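(* (a) For some $\alpha,\delta\in\mathbb R$ let $(V_t)_{t\in\mathbb R}$ be a $\delta$-translatively stable wide-sense OU-type process with parameter $\lambda=\delta/2-\alpha$ and driving process $(Y_t)_{t\in\mathbb R}=\big(L(\tfrac{e^{\delta t}-1}{e^\delta-1})\big)_{t\in\mathbb R}$, where $(L(t))_{t\in\mathbb R}$ is a two-sided Lévy process. If $e^{(\alpha-\delta/2)t}V_t\to0$ in probability as $t\downarrow-\infty$, then $(V_t)_{t\in\mathbb R}$ has the integral representation $$V_t=\int_{-\infty}^te^{(u-t)(\alpha-\delta/2)}\,dY_u .$$ (b) Let $\delta\ne0$, let $(L(t))_{t\in\mathbb R}$ be a two-sided Lévy process and let $(Y_t)_{t\in\mathbb R}=\big(L(\tfrac{e^{\delta t}-1}{e^\delta-1})\big)_{t\in\mathbb R}$ be the time-changed Lévy process. Suppose that for some $\alpha\in\mathbb R$ one of the following conditions is fulfilled: (i) $\delta>0$ and $\alpha>\delta/2$; (ii) $\delta<0$, $\alpha>-\delta/2$ and $\displaystyle\sup_{\frac1\delta\log2\le s\le0}\mathbb E\left[\Big|\int_s^0e^{t(\alpha-\delta/2)}\,dY_t\Big|^{\gamma}\right]<\infty$ for some $\gamma>\frac{-\delta}{\alpha+\delta/2}$. Then the process $(V_t)_{t\in\mathbb R}$ given by $$V_t:=\int_{-\infty}^te^{(u-t)(\alpha-\delta/2)}\,dY_u$$ is well-defined (the integrals exist as almost sure limits) and is a $\delta$-translatively stable wide-sense OU-type process with parameter $\lambda=\delta/2-\alpha$ and driving process $(Y_t)_{t\in\mathbb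 R}$.
   Context: All processes are real-valued. An additive process $(Y_t)_{t\in\mathbb R}$ is a process such that: (i) for any $t_0<t_1<\dots<t_n$ in $\mathbb R$ the increments $Y_{t_1}-Y_{t_0},\dots,Y_{t_n}-Y_{t_{n-1}}$ are independent; (ii) it is stochastically continuous; (iii) almost surely its paths are right-continuous with left limits (càdlàg); (iv) $Y_0=0$ almost surely. A process is infinitely divisible if all its finite-dimensional distributions are. For an infinitely divisible process $V$, $\Psi^V_{t_1,\dots,t_k}:\mathbb R^k\to\mathbb C$ denotes the log-characteristic function (Lévy exponent) of $(V_{t_1},\dots,V_{t_k})$, i.e. the unique continuous function with $\Psi^V_{t_1,\dots,t_k}(0,\dots,0)=0$ and $\mathbb E[\exp(i\sum_j\theta_jV_{t_j})]=\exp(\Psi^V_{t_1,\dots,t_k}(\theta_1,\dots,\theta_k))$. An infinitely divisible process $(V_t)_{t\in\mathbb R}$ is $\delta$-translatively stable if $\Psi^V_{t_1+T,\dots,t_k+T}(\theta_1,\dots,\theta_k)=e^{\delta T}\Psi^V_{t_1,\dots,t_k}(\theta_1,\dots,\theta_k)$ for all $T\in\mathbb R$, $k\in\mathbb N$, $t_1,\dots,t_k,\theta_1,\dots,\theta_k\in\mathbb R$. Random integral: for a process $Y$ with càdlàg paths, a continuously differentiable function $A$ and $a<b$, $\int_a^bA(t)\,dY_t:=A(b)Y_b-A(a)Y_a-\int_a^bA'(t)Y_t\,dt$ (pathwise Riemann integral), and $\int_b^aA(t)\,dY_t:=-\int_a^bA(t)\,dY_t$. $\int_{-\infty}^{b}A(t)\,dY_t$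 denotes the almost sure limit of $\int_a^bA(t)\,dY_t$ as $a\downarrow-\infty$; identities between random integrals hold almost surely. For an additive process $(Y_t)_{t\in\mathbb R}$, a process $(U_t)_{t\in\mathbb R}$ is called a wide-sense OU-type process with parameter $\lambda\in\mathbb R$ and (background) driving process $Y$ if $U_t=e^{\lambda t}\big(U_0+\int_0^te^{-\lambda s}\,dY_s\big)$ for all $t\in\mathbb R$. Two-sided Lévy process generated by the law of an infinitely divisible random variable: $L(t)=L^{(1)}(t)$ for $t\ge0$ and $L(t)=-L^{(2)}((-t)-)$ for $t<0$ (left limit at $-t$), where $L^{(1)},L^{(2)}$ are independent copies of the (càdlàg) Lévy process whose value at time $1$ has that law. For $\delta=0$ the time change $\frac{e^{\delta t}-1}{e^\delta-1}$ is understood as its limit $t$. *)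

theory Defs
  imports "HOL-Probability.Probability"
begin

text \<open>
  A process is a family \<open>X :: real \<Rightarrow> 'a \<Rightarrow> real\<close> on a probability space \<open>M\<close>; a time domain
  \<open>I\<close> is given explicitly, so that processes on \<open>{0..}\<close> and on \<open>UNIV\<close> share their definitions.
\<close>

definition process_on :: "'a measure \<Rightarrow> real set \<Rightarrow> (real \<Rightarrow> 'a \<Rightarrow> real) \<Rightarrow> bool" where
  "process_on M I X \<longleftrightarrow> (\<forall>t\<in>I. X t \<in> borel_measurable M)"

definition tendsto_in_prob ::
    "'a measure \<Rightarrow> ('i \<Rightarrow> 'a \<Rightarrow> real) \<Rightarrow> ('a \<Rightarrow> real) \<Rightarrow> 'i filter \<Rightarrow> bool" where
  "tendsto_in_prob M X Z F \<longleftrightarrow>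
    (\<forall>\<epsilon>>0. ((\<lambda>t. measure M {\<omega> \<in> space M. \<bar>X t \<omega> - Z \<omega>\<bar> > \<epsilon>}) \<longlongrightarrow> 0) F)"

text \<open>At a left endpoint of \<open>I\<close> the left limit is taken along the trivial filter, so nothing is
  required there.\<close>

definition cadlag_on :: "real set \<Rightarrow> (real \<Rightarrow> real) \<Rightarrow> bool" where
  "cadlag_on I f \<longleftrightarrow>
    (\<forall>t\<in>I. (f \<longlongrightarrow> f t) (at t within (I \<inter> {t<..})) \<and>
           (\<exists>l. (f \<longlongrightarrow> l) (at t within (I \<inter> {..<t}))))"

definition independent_increments_on ::
    "'a measure \<Rightarrow> real set \<Rightarrow> (real \<Rightarrow> 'a \<Rightarrow> real) \<Rightarrow> bool" where
  "independent_increments_on M I X \<longleftrightarrow>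
    (\<forall>(n::nat) t. (\<forall>i\<le>n. t i \<in> I) \<and> (\<forall>i<n. t i < t (Suc i)) \<longrightarrow>
      prob_space.indep_vars M (\<lambda>_. borel) (\<lambda>i \<omega>. X (t (Suc i)) \<omega> - X (t i) \<omega>) {..<n})"

definition additive_process_on ::
    "'a measure \<Rightarrow> real set \<Rightarrow> (real \<Rightarrow> 'a \<Rightarrow> real) \<Rightarrow> bool" where
  "additive_process_on M I X \<longleftrightarrow>
    process_on M I X \<and>
    independent_increments_on M I X \<and>
    (\<forall>t\<in>I. tendsto_in_prob M X (X t) (at t within I)) \<and>
    (AE \<omega> in M. cadlag_on I (\<lambda>t. X t \<omega>)) \<and>
    (AE \<omega> in M. X 0 \<omega> = 0)"

abbreviation additive_process :: "'a measure \<Rightarrow> (real \<Rightarrow> 'a \<Rightarrow> real) \<Rightarrow> bool" where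
  "additive_process M Y \<equiv> additive_process_on M UNIV Y"

definition levy_process :: "'a measure \<Rightarrow> (real \<Rightarrow> 'a \<Rightarrow> real) \<Rightarrow> bool" where
  "levy_process M X \<longleftrightarrow>
    additive_process_on M {0..} X \<and>
    (\<forall>s t h. 0 \<le> s \<and> s \<le> t \<and> 0 \<le> h \<longrightarrow>
      distr M borel (\<lambda>\<omega>. X (t + h) \<omega> - X (s + h) \<omega>) = distr M borel (\<lambda>\<omega>. X t \<omega> - X s \<omega>))"

text \<open>The common law of \<open>L1 1\<close> and \<open>L2 1\<close>, which generates the process, is automatically
  infinitely divisible. The left limits of \<open>L2\<close> exist only almost surely, so the pathwise
  description of \<open>L\<close> is imposed almost surely and measurability of \<open>L t\<close> separately.\<close>

definition two_sided_levy_process :: "'a measure \<Rightarrow> (real \<Rightarrow> 'a \<Rightarrow> real) \<Rightarrow> bool" where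
  "two_sided_levy_process M L \<longleftrightarrow>
    process_on M UNIV L \<and>
    (\<exists>L1 L2. levy_process M L1 \<and> levy_process M L2 \<and>
      distr M borel (L1 1) = distr M borel (L2 1) \<and>
      prob_space.indep_var M
        (PiM {0..} (\<lambda>_. borel)) (\<lambda>\<omega>. \<lambda>t\<in>{0..}. L1 t \<omega>)
        (PiM {0..} (\<lambda>_. borel)) (\<lambda>\<omega>. \<lambda>t\<in>{0..}. L2 t \<omega>) \<and>
      (AE \<omega> in M. (\<forall>t\<ge>0. L t \<omega> = L1 t \<omega>) \<and>
                   (\<forall>t<0. L t \<omega> = - Lim (at_left (- t)) (\<lambda>s. L2 s \<omega>))))"

definition time_change :: "real \<Rightarrow> real \<Rightarrow> real" where
  "time_change \<delta> t = (if \<delta> = 0 then t else (exp (\<delta> * t) - 1) / (exp \<delta> - 1))"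

definition time_changed :: "real \<Rightarrow> (real \<Rightarrow> 'a \<Rightarrow> real) \<Rightarrow> real \<Rightarrow> 'a \<Rightarrow> real" where
  "time_changed \<delta> L = (\<lambda>t. L (time_change \<delta> t))"

text \<open>
  Vectors in \<open>\<real>\<^sup>k\<close> are extensional functions on \<open>{..<k}\<close>. A law on \<open>\<real>\<^sup>k\<close> is infinitely divisible
  if for each \<open>n \<ge> 1\<close> it is the law of a sum of \<open>n\<close> i.i.d. random vectors.
\<close>

definition infinitely_divisible :: "nat \<Rightarrow> (nat \<Rightarrow> real) measure \<Rightarrow> bool" where
  "infinitely_divisible k \<mu> \<longleftrightarrow>
    (\<forall>n::nat. n \<ge> 1 \<longrightarrow>
      (\<exists>\<nu>. prob_space \<nu> \<and> sets \<nu> = sets (PiM {..<k} (\<lambda>_. borel)) \<and>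
        \<mu> = distr (PiM {..<n} (\<lambda>_. \<nu>)) (PiM {..<k} (\<lambda>_. borel))
              (\<lambda>x. \<lambda>j\<in>{..<k}. \<Sum>i<n. x i j)))"

definition infinitely_divisible_process :: "'a measure \<Rightarrow> (real \<Rightarrow> 'a \<Rightarrow> real) \<Rightarrow> bool" where
  "infinitely_divisible_process M V \<longleftrightarrow>
    process_on M UNIV V \<and>
    (\<forall>k t. infinitely_divisible k
      (distr M (PiM {..<k} (\<lambda>_. borel)) (\<lambda>\<omega>. \<lambda>j\<in>{..<k}. V (t j) \<omega>)))"

text \<open>The log-characteristic function of the random vector \<open>(X 0, \<dots>, X (k - 1))\<close>;
  extensionality makes the description unique as a HOL function.\<close>

definition log_char ::
    "'a measure \<Rightarrow> nat \<Rightarrow> (nat \<Rightarrow> 'a \<Rightarrow> real) \<Rightarrow> (nat \<Rightarrow> real) \<Rightarrow> complex" where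
  "log_char M k X = (THE \<Psi>.
    \<Psi> \<in> extensional ({..<k} \<rightarrow>\<^sub>E UNIV) \<and>
    continuous_map (powertop_real {..<k}) euclidean \<Psi> \<and>
    \<Psi> (\<lambda>j\<in>{..<k}. 0) = 0 \<and>
    (\<forall>\<theta> \<in> {..<k} \<rightarrow>\<^sub>E UNIV. (CLINT \<omega>|M. iexp (\<Sum>j<k. \<theta> j * X j \<omega>)) = exp (\<Psi> \<theta>)))"

definition translatively_stable ::
    "'a measure \<Rightarrow> real \<Rightarrow> (real \<Rightarrow> 'a \<Rightarrow> real) \<Rightarrow> bool" where
  "translatively_stable M \<delta> V \<longleftrightarrow>
    infinitely_divisible_process M V \<and>
    (\<forall>T k t. \<forall>\<theta> \<in> {..<k} \<rightarrow>\<^sub>E UNIV.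
      log_char M k (\<lambda>j. V (t j + T)) \<theta> =
      complex_of_real (exp (\<delta> * T)) * log_char M k (\<lambda>j. V (t j)) \<theta>)"

text \<open>\<open>cadlag_integral A y a b\<close> is the integral of the continuously differentiable function \<open>A\<close>
  along the cadlag path \<open>y\<close>, defined by integration by parts. The integrand \<open>A' y\<close> is Riemann
  integrable in that case, so the Henstock-Kurzweil integral is the Riemann integral.\<close>

definition cadlag_integral ::
    "(real \<Rightarrow> real) \<Rightarrow> (real \<Rightarrow> real) \<Rightarrow> real \<Rightarrow> real \<Rightarrow> real" where
  "cadlag_integral A y a b =
    (let J = (\<lambda>a b. A b * y b - A a * y a - integral {a..b} (\<lambda>t. deriv A t * y t))
     in if a \<le> b then J a b else - J b a)"

text \<open>\<open>has_left_improper_integral M A Y b Z\<close>: the integral of \<open>A\<close> with respect to \<open>Y\<close> over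
  \<open>(-\<infinity>, b]\<close> exists as an almost sure limit and equals the random variable \<open>Z\<close> (which is thereby
  determined up to null sets).\<close>

definition has_left_improper_integral ::
    "'a measure \<Rightarrow> (real \<Rightarrow> real) \<Rightarrow> (real \<Rightarrow> 'a \<Rightarrow> real) \<Rightarrow> real \<Rightarrow> ('a \<Rightarrow> real) \<Rightarrow> bool" where
  "has_left_improper_integral M A Y b Z \<longleftrightarrow>
    Z \<in> borel_measurable M \<and>
    (AE \<omega> in M. ((\<lambda>a. cadlag_integral A (\<lambda>t. Y t \<omega>) a b) \<longlongrightarrow> Z \<omega>) at_bot)"

definition wide_sense_OU ::
    "'a measure \<Rightarrow> real \<Rightarrow> (real \<Rightarrow> 'a \<Rightarrow> real) \<Rightarrow> (real \<Rightarrow> 'a \<Rightarrow> real) \<Rightarrow> bool" where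
  "wide_sense_OU M r Y U \<longleftrightarrow>
    additive_process M Y \<and> process_on M UNIV U \<and>
    (\<forall>t. AE \<omega> in M. U t \<omega> =
      exp (r * t) * (U 0 \<omega> + cadlag_integral (\<lambda>s. exp (- r * s)) (\<lambda>s. Y s \<omega>) 0 t))"

end

theory Submission
  imports Defs
begin

text \<open>
  Write \<open>k = \<alpha> - \<delta>/2\<close>, \<open>Y\<close> for the time-changed process and \<open>W\<^sub>t\<close> for \<open>\<integral>\<^sub>0\<^sup>t e\<^bsup>ku\<^esup> dY\<^sub>u\<close>. The improper integral is
  \<open>e\<^bsup>-kt\<^esup> (W\<^sub>t - W\<^sub>-\<^sub>\<infinity>)\<close>, so everything hinges on the almost sure existence of \<open>W\<^sub>-\<^sub>\<infinity>\<close>.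
  As \<open>W\<close> has independent increments and right-continuous paths, Ottaviani's inequality upgrades the
  Cauchy property in probability at \<open>-\<infinity>\<close> to almost sure convergence. In part (a) that property is the
  hypothesis \<open>e\<^bsup>kt\<^esup> V\<^sub>t = V\<^sub>0 + W\<^sub>t \<rightarrow> 0\<close>. In part (b), \<open>\<delta> < 0\<close>, put \<open>T\<^sub>n = n ln 2 / \<delta>\<close>; then
  \<open>e\<^bsup>-kT\<^sub>n\<^esup> (W(T\<^sub>n) - W(s + T\<^sub>n))\<close> is in law a sum of \<open>2\<^sup>n\<close> independent copies of \<open>W(0) - W(s)\<close>, which bounds its
  moments of order \<open>min 1 \<gamma>\<close> and makes the increments decay geometrically. For \<open>\<delta> > 0\<close> the paths of \<open>Y\<close>
  converge at \<open>-\<infinity>\<close> and the limit exists pathwise.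

  A shift of time by \<open>T\<close> scales the increments of the time change by \<open>c = e\<^bsup>\<delta>T\<^esup>\<close>. Through Riemann sums, the
  characteristic functions of the shifted finite-dimensional distributions therefore form a multiplicative
  semigroup in \<open>c\<close>; it tends to 1 as \<open>c\<close> tends to 0, hence has the form \<open>exp (c \<Psi>)\<close>. This gives
  infinite divisibility and translative stability.
\<close>

section \<open>Multiplicative functions and continuous logarithms\<close>

text \<open>The obstacle is the logarithm. For the Riemann sums only the exponentials of the
  exponents \<open>K n\<close> are shown to converge, not the exponents themselves. The sums are
  therefore arranged so that a shift by \<open>T\<close> leaves the weights alone and multiplies
  \<open>K n\<close> by \<open>c = exp (\<delta> * T)\<close>. Identities such as
  \<open>exp ((c + c') * K n) = exp (c * K n) * exp (c' * K n)\<close>, or an integer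
  \<open>c\<close> turning into a power, then pass to the limit without any choice of branch. A
  logarithm is taken only afterwards, from the whole semigroup in \<open>c\<close>, and knowing all
  \<open>c > 0\<close> is also what makes it continuous in the frequencies.

  The limit 1 as \<open>c\<close> tends to 0 comes from opposite ends of the time axis: the shift
  \<open>ln c / \<delta>\<close> runs to the left end for \<delta> > 0 and to the right end for
  \<delta> < 0. In both cases the time change approaches the finite time
  \<open>-1 / (exp \<delta> - 1)\<close>, so Y converges there and the integral process tends to 0.

  For \<delta> < 0, \<alpha> > -\<delta>/2 means k > -\<delta>. With the bound on \<gamma> it gives
  \<open>k * min 1 \<gamma> > - \<delta>\<close>, which says that the ratio
  \<open>2 * exp (k * min 1 \<gamma> * ln 2 / \<delta>)\<close> of the geometric decay is below
  1.\<close>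

lemma multiplicative_eq_exp:
  fixes f :: "real \<Rightarrow> complex"
  assumes mult: "\<And>s t. 0 < s \<Longrightarrow> 0 < t \<Longrightarrow> f (s + t) = f s * f t"
    and lim: "(f \<longlongrightarrow> 1) (at_right 0)"
  obtains z where "\<And>t. 0 < t \<Longrightarrow> f t = exp (of_real t * z)"
proof -
  \<comment> \<open>Filling in the limit value 1 at 0 makes the functional equation valid on the
    closed half-line, where integrals starting at 0 can be used.\<close>
  define g where "g t = (if t \<le> 0 then 1 else f t)" for t
  have g0: "g 0 = 1" by (simp add: g_def)
  have gm: "g (s + t) = g s * g t" if "0 \<le> s" "0 \<le> t" for s t
    using that mult[of s t] by (auto simp: g_def)
  have glim: "(g \<longlongrightarrow> 1) (at_right 0)"
    using lim by (rule Lim_transform_eventually) (auto simp: g_def eventually_at_filter)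
  \<comment> \<open>Continuity at 0 spreads by the functional equation. To the right of
    \<open>t\<close> the factor \<open>g t\<close> is fixed; to the left, \<open>g s\<close> is
    under control because \<open>g (t - s)\<close> has norm at least 1/2, whence the cap 1/2 in
    \<open>e'\<close>.\<close>
  have cont: "continuous_on {0..} g"
    unfolding continuous_on_iff
  proof (intro ballI allI impI)
    fix t e :: real assume t: "t \<in> {0..}" and e: "0 < e"
    define K where "K = norm (g t) + 1"
    have K: "K > 0" by (simp add: K_def add_nonneg_pos)
    define e' where "e' = min (1/2) (e / (2 * K))"
    have e': "e' > 0" using K e by (simp add: e'_def)
    from tendstoD[OF glim e'] obtain d where d: "d > 0" "\<And>h. 0 < h \<Longrightarrow> h < d \<Longrightarrow> dist (g h) 1 < e'"
      by (auto simp: eventually_at_right_field)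
    have "dist (g s) (g t) < e" if s: "s \<in> {0..}" and st: "dist s t < d" for s
    proof (cases s t rule: linorder_cases)
      case equal then show ?thesis using e by simp
    next
      case greater
      then have "g s = g t * g (s - t)" using gm[of t "s - t"] t by simp
      then have "dist (g s) (g t) = norm (g t) * dist (g (s - t)) 1"
        by (simp add: dist_norm norm_mult[symmetric] algebra_simps)
      also have "\<dots> \<le> norm (g t) * e'"
        using d(2)[of "s - t"] greater st by (intro mult_left_mono) (auto simp: dist_real_def less_imp_le)
      also have "\<dots> \<le> K * (e / (2 * K))" using e K
        by (intro mult_mono) (auto simp: e'_def K_def)
      also have "\<dots> < e" using K e by simp
      finally show ?thesis .
    next
      case less
      have eq: "g t = g s * g (t - s)" using gm[of s "t - s"] s less by simp
      have dd: "dist (g (t - s)) 1 < e'" using d(2)[of "t - s"] less st by (auto simp: dist_real_def)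
      then have "norm (g (t - s)) \<ge> 1/2"
        using norm_triangle_ineq2[of 1 "1 - g (t - s)"] by (simp add: dist_norm norm_minus_commute e'_def)
      then have "norm (g s) * (1/2) \<le> norm (g t)" unfolding eq norm_mult by (intro mult_left_mono) auto
      then have le: "norm (g s) < 2 * K" using K by (simp add: K_def)
      have "dist (g s) (g t) = norm (g s) * dist 1 (g (t - s))"
        unfolding eq by (simp add: dist_norm norm_mult[symmetric] algebra_simps)
      also have "\<dots> \<le> norm (g s) * e'"
        using dd by (intro mult_left_mono) (auto simp: dist_commute)
      also have "\<dots> \<le> norm (g s) * (e / (2 * K))" by (intro mult_left_mono) (auto simp: e'_def)
      also have "\<dots> < 2 * K * (e / (2 * K))" using le e K by (intro mult_strict_right_mono) auto
      also have "\<dots> = e" using K by simp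
      finally show ?thesis .
    qed
    then show "\<exists>d>0. \<forall>s\<in>{0..}. dist s t < d \<longrightarrow> dist (g s) (g t) < e" using d by blast
  qed
  from tendstoD[OF glim, of "1/2"] obtain d where d: "d > 0" "\<And>h. 0 < h \<Longrightarrow> h < d \<Longrightarrow> dist (g h) 1 < 1/2"
    by (auto simp: eventually_at_right_field)
  define r where "r = d / 2"
  have r': "norm (g h - 1) \<le> 1/2" if "h \<in> {0..r}" for h
  proof (cases "h = 0")
    case False
    then show ?thesis using d(2)[of h] d(1) that by (auto simp: dist_norm r_def)
  qed (simp add: g0)
  have r: "r > 0" "\<And>h. h \<in> {0..r} \<Longrightarrow> norm (g h - 1) \<le> 1/2"
    using r' d by (auto simp: r_def)
  \<comment> \<open>Integration upgrades continuity to differentiability: the functional equation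
    gives \<open>g t * F r = F (t + r) - F t\<close>, and \<open>F r\<close> is nonzero because
    \<open>g\<close> stays within 1/2 of 1 on \<open>{0..r}\<close>.\<close>
  define F where "F x = integral {0..x} g" for x
  have int: "g integrable_on {0..x}" for x
    by (intro integrable_continuous_interval continuous_on_subset[OF cont]) auto
  have Fr: "F r \<noteq> 0"
  proof
    assume "F r = 0"
    have "integral {0..r} (\<lambda>x. g x - 1) = F r - of_real r"
      using r(1) by (subst integral_diff[OF int]) (auto simp: F_def scaleR_conv_of_real)
    moreover have "norm (integral {0..r} (\<lambda>x. g x - 1)) \<le> 1/2 * (r - 0)"
      using r by (intro integral_bound) (auto intro!: continuous_intros continuous_on_subset[OF cont])
    ultimately show False using \<open>F r = 0\<close> r(1) by simp
  qed
  have Fd: "(F has_vector_derivative g x) (at x within {0..N})" if "x \<in> {0..N}" for x N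
    unfolding F_def using that
    by (intro integral_has_vector_derivative continuous_on_subset[OF cont]) auto
  have key: "g t * F r = F (t + r) - F t" if "t \<ge> 0" for t
  proof -
    have "g t * F r = integral {0..r} (\<lambda>s. g t * g s)" unfolding F_def by simp
    also have "\<dots> = integral {0..r} (\<lambda>s. g (t + s))" using gm that by (intro integral_cong) auto
    also have "\<dots> = integral {t..t+r} g"
      using integral_shift_Icc_real[of 0 r g t] by (simp add: o_def add.commute)
    also have "\<dots> = F (t + r) - F t"
      using Henstock_Kurzweil_Integration.integral_combine[of 0 t "t+r" g] int that r(1) by (simp add: F_def algebra_simps)
    finally show ?thesis .
  qed
  define z where "z = (g r - 1) / F r"
  have gd: "(g has_vector_derivative z * g t) (at t within {0..N})" if t: "t \<in> {0..N}" for t N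
  proof -
    have "((\<lambda>t. (F (t + r) - F t) / F r) has_vector_derivative (g (t + r) - g t) / F r) (at t within {0..N})"
    proof (intro derivative_intros has_vector_derivative_divide)
      have "((F \<circ> (\<lambda>t. t + r)) has_vector_derivative 1 *\<^sub>R g (t + r)) (at t within {0..N})"
      proof (rule vector_diff_chain_within)
        show "((\<lambda>t. t + r) has_vector_derivative 1) (at t within {0..N})"
          by (auto intro!: derivative_eq_intros)
        show "(F has_vector_derivative g (t + r)) (at (t + r) within (\<lambda>t. t + r) ` {0..N})"
          by (rule has_vector_derivative_within_subset[OF Fd[of _ "N + r"]]) (use t r(1) in auto)
      qed
      then show "((\<lambda>t. F (t + r)) has_vector_derivative g (t + r)) (at t within {0..N})" by (simp add: o_def)
      show "(F has_vector_derivative g t) (at t within {0..N})" using Fd t by auto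
    qed
    moreover have "(g (t + r) - g t) / F r = z * g t"
      using gm[of t r] t r(1) by (simp add: z_def field_simps)
    moreover have "(F (s + r) - F s) / F r = g s" if "s \<in> {0..N}" for s
      using key[of s] Fr that by (simp add: field_simps)
    ultimately show ?thesis
      by (metis (no_types, lifting) has_vector_derivative_transform t)
  qed
  have "f t = exp (of_real t * z)" if t: "t > 0" for t
  proof -
    have "((\<lambda>s. g s * exp (- (of_real s * z))) has_vector_derivative 0) (at s within {0..t})" if "s \<in> {0..t}" for s
    proof -
      have e: "((\<lambda>s. exp (- (of_real s * z))) has_vector_derivative (- z * exp (- (of_real s * z)))) (at s within {0..t})"
      proof -
        have "((\<lambda>w. exp (- (w * z))) has_field_derivative (- z * exp (- (of_real s * z)))) (at (of_real s))"
          by (auto intro!: derivative_eq_intros)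
        then show ?thesis by (intro has_vector_derivative_real_field has_vector_derivative_at_within)
      qed
      show ?thesis
        by (rule has_vector_derivative_eq_rhs[OF has_vector_derivative_mult[OF gd[OF that] e]])
           (simp add: algebra_simps)
    qed
    then obtain c where c: "\<And>s. s \<in> {0..t} \<Longrightarrow> g s * exp (- (of_real s * z)) = c"
      using has_vector_derivative_zero_constant[of "{0..t}" "\<lambda>s. g s * exp (- (of_real s * z))"] by auto
    from c[of 0] c[of t] t have "g t * exp (- (of_real t * z)) = 1" by (simp add: g0)
    then have "g t = exp (of_real t * z)" by (simp add: exp_minus divide_simps split: if_splits)
    then show ?thesis using t by (simp add: g_def)
  qed
  then show ?thesis using that by blast
qed

text \<open>One exponential would determine the limit only up to multiples of
  \<open>2 * pi * \<i>\<close>; all powers exclude such drift. With \<open>y = x - l\<close>, the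
  number \<open>y n\<close> times the integral of \<open>exp (c * y n)\<close> over \<open>c\<close>
  in [0, 1] equals \<open>exp (y n) - 1\<close>, and dominated convergence sends that integral to 1.
  The bound on the real parts supplies the dominating constant.\<close>

lemma tendsto_log_if_all_powers_tendsto:
  fixes x :: "nat \<Rightarrow> complex" and l :: complex
  assumes lim: "\<And>c::real. 0 < c \<Longrightarrow> (\<lambda>n. exp (of_real c * x n)) \<longlonglongrightarrow> exp (of_real c * l)"
    and re: "\<And>n. Re (x n) \<le> 0"
  shows "x \<longlonglongrightarrow> l"
proof -
  define y where "y n = x n - l" for n
  have y: "(\<lambda>n. exp (of_real c * y n)) \<longlonglongrightarrow> 1" if "c > 0" for c :: real
    using tendsto_divide[OF lim[OF that] tendsto_const[of "exp (of_real c * l)"]]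
    by (simp add: y_def exp_diff right_diff_distrib)
  have bnd: "norm (exp (of_real c * y n)) \<le> exp (\<bar>Re l\<bar>)" if "c \<in> {0..1}" for c n
  proof -
    have "c * Re (y n) \<le> c * \<bar>Re l\<bar>" using that re[of n] by (intro mult_left_mono) (auto simp: y_def)
    also have "\<dots> \<le> \<bar>Re l\<bar>" using that mult_right_mono[of c 1 "\<bar>Re l\<bar>"] by simp
    finally show ?thesis by simp
  qed
  have I: "(\<lambda>n. integral {0..1::real} (\<lambda>c. exp (of_real c * y n))) \<longlonglongrightarrow> integral {0..1::real} (\<lambda>c. 1)"
  proof (rule dominated_convergence(2)[where h = "\<lambda>_. exp \<bar>Re l\<bar>"])
    show "(\<lambda>c. exp (of_real c * y n)) integrable_on {0..1}" for n
      by (intro integrable_continuous_interval continuous_intros)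
    show "(\<lambda>n. exp (complex_of_real c * y n)) \<longlonglongrightarrow> 1" if "c \<in> {0..1}" for c
      using y[of c] that by (cases "c = 0") auto
  qed (use bnd in auto)
  have eq: "y n * integral {0..1} (\<lambda>c. exp (of_real c * y n)) = exp (y n) - 1" for n
  proof -
    have "((\<lambda>c. y n * exp (of_real c * y n)) has_integral (exp (of_real 1 * y n) - exp (of_real 0 * y n))) {0..1::real}"
    proof (rule fundamental_theorem_of_calculus)
      fix c :: real
      have "((\<lambda>z. exp (z * y n)) has_field_derivative y n * exp (of_real c * y n)) (at (of_real c))"
        by (auto intro!: derivative_eq_intros)
      then show "((\<lambda>c. exp (of_real c * y n)) has_vector_derivative y n * exp (of_real c * y n)) (at c within {0..1})"
        by (intro has_vector_derivative_real_field has_vector_derivative_at_within)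
    qed simp
    then show ?thesis by (simp add: integral_unique flip: integral_mult_right)
  qed
  have "(\<lambda>n. (exp (y n) - 1) / integral {0..1} (\<lambda>c. exp (of_real c * y n))) \<longlonglongrightarrow> (1 - 1) / integral {0..1::real} (\<lambda>c. 1)"
    using y[of 1] by (intro tendsto_intros I) auto
  moreover have "eventually (\<lambda>n. integral {0..1} (\<lambda>c. exp (of_real c * y n)) \<noteq> 0) sequentially"
    by (rule tendsto_imp_eventually_ne[OF I]) auto
  then have "eventually (\<lambda>n. (exp (y n) - 1) / integral {0..1} (\<lambda>c. exp (of_real c * y n)) = y n) sequentially"
    by eventually_elim (simp flip: eq)
  ultimately have "y \<longlonglongrightarrow> 0" by (simp add: Lim_transform_eventually)
  then show ?thesis unfolding y_def by (simp add: LIM_zero_iff)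
qed

text \<open>The difference is continuous with values in the multiples of
  \<open>2 * pi * \<i>\<close>, a discrete set, so it is constant on the connected line.\<close>

lemma continuous_log_unique:
  fixes f g :: "real \<Rightarrow> complex"
  assumes "continuous_on UNIV f" "continuous_on UNIV g" "\<And>t. exp (f t) = exp (g t)" "f 0 = g 0"
  shows "f t = g t"
proof -
  have "(\<lambda>t. f t - g t) constant_on UNIV"
  proof (rule continuous_discrete_range_constant)
    show "connected (UNIV::real set)" by simp
    show "continuous_on UNIV (\<lambda>t. f t - g t)" by (intro continuous_intros assms)
    fix t
    have int: "\<exists>n::int. f t - g t = of_int (2 * n) * pi * \<i>" for t
      using assms(3)[of t] unfolding exp_eq by (auto simp: algebra_simps)
    show "\<exists>e>0. \<forall>s. s \<in> UNIV \<and> f s - g s \<noteq> f t - g t \<longrightarrow> e \<le> cmod (f s - g s - (f t - g t))"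
    proof (intro exI[of _ 1] conjI allI impI)
      fix s assume ne: "s \<in> UNIV \<and> f s - g s \<noteq> f t - g t"
      obtain m n where m: "f s - g s = of_int (2 * m) * pi * \<i>" and n: "f t - g t = of_int (2 * n) * pi * \<i>"
        using int by blast
      have mn: "m \<noteq> n" using ne m n by auto
      have "f s - g s - (f t - g t) = of_real (2 * pi * of_int (m - n)) * \<i>"
        unfolding m n by (simp add: algebra_simps)
      then have "cmod (f s - g s - (f t - g t)) = 2 * pi * \<bar>of_int (m - n)\<bar>"
        by (simp only: norm_mult norm_of_real) (simp add: abs_mult)
      moreover have "\<bar>of_int (m - n)\<bar> \<ge> (1::real)" using mn by linarith
      ultimately show "1 \<le> cmod (f s - g s - (f t - g t))"
        using mult_mono[of 1 "2*pi" 1 "\<bar>of_int (m - n)\<bar> :: real"] pi_gt3 by simp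
    qed simp
  qed
  then obtain c where "\<And>t. f t - g t = c" by (auto simp: constant_on_def)
  with assms(4) show ?thesis by (metis eq_iff_diff_eq_0)
qed

section \<open>Characteristic functions of random vectors\<close>

context prob_space begin

lemma char_distr_eq:
  assumes [measurable]: "X \<in> borel_measurable M"
  shows "char (distr M borel X) t = (CLINT \<omega>|M. iexp (t * X \<omega>))"
  unfolding char_def by (subst integral_distr) auto

lemma integrable_iexp_real:
  assumes [measurable]: "f \<in> borel_measurable M"
  shows "integrable M (\<lambda>\<omega>. iexp (f \<omega>))"
  by (rule integrable_const_bound[of _ 1]) (auto simp: norm_exp_i_times)

end

text \<open>Levy's uniqueness theorem speaks of probability laws only; dividing a bounded
  nonnegative weight by its mass produces one to which it can be applied.\<close>

lemma weighted_distribution: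
  fixes W X :: "'a \<Rightarrow> real"
  assumes "prob_space M" and [measurable]: "X \<in> borel_measurable M" "W \<in> borel_measurable M"
    and "\<forall>x\<in>space M. 0 \<le> W x \<and> W x \<le> B"
    and m: "m = (LINT x|M. W x)" "0 < m"
  defines "N \<equiv> distr (density M (\<lambda>x. W x / m)) borel X"
  shows "real_distribution N"
    and "char N s = (CLINT x|M. of_real (W x) * iexp (s * X x)) / of_real m"
    and "A \<in> sets borel \<Longrightarrow> (LINT x|N. indicator A x) = (LINT x|M. W x * indicator A (X x)) / m"
proof -
  interpret prob_space M by fact
  have W: "0 \<le> W x" "W x \<le> B" if "x \<in> space M" for x using assms(4) that by auto
  have int: "integrable M W"
    by (auto intro!: integrable_const_bound[of _ B] simp: W)
  have "prob_space (density M (\<lambda>x. W x / m))"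
  proof
    have "emeasure (density M (\<lambda>x. W x / m)) (space (density M (\<lambda>x. W x / m))) = (\<integral>\<^sup>+x. ennreal (W x / m) \<partial>M)"
      by (subst emeasure_density) (auto intro!: nn_integral_cong)
    also have "\<dots> = ennreal (LINT x|M. W x / m)"
      using W m int by (intro nn_integral_eq_integral) auto
    finally show "emeasure (density M (\<lambda>x. W x / m)) (space (density M (\<lambda>x. W x / m))) = 1"
      using m by simp
  qed
  then show "real_distribution N" unfolding N_def
    by (intro prob_space.real_distribution_distr) auto
  have "char N s = (CLINT x|M. (W x / m) *\<^sub>R iexp (s * X x))"
    unfolding char_def N_def using W m
    by (subst integral_distr) (auto intro!: integral_density)
  also have "\<dots> = (CLINT x|M. of_real (W x) * iexp (s * X x)) / of_real m"
    unfolding scaleR_conv_of_real by (subst integral_divide_zero[symmetric]) (auto intro!: Bochner_Integration.integral_cong)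
  finally show "char N s = (CLINT x|M. of_real (W x) * iexp (s * X x)) / of_real m" .
  assume [measurable]: "A \<in> sets borel"
  have "(LINT x|N. indicator A x) = (LINT x|M. (W x / m) *\<^sub>R indicator A (X x) :: real)"
    unfolding N_def by (subst integral_distr, simp, simp, subst integral_density) (use W m in auto)
  then show "(LINT x|N. indicator A x) = (LINT x|M. W x * indicator A (X x)) / m" by simp
qed

lemma weighted_char_eq_imp_indicator:
  fixes W W' X X' :: "_ \<Rightarrow> real"
  assumes "prob_space M" "prob_space M'"
    and [measurable]: "X \<in> borel_measurable M" "X' \<in> borel_measurable M'"
    and W: "W \<in> borel_measurable M" "\<And>x. x \<in> space M \<Longrightarrow> 0 \<le> W x \<and> W x \<le> B"
    and W': "W' \<in> borel_measurable M'" "\<And>x. x \<in> space M' \<Longrightarrow> 0 \<le> W' x \<and> W' x \<le> B"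
    and eq: "\<And>s. (CLINT x|M. of_real (W x) * iexp (s * X x)) = (CLINT x|M'. of_real (W' x) * iexp (s * X' x))"
    and A: "A \<in> sets borel"
  shows "(LINT x|M. W x * indicator A (X x)) = (LINT x|M'. W' x * indicator A (X' x))"
proof -
  interpret M: prob_space M by fact
  interpret M': prob_space M' by fact
  note [measurable] = W(1) W'(1) A
  have int: "integrable M W" "integrable M' W'"
    by (auto intro!: M.integrable_const_bound[of _ B] M'.integrable_const_bound[of _ B] simp: W W')
  have m: "(LINT x|M. W x) = (LINT x|M'. W' x)" (is "?m = _")
    using eq[of 0] by simp
  have m0: "?m \<ge> 0" using W by (intro integral_nonneg_AE) auto
  show ?thesis
  \<comment> \<open>The frequency 0 shows that both weights have the same mass. Mass 0 cannot be
    normalized, but then both weights vanish almost everywhere.\<close>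
  proof (cases "?m = 0")
    case True
    have "AE x in M. W x = 0" using True int W
      by (subst (asm) integral_nonneg_eq_0_iff_AE) auto
    moreover have "AE x in M'. W' x = 0" using True int W' unfolding m
      by (subst (asm) integral_nonneg_eq_0_iff_AE) auto
    ultimately have "(LINT x|M. W x * indicator A (X x)) = 0" "(LINT x|M'. W' x * indicator A (X' x)) = 0"
      by (auto intro!: integral_eq_zero_AE)
    then show ?thesis by simp
  next
    case False
    with m0 have mp: "?m > 0" by simp
    have bounds: "\<forall>x\<in>space M. 0 \<le> W x \<and> W x \<le> B" "\<forall>x\<in>space M'. 0 \<le> W' x \<and> W' x \<le> B"
      using W(2) W'(2) by auto
    note N = weighted_distribution[OF assms(1,3) W(1) bounds(1) refl mp]
    note N' = weighted_distribution[OF assms(2,4) W'(1) bounds(2) m mp]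
    have "char (distr (density M (\<lambda>x. W x / ?m)) borel X) = char (distr (density M' (\<lambda>x. W' x / ?m)) borel X')"
    proof
      fix s
      show "char (distr (density M (\<lambda>x. W x / ?m)) borel X) s = char (distr (density M' (\<lambda>x. W' x / ?m)) borel X') s"
        unfolding N(2) N'(2) eq ..
    qed
    with N(1) N'(1) have "distr (density M (\<lambda>x. W x / ?m)) borel X = distr (density M' (\<lambda>x. W' x / ?m)) borel X'"
      by (rule Levy_uniqueness)
    then have "(LINT x|M. W x * indicator A (X x)) / ?m = (LINT x|M'. W' x * indicator A (X' x)) / ?m"
      using N(3)[OF A] N'(3)[OF A] by metis
    then show ?thesis using mp by simp
  qed
qed

text \<open>The complex weight \<open>iexp Z\<close> enters through the nonnegative weights \<open>1 + cos (Z + p)\<close>, to which Levy's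
  uniqueness theorem applies after normalization.\<close>

lemma weighted_char_eq_imp_indicator_complex:
  fixes W W' X X' :: "_ \<Rightarrow> real" and G :: "_ \<Rightarrow> complex"
  assumes "prob_space M" "prob_space M'"
    and [measurable]: "X \<in> borel_measurable M" "X' \<in> borel_measurable M'"
    and [measurable]: "W \<in> borel_measurable M" "W' \<in> borel_measurable M'"
    and [measurable]: "Z \<in> borel_measurable M" "Z' \<in> borel_measurable M'"
    and W: "\<And>x. x \<in> space M \<Longrightarrow> 0 \<le> W x \<and> W x \<le> 1"
    and W': "\<And>x. x \<in> space M' \<Longrightarrow> 0 \<le> W' x \<and> W' x \<le> 1"
    and eq: "\<And>r s. (CLINT x|M. of_real (W x) * iexp (r * Z x + s * X x)) = (CLINT x|M'. of_real (W' x) * iexp (r * Z' x + s * X' x))"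
    and A[measurable]: "A \<in> sets borel"
  shows "(CLINT x|M. of_real (W x * indicator A (X x)) * iexp (Z x)) = (CLINT x|M'. of_real (W' x * indicator A (X' x)) * iexp (Z' x))"
proof -
  interpret M: prob_space M by fact
  interpret M': prob_space M' by fact
  have intM: "integrable M (\<lambda>x. of_real (W x * indicator B (X x)) * iexp (f x))"
    if [measurable]: "f \<in> borel_measurable M" "B \<in> sets borel" for f B
    by (rule M.integrable_const_bound[of _ 1]) (use W in \<open>auto simp: norm_mult indicator_def intro!: AE_I2\<close>)
  have intM': "integrable M' (\<lambda>x. of_real (W' x * indicator B (X' x)) * iexp (f x))"
    if [measurable]: "f \<in> borel_measurable M'" "B \<in> sets borel" for f B
    by (rule M'.integrable_const_bound[of _ 1]) (use W' in \<open>auto simp: norm_mult indicator_def intro!: AE_I2\<close>)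
  have c: "of_real (cos a) = (iexp a + iexp (- a)) / 2" for a
    unfolding cos_of_real[symmetric] cos_exp_eq by simp
  have s: "of_real (sin a) = (iexp a - iexp (- a)) / (2 * \<i>)" for a
    unfolding sin_of_real[symmetric] sin_exp_eq by simp
  have one: "(LINT x|M. W x * indicator A (X x)) = (LINT x|M'. W' x * indicator A (X' x))"
    using weighted_char_eq_imp_indicator[OF assms(1-4), of W 1 W' A] W W' eq[of 0] by auto
  have cs: "(LINT x|M. W x * (1 + cos (Z x + p)) * indicator A (X x)) = (LINT x|M'. W' x * (1 + cos (Z' x + p)) * indicator A (X' x))" for p
  proof (rule weighted_char_eq_imp_indicator[OF assms(1-4), where B = 2])
    fix s
    have iM: "integrable M (\<lambda>x. of_real (W x) * iexp (r * Z x + s * X x))" for r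
      using intM[of "\<lambda>x. r * Z x + s * X x" UNIV] by simp
    have iM': "integrable M' (\<lambda>x. of_real (W' x) * iexp (r * Z' x + s * X' x))" for r
      using intM'[of "\<lambda>x. r * Z' x + s * X' x" UNIV] by simp
    \<comment> \<open>By Euler's formula the weight \<open>1 + cos (z + p)\<close> only involves the
      frequencies 0, 1 and -1 of \<open>z\<close>, all of which are instances of
      \<open>eq\<close>.\<close>
    have e: "of_real (w * (1 + cos (z + p))) * iexp (s * x) =
       of_real w * iexp (0 * z + s * x) + iexp p / 2 * (of_real w * iexp (1 * z + s * x)) + iexp (- p) / 2 * (of_real w * iexp ((- 1) * z + s * x))"
      for w z x :: real
      by (simp add: c exp_add algebra_simps add_divide_distrib exp_diff exp_minus)
    have "(CLINT x|M. of_real (W x * (1 + cos (Z x + p))) * iexp (s * X x)) =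
       (CLINT x|M. of_real (W x) * iexp (0 * Z x + s * X x)) + iexp p / 2 * (CLINT x|M. of_real (W x) * iexp (1 * Z x + s * X x))
       + iexp (-p) / 2 * (CLINT x|M. of_real (W x) * iexp ((-1) * Z x + s * X x))"
      unfolding e by (simp only: Bochner_Integration.integral_add Bochner_Integration.integrable_add iM integrable_mult_right integral_mult_right_zero)
    also have "\<dots> = (CLINT x|M'. of_real (W' x) * iexp (0 * Z' x + s * X' x)) + iexp p / 2 * (CLINT x|M'. of_real (W' x) * iexp (1 * Z' x + s * X' x))
       + iexp (-p) / 2 * (CLINT x|M'. of_real (W' x) * iexp ((-1) * Z' x + s * X' x))"
      unfolding eq ..
    also have "\<dots> = (CLINT x|M'. of_real (W' x * (1 + cos (Z' x + p))) * iexp (s * X' x))"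
      unfolding e by (simp only: Bochner_Integration.integral_add Bochner_Integration.integrable_add iM' integrable_mult_right integral_mult_right_zero)
    finally show "(CLINT x|M. of_real (W x * (1 + cos (Z x + p))) * iexp (s * X x)) = (CLINT x|M'. of_real (W' x * (1 + cos (Z' x + p))) * iexp (s * X' x))" .
  next
    fix x assume "x \<in> space M"
    then show "0 \<le> W x * (1 + cos (Z x + p)) \<and> W x * (1 + cos (Z x + p)) \<le> 2"
      using W[of x] mult_mono[of "W x" 1 "1 + cos (Z x + p)" 2] cos_ge_minus_one[of "Z x + p"]
      by (auto simp del: cos_ge_minus_one simp: add.commute intro!: mult_nonneg_nonneg)
  next
    fix x assume "x \<in> space M'"
    then show "0 \<le> W' x * (1 + cos (Z' x + p)) \<and> W' x * (1 + cos (Z' x + p)) \<le> 2"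
      using W'[of x] mult_mono[of "W' x" 1 "1 + cos (Z' x + p)" 2] cos_ge_minus_one[of "Z' x + p"]
      by (auto simp del: cos_ge_minus_one simp: add.commute intro!: mult_nonneg_nonneg)
  qed auto
  have dM: "(LINT x|M. W x * (1 + cos (Z x + p)) * indicator A (X x)) = (LINT x|M. W x * indicator A (X x)) + (LINT x|M. W x * indicator A (X x) * cos (Z x + p))" for p
    by (subst Bochner_Integration.integral_add[symmetric])
      (auto intro!: Bochner_Integration.integral_cong M.integrable_const_bound[of _ 1] AE_I2 simp: algebra_simps indicator_def abs_mult mult_le_one W)
  have dM': "(LINT x|M'. W' x * (1 + cos (Z' x + p)) * indicator A (X' x)) = (LINT x|M'. W' x * indicator A (X' x)) + (LINT x|M'. W' x * indicator A (X' x) * cos (Z' x + p))" for p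
    by (subst Bochner_Integration.integral_add[symmetric])
      (auto intro!: Bochner_Integration.integral_cong M'.integrable_const_bound[of _ 1] AE_I2 simp: algebra_simps indicator_def abs_mult mult_le_one W')
  have C: "(LINT x|M. W x * indicator A (X x) * cos (Z x + p)) = (LINT x|M'. W' x * indicator A (X' x) * cos (Z' x + p))" for p
    using cs[of p] dM[of p] dM'[of p] one by simp
  have reM: "Re (CLINT x|M. of_real (W x * indicator A (X x)) * iexp (Z x)) = (LINT x|M. W x * indicator A (X x) * cos (Z x + 0))"
     "Im (CLINT x|M. of_real (W x * indicator A (X x)) * iexp (Z x)) = (LINT x|M. W x * indicator A (X x) * cos (Z x + (- pi / 2)))"
    using intM[of Z A] by (simp_all add: integral_Re[symmetric] integral_Im[symmetric] Re_exp Im_exp cos_diff cos_add)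
  have reM': "Re (CLINT x|M'. of_real (W' x * indicator A (X' x)) * iexp (Z' x)) = (LINT x|M'. W' x * indicator A (X' x) * cos (Z' x + 0))"
     "Im (CLINT x|M'. of_real (W' x * indicator A (X' x)) * iexp (Z' x)) = (LINT x|M'. W' x * indicator A (X' x) * cos (Z' x + (- pi / 2)))"
    using intM'[of Z' A] by (simp_all add: integral_Re[symmetric] integral_Im[symmetric] Re_exp Im_exp cos_diff cos_add)
  show ?thesis unfolding complex_eq_iff reM reM' C by simp
qed

text \<open>Coordinates are converted one at a time. In \<open>P\<close> the first \<open>m\<close>
  coordinates are tested by indicators and the others by characters; the one-dimensional result with
  the complex weight turns the character in coordinate \<open>m\<close> into an indicator. For
  \<open>m = k\<close> only the probabilities of boxes remain, and these determine the law.\<close>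

lemma multivariate_char_unique:
  fixes X :: "nat \<Rightarrow> 'a \<Rightarrow> real" and X' :: "nat \<Rightarrow> 'b \<Rightarrow> real"
  assumes M: "prob_space M" and M': "prob_space M'"
    and X[measurable]: "\<And>j. j < k \<Longrightarrow> X j \<in> borel_measurable M"
    and X'[measurable]: "\<And>j. j < k \<Longrightarrow> X' j \<in> borel_measurable M'"
    and eq: "\<And>\<theta>. (CLINT x|M. iexp (\<Sum>j<k. \<theta> j * X j x)) = (CLINT x|M'. iexp (\<Sum>j<k. \<theta> j * X' j x))"
  shows "distr M (PiM {..<k} (\<lambda>_. borel)) (\<lambda>x. \<lambda>j\<in>{..<k}. X j x) =
         distr M' (PiM {..<k} (\<lambda>_. borel)) (\<lambda>x. \<lambda>j\<in>{..<k}. X' j x)"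
proof -
  interpret M: prob_space M by fact
  interpret M': prob_space M' by fact
  have prod01: "0 \<le> (\<Prod>j<m. indicator (A j) (z j) :: real)" "(\<Prod>j<m. indicator (A j) (z j) :: real) \<le> 1"
    for A :: "nat \<Rightarrow> real set" and z m
    by (auto intro!: prod_nonneg prod_le_1 simp: indicator_def)
  have P: "(CLINT x|M. of_real (\<Prod>j<m. indicator (A j) (X j x)) * iexp (\<Sum>j\<in>{m..<k}. \<theta> j * X j x)) =
      (CLINT x|M'. of_real (\<Prod>j<m. indicator (A j) (X' j x)) * iexp (\<Sum>j\<in>{m..<k}. \<theta> j * X' j x))"
    if "m \<le> k" and A: "\<And>j. A j \<in> sets borel" for m A \<theta>
    using that(1)
  proof (induction m arbitrary: \<theta>)
    case 0
    then show ?case using eq[of \<theta>] by (simp add: lessThan_atLeast0)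
  next
    case (Suc m)
    then have mk: "m < k" by simp
    note [measurable] = A
    have spl: "{m..<k} = insert m {Suc m..<k}" using mk by auto
    have "(CLINT x|M. of_real ((\<Prod>j<m. indicator (A j) (X j x)) * indicator (A m) (X m x)) * iexp (\<Sum>j\<in>{Suc m..<k}. \<theta> j * X j x)) =
      (CLINT x|M'. of_real ((\<Prod>j<m. indicator (A j) (X' j x)) * indicator (A m) (X' m x)) * iexp (\<Sum>j\<in>{Suc m..<k}. \<theta> j * X' j x))"
    proof (rule weighted_char_eq_imp_indicator_complex[OF M M'])
      fix r s
      \<comment> \<open>Coordinate \<open>m\<close> gets its own frequency \<open>s\<close>, while
        \<open>r\<close> scales the remaining combination, which plays the part of the phase
        \<open>Z\<close>.\<close>
      have e: "(\<Sum>j\<in>{m..<k}. (if j = m then s else r * \<theta> j) * z j) = r * (\<Sum>j\<in>{Suc m..<k}. \<theta> j * z j) + s * z m" for z :: "nat \<Rightarrow> real"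
        unfolding spl by (simp add: sum_distrib_left mult.assoc)
      show "(CLINT x|M. of_real (\<Prod>j<m. indicator (A j) (X j x)) * iexp (r * (\<Sum>j\<in>{Suc m..<k}. \<theta> j * X j x) + s * X m x)) =
        (CLINT x|M'. of_real (\<Prod>j<m. indicator (A j) (X' j x)) * iexp (r * (\<Sum>j\<in>{Suc m..<k}. \<theta> j * X' j x) + s * X' m x))"
        using Suc.IH[of "\<lambda>j. if j = m then s else r * \<theta> j"] mk unfolding e by simp
    qed (use mk A prod01 in \<open>auto intro!: borel_measurable_prod borel_measurable_sum borel_measurable_times borel_measurable_indicator' measurable_compose[OF X] measurable_compose[OF X']\<close>)
    then show ?case by simp
  qed
  have E: "M.prob {x\<in>space M. \<forall>j<k. X j x \<in> A j} = M'.prob {x\<in>space M'. \<forall>j<k. X' j x \<in> A j}"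
    if A[measurable]: "\<And>j. A j \<in> sets borel" for A
  proof -
    have ind: "(\<Prod>j<k. indicator (A j) (z j) :: real) = (if \<forall>j<k. z j \<in> A j then 1 else 0)" for z :: "nat \<Rightarrow> real"
      by (auto simp: indicator_def)
    have s: "{x\<in>space M. \<forall>j<k. X j x \<in> A j} \<in> sets M" "{x\<in>space M'. \<forall>j<k. X' j x \<in> A j} \<in> sets M'"
      by measurable
    have "(LINT x|M. (\<Prod>j<k. indicator (A j) (X j x))) = (LINT x|M. indicator {x\<in>space M. \<forall>j<k. X j x \<in> A j} x :: real)"
      unfolding ind by (intro Bochner_Integration.integral_cong) (auto simp: indicator_def)
    moreover have "(LINT x|M'. (\<Prod>j<k. indicator (A j) (X' j x))) = (LINT x|M'. indicator {x\<in>space M'. \<forall>j<k. X' j x \<in> A j} x :: real)"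
      unfolding ind by (intro Bochner_Integration.integral_cong) (auto simp: indicator_def)
    moreover have "(LINT x|M. (\<Prod>j<k. indicator (A j) (X j x)) :: real) = (LINT x|M'. (\<Prod>j<k. indicator (A j) (X' j x)))"
      using P[of k A] A by (simp flip: of_real_prod)
    ultimately show ?thesis using s by simp
  qed
  note [measurable] = measurable_restrict[of "{..<k}" X M "\<lambda>_. borel"] measurable_restrict[of "{..<k}" X' M' "\<lambda>_. borel"]
  show ?thesis
  proof (rule measure_eqI_PiM_finite[where I="{..<k}" and M="\<lambda>_. borel" and A="\<lambda>_. space (PiM {..<k} (\<lambda>_. borel))"])
    fix A :: "nat \<Rightarrow> real set" assume A: "\<And>j. j \<in> {..<k} \<Longrightarrow> A j \<in> sets borel"
    define A' where "A' j = (if j < k then A j else UNIV)" for j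
    have A': "A' j \<in> sets borel" for j using A by (simp add: A'_def)
    have PA: "Pi\<^sub>E {..<k} A \<in> sets (PiM {..<k} (\<lambda>_. borel))" using A by (intro sets_PiM_I_finite) auto
    have 1: "(\<lambda>x. \<lambda>j\<in>{..<k}. X j x) -` Pi\<^sub>E {..<k} A \<inter> space M = {x\<in>space M. \<forall>j<k. X j x \<in> A' j}"
      unfolding set_eq_iff A'_def by (simp add: restrict_PiE_iff Pi_iff conj_commute Ball_def)
    have 2: "(\<lambda>x. \<lambda>j\<in>{..<k}. X' j x) -` Pi\<^sub>E {..<k} A \<inter> space M' = {x\<in>space M'. \<forall>j<k. X' j x \<in> A' j}"
      unfolding set_eq_iff A'_def by (simp add: restrict_PiE_iff Pi_iff conj_commute Ball_def)
    show "emeasure (distr M (PiM {..<k} (\<lambda>_. borel)) (\<lambda>x. \<lambda>j\<in>{..<k}. X j x)) (Pi\<^sub>E {..<k} A) =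
      emeasure (distr M' (PiM {..<k} (\<lambda>_. borel)) (\<lambda>x. \<lambda>j\<in>{..<k}. X' j x)) (Pi\<^sub>E {..<k} A)"
      using PA E[OF A'] by (subst (1 2) emeasure_distr) (auto simp: 1 2 M.emeasure_eq_measure M'.emeasure_eq_measure)
  next
    show "range (\<lambda>_::nat. space (PiM {..<k} (\<lambda>_. borel :: real measure))) \<subseteq> prod_algebra {..<k} (\<lambda>_. borel)"
      by (auto simp: space_PiM intro!: prod_algebraI_finite)
  qed (auto simp: M.emeasure_eq_measure emeasure_distr)
qed

lemma (in prob_space) indep_vars_if_char_prod:
  fixes X :: "nat \<Rightarrow> 'a \<Rightarrow> real"
  assumes X[measurable]: "\<And>j. j < n \<Longrightarrow> X j \<in> borel_measurable M"
    and eq: "\<And>\<theta>. (CLINT x|M. iexp (\<Sum>j<n. \<theta> j * X j x)) = (\<Prod>j<n. CLINT x|M. iexp (\<theta> j * X j x))"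
  shows "indep_vars (\<lambda>_. borel) X {..<n}"
proof (cases "n = 0")
  case True
  then show ?thesis by (auto simp: indep_vars_def indep_sets_def)
next
  case False
  \<comment> \<open>The dummy law for \<open>j \<ge> n\<close> makes every \<open>N j\<close> a
    probability space, as the interpretation of the product space demands.\<close>
  define N where "N j = (if j < n then distr M borel (X j) else return borel 0)" for j
  have N: "prob_space (N j)" for j unfolding N_def by (auto intro!: prob_space_distr prob_space_return)
  interpret N: prob_space "N j" for j by (rule N)
  interpret P: product_prob_space N "{..<n}" ..
  have sN: "sets (N j) = sets borel" for j by (simp add: N_def)
  have PM: "PiM {..<n} N = PiM {..<n} (\<lambda>j. distr M borel (X j))" by (intro PiM_cong) (auto simp: N_def)
  have sP: "sets (PiM {..<n} N) = sets (PiM {..<n} (\<lambda>_. borel))" by (intro sets_PiM_cong) (auto simp: sN)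
  have "distr M (PiM {..<n} (\<lambda>_. borel)) (\<lambda>x. \<lambda>j\<in>{..<n}. X j x) =
     distr (PiM {..<n} N) (PiM {..<n} (\<lambda>_. borel)) (\<lambda>x. \<lambda>j\<in>{..<n}. x j)"
  proof (rule multivariate_char_unique)
    show "prob_space (PiM {..<n} N)" by unfold_locales
    fix \<theta> :: "nat \<Rightarrow> real"
    have "(CLINT x|PiM {..<n} N. iexp (\<Sum>j<n. \<theta> j * x j)) = (CLINT x|PiM {..<n} N. (\<Prod>j<n. iexp (\<theta> j * x j)))"
      by (simp add: exp_sum sum_distrib_left)
    also have "\<dots> = (\<Prod>j<n. CLINT x|N j. iexp (\<theta> j * x))"
    proof (rule P.product_integral_prod)
      fix j assume "j \<in> {..<n}"
      have [measurable]: "(\<lambda>x. \<theta> j * x) \<in> borel_measurable (N j)" by (simp add: measurable_cong_sets[OF sN refl])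
      show "integrable (N j) (\<lambda>x. iexp (\<theta> j * x))" by (rule N.integrable_iexp_real) simp
    qed simp
    also have "\<dots> = (\<Prod>j<n. CLINT x|M. iexp (\<theta> j * X j x))"
      by (intro prod.cong refl) (auto simp: N_def integral_distr)
    finally show "(CLINT x|M. iexp (\<Sum>j<n. \<theta> j * X j x)) = (CLINT x|PiM {..<n} N. iexp (\<Sum>j<n. \<theta> j * x j))"
      using eq by simp
  next
    fix j assume "j < n"
    then have "(\<lambda>x. x j) \<in> measurable (PiM {..<n} N) (N j)" by (intro measurable_component_singleton) auto
    then show "(\<lambda>x. x j) \<in> borel_measurable (PiM {..<n} N)" using sN by (simp cong: measurable_cong_sets)
  qed (use prob_space_axioms in auto)
  also have "\<dots> = distr (PiM {..<n} N) (PiM {..<n} N) (\<lambda>x. x)"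
    by (rule distr_cong) (auto simp: sP space_PiM PiE_def extensional_restrict)
  also have "\<dots> = PiM {..<n} N" by (rule distr_id)
  finally show ?thesis using False PM by (subst indep_vars_iff_distr_eq_PiM') auto
qed

lemma (in prob_space) iexp_dominated_convergence:
  assumes "\<And>n. f n \<in> borel_measurable M" "g \<in> borel_measurable M"
    and "AE x in M. (\<lambda>n. f n x) \<longlonglongrightarrow> g x"
  shows "(\<lambda>n. CLINT x|M. iexp (f n x)) \<longlonglongrightarrow> (CLINT x|M. iexp (g x))"
proof (rule integral_dominated_convergence[where w="\<lambda>_. 1"])
  show "AE x in M. (\<lambda>n. iexp (f n x)) \<longlonglongrightarrow> iexp (g x)"
    using assms(3) by eventually_elim (intro tendsto_intros)
qed (use assms(1,2) in auto)

text \<open>The functional equation gives a logarithm separately for each frequency vector, with no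
  continuity in that vector. Continuity is recovered afterwards: for every \<open>c\<close> the
  characteristic function is continuous by dominated convergence, its modulus is at most 1, and so
  the convergence of all powers forces convergence of the exponents.\<close>

lemma (in prob_space) char_semigroup_exponent:
  fixes X :: "real \<Rightarrow> nat \<Rightarrow> 'a \<Rightarrow> real" and k :: nat
  defines "\<phi> \<equiv> \<lambda>c \<theta>. CLINT x|M. iexp (\<Sum>j<k. \<theta> j * X c j x)"
  assumes X: "\<And>c j. 0 < c \<Longrightarrow> j < k \<Longrightarrow> X c j \<in> borel_measurable M"
    and mult: "\<And>c c' \<theta>. 0 < c \<Longrightarrow> 0 < c' \<Longrightarrow> \<phi> (c + c') \<theta> = \<phi> c \<theta> * \<phi> c' \<theta>"
    and lim: "\<And>\<theta>. ((\<lambda>c. \<phi> c \<theta>) \<longlongrightarrow> 1) (at_right 0)"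
  obtains \<Psi> where "\<And>c \<theta>. 0 < c \<Longrightarrow> \<phi> c \<theta> = exp (of_real c * \<Psi> \<theta>)"
    and "\<And>\<theta> \<eta>. (\<And>j. j < k \<Longrightarrow> (\<lambda>n. \<eta> n j) \<longlonglongrightarrow> \<theta> j) \<Longrightarrow> (\<lambda>n. \<Psi> (\<eta> n)) \<longlonglongrightarrow> \<Psi> \<theta>"
    and "\<And>\<theta>. (\<And>j. j < k \<Longrightarrow> \<theta> j = 0) \<Longrightarrow> \<Psi> \<theta> = 0"
proof -
  have "\<exists>z. \<forall>c>0. \<phi> c \<theta> = exp (of_real c * z)" for \<theta>
    using multiplicative_eq_exp[of "\<lambda>c. \<phi> c \<theta>"] mult lim by metis
  then obtain \<Psi> where \<Psi>: "\<And>c \<theta>. 0 < c \<Longrightarrow> \<phi> c \<theta> = exp (of_real c * \<Psi> \<theta>)" by metis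
  have meas: "(\<lambda>x. \<Sum>j<k. \<theta> j * X c j x) \<in> borel_measurable M" if "c > 0" for c \<theta>
    using X that by (intro borel_measurable_sum borel_measurable_times) auto
  have Re: "Re (\<Psi> \<theta>) \<le> 0" for \<theta>
  proof -
    have "norm (\<phi> 1 \<theta>) \<le> (LINT x|M. norm (iexp (\<Sum>j<k. \<theta> j * X 1 j x)))"
      unfolding \<phi>_def by (rule integral_norm_bound)
    also have "\<dots> = 1" by (simp add: prob_space)
    finally show ?thesis by (simp add: \<Psi>)
  qed
  show ?thesis
  proof (rule that[OF \<Psi>])
    fix \<theta> :: "nat \<Rightarrow> real" and \<eta> :: "nat \<Rightarrow> nat \<Rightarrow> real"
    assume \<eta>: "\<And>j. j < k \<Longrightarrow> (\<lambda>n. \<eta> n j) \<longlonglongrightarrow> \<theta> j"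
    show "(\<lambda>n. \<Psi> (\<eta> n)) \<longlonglongrightarrow> \<Psi> \<theta>"
    proof (rule tendsto_log_if_all_powers_tendsto[OF _ Re])
      fix c :: real assume c: "c > 0"
      have "(\<lambda>n. \<phi> c (\<eta> n)) \<longlonglongrightarrow> \<phi> c \<theta>" unfolding \<phi>_def
        by (rule iexp_dominated_convergence[OF meas meas]) (use \<eta> c in \<open>auto intro!: tendsto_intros\<close>)
      then show "(\<lambda>n. exp (complex_of_real c * \<Psi> (\<eta> n))) \<longlonglongrightarrow> exp (complex_of_real c * \<Psi> \<theta>)"
        using \<Psi> c by simp
    qed
  next
    fix \<theta> :: "nat \<Rightarrow> real" assume 0: "\<And>j. j < k \<Longrightarrow> \<theta> j = 0"
    \<comment> \<open>A constant sequence suffices: \<open>exp (c * \<Psi> \<theta>) = 1\<close> for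
      every \<open>c > 0\<close> leaves no nonzero multiple of \<open>2 * pi * \<i>\<close> for
      \<open>\<Psi> \<theta>\<close>.\<close>
    have "(\<lambda>n::nat. \<Psi> \<theta>) \<longlonglongrightarrow> 0"
    proof (rule tendsto_log_if_all_powers_tendsto[OF _ Re])
      fix c :: real assume c: "c > 0"
      have "\<phi> c \<theta> = 1" using 0 by (simp add: \<phi>_def prob_space)
      then show "(\<lambda>n::nat. exp (complex_of_real c * \<Psi> \<theta>)) \<longlonglongrightarrow> exp (complex_of_real c * 0)"
        using \<Psi> c by simp
    qed
    then show "\<Psi> \<theta> = 0" by (simp add: LIMSEQ_const_iff)
  qed
qed

lemma continuous_map_powertop_real_if_sequentially:
  fixes \<Psi> :: "(nat \<Rightarrow> real) \<Rightarrow> complex"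
  assumes "\<And>\<theta> \<eta>. (\<And>j. j < k \<Longrightarrow> (\<lambda>n. \<eta> n j) \<longlonglongrightarrow> \<theta> j) \<Longrightarrow> (\<lambda>n. \<Psi> (\<eta> n)) \<longlonglongrightarrow> \<Psi> \<theta>"
  shows "continuous_map (powertop_real {..<k}) euclidean \<Psi>"
proof -
  have "topcontinuous_at (powertop_real {..<k}) euclidean \<Psi> \<theta>" if \<theta>: "\<theta> \<in> topspace (powertop_real {..<k})" for \<theta>
    unfolding topcontinuous_at_def
  proof (intro conjI allI impI)
    fix V assume V: "openin euclidean V \<and> \<Psi> \<theta> \<in> V"
    have "\<exists>d>0. \<forall>\<eta>. (\<forall>j<k. \<bar>\<eta> j - \<theta> j\<bar> < d) \<longrightarrow> \<Psi> \<eta> \<in> V"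
    proof (rule ccontr)
      assume "\<not> ?thesis"
      then have "\<forall>n. \<exists>\<eta>. (\<forall>j<k. \<bar>\<eta> j - \<theta> j\<bar> < 1 / real (Suc n)) \<and> \<Psi> \<eta> \<notin> V"
        by (metis of_nat_0_less_iff zero_less_Suc zero_less_divide_1_iff)
      then obtain \<eta> where \<eta>: "\<And>n j. j < k \<Longrightarrow> \<bar>\<eta> n j - \<theta> j\<bar> < 1 / real (Suc n)" "\<And>n. \<Psi> (\<eta> n) \<notin> V"
        by metis
      have "(\<lambda>n. \<Psi> (\<eta> n)) \<longlonglongrightarrow> \<Psi> \<theta>"
      proof (rule assms)
        fix j assume j: "j < k"
        have "(\<lambda>n. \<eta> n j - \<theta> j) \<longlonglongrightarrow> 0"
          by (rule Lim_null_comparison[OF always_eventually LIMSEQ_Suc[OF lim_1_over_n]])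
            (use \<eta>(1)[OF j] in \<open>auto intro: less_imp_le\<close>)
        then show "(\<lambda>n. \<eta> n j) \<longlonglongrightarrow> \<theta> j" by (rule LIM_zero_cancel)
      qed
      then have "eventually (\<lambda>n. \<Psi> (\<eta> n) \<in> V) sequentially" using V by (auto dest: topological_tendstoD)
      then show False using \<eta>(2) by auto
    qed
    then obtain d where d: "d > 0" "\<And>\<eta>. (\<And>j. j < k \<Longrightarrow> \<bar>\<eta> j - \<theta> j\<bar> < d) \<Longrightarrow> \<Psi> \<eta> \<in> V" by blast
    show "\<exists>U. openin (powertop_real {..<k}) U \<and> \<theta> \<in> U \<and> (\<forall>y\<in>U. \<Psi> y \<in> V)"
    proof (intro exI[of _ "Pi\<^sub>E {..<k} (\<lambda>j. ball (\<theta> j) d)"] conjI ballI)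
      show "openin (powertop_real {..<k}) (Pi\<^sub>E {..<k} (\<lambda>j. ball (\<theta> j) d))"
        by (subst openin_PiE) auto
      show "\<theta> \<in> Pi\<^sub>E {..<k} (\<lambda>j. ball (\<theta> j) d)" using \<theta> d by (auto simp: PiE_iff)
      fix \<eta> assume "\<eta> \<in> Pi\<^sub>E {..<k} (\<lambda>j. ball (\<theta> j) d)"
      then show "\<Psi> \<eta> \<in> V" by (intro d) (auto simp: PiE_iff dist_real_def abs_minus_commute)
    qed
  qed (use \<theta> in auto)
  then show ?thesis unfolding continuous_map_eq_topcontinuous_at by blast
qed

text \<open>Uniqueness behind the definite description: along the line from 0 to a given vector, two
  candidates are continuous logarithms of the same function and agree at 0, hence agree at the
  vector.\<close>

lemma log_char_eqI:
  assumes char: "\<And>\<theta>. (CLINT \<omega>|M. iexp (\<Sum>j<k. \<theta> j * X j \<omega>)) = exp (\<Psi> \<theta>)"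
    and cont: "\<And>\<theta> \<eta>. (\<And>j. j < k \<Longrightarrow> (\<lambda>n. \<eta> n j) \<longlonglongrightarrow> \<theta> j) \<Longrightarrow> (\<lambda>n. \<Psi> (\<eta> n)) \<longlonglongrightarrow> \<Psi> \<theta>"
    and zero: "\<And>\<theta>. (\<And>j. j < k \<Longrightarrow> \<theta> j = 0) \<Longrightarrow> \<Psi> \<theta> = 0"
    and \<theta>: "\<theta> \<in> {..<k} \<rightarrow>\<^sub>E UNIV"
  shows "log_char M k X \<theta> = \<Psi> \<theta>"
proof -
  define P where "P \<Phi> \<longleftrightarrow> \<Phi> \<in> extensional ({..<k} \<rightarrow>\<^sub>E UNIV) \<and>
    continuous_map (powertop_real {..<k}) euclidean \<Phi> \<and>
    \<Phi> (\<lambda>j\<in>{..<k}. 0) = 0 \<and>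
    (\<forall>\<theta> \<in> {..<k} \<rightarrow>\<^sub>E UNIV. (CLINT \<omega>|M. iexp (\<Sum>j<k. \<theta> j * X j \<omega>)) = exp (\<Phi> \<theta>))" for \<Phi>
  \<comment> \<open>The description asks for an extensional function, so \<open>\<Psi>\<close> is
    restricted to the vectors of length \<open>k\<close>.\<close>
  define \<Phi> where "\<Phi> = restrict \<Psi> ({..<k} \<rightarrow>\<^sub>E UNIV)"
  have "continuous_map (powertop_real {..<k}) euclidean \<Phi>"
    by (rule continuous_map_eq[OF continuous_map_powertop_real_if_sequentially[OF cont]]) (auto simp: \<Phi>_def)
  then have P\<Phi>: "P \<Phi>"
    unfolding P_def using char zero by (auto simp: \<Phi>_def)
  have "\<Phi>' = \<Phi>" if P': "P \<Phi>'" for \<Phi>'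
  proof (rule extensionalityI[of _ "{..<k} \<rightarrow>\<^sub>E UNIV"])
    fix \<eta> :: "nat \<Rightarrow> real" assume \<eta>: "\<eta> \<in> {..<k} \<rightarrow>\<^sub>E UNIV"
    define line where "line s = (\<lambda>j\<in>{..<k}. s * \<eta> j)" for s :: real
    have line: "continuous_map euclideanreal (powertop_real {..<k}) line"
      unfolding continuous_map_componentwise line_def
      by (auto intro!: continuous_on_mult_right continuous_on_id)
    have cont_line: "continuous_on UNIV (\<lambda>s. \<Phi> (line s))" "continuous_on UNIV (\<lambda>s. \<Phi>' (line s))"
      using continuous_map_compose[OF line, of euclidean \<Phi>] continuous_map_compose[OF line, of euclidean \<Phi>'] P' P\<Phi>
      by (auto simp: P_def o_def)
    have "\<Phi> (line 1) = \<Phi>' (line 1)"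
    proof (rule continuous_log_unique[OF cont_line])
      have mem: "line t \<in> {..<k} \<rightarrow>\<^sub>E UNIV" for t by (auto simp: line_def)
      show "exp (\<Phi> (line t)) = exp (\<Phi>' (line t))" for t
      proof -
        have "(CLINT \<omega>|M. iexp (\<Sum>j<k. line t j * X j \<omega>)) = exp (\<Phi> (line t))"
          using P\<Phi> mem unfolding P_def by blast
        moreover have "(CLINT \<omega>|M. iexp (\<Sum>j<k. line t j * X j \<omega>)) = exp (\<Phi>' (line t))"
          using P' mem unfolding P_def by blast
        ultimately show ?thesis by simp
      qed
      show "\<Phi> (line 0) = \<Phi>' (line 0)" using P' P\<Phi> by (simp add: P_def line_def)
    qed
    moreover have "line 1 = \<eta>" using \<eta> by (auto simp: line_def PiE_def extensional_def fun_eq_iff)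
    ultimately show "\<Phi>' \<eta> = \<Phi> \<eta>" by simp
  qed (use P' P\<Phi> in \<open>auto simp: P_def\<close>)
  note unique = this
  have "log_char M k X = \<Phi>"
    unfolding log_char_def P_def[symmetric] by (rule the_equality[where P=P, OF P\<Phi> unique])
  then show ?thesis using \<theta> by (simp add: \<Phi>_def)
qed

section \<open>Integrals along cadlag paths\<close>

lemma cadlag_on_UNIV_iff:
  "cadlag_on UNIV y \<longleftrightarrow> (\<forall>t. (y \<longlongrightarrow> y t) (at_right t) \<and> (\<exists>l. (y \<longlongrightarrow> l) (at_left t)))"
  by (simp add: cadlag_on_def)

text \<open>Rounding goes upwards because the paths are continuous from the right only.\<close>

definition grid_ceil :: "nat \<Rightarrow> real \<Rightarrow> real" where
  "grid_ceil n u = of_int \<lceil>u * real (Suc n)\<rceil> / real (Suc n)"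

lemma grid_ceil_ge: "u \<le> grid_ceil n u"
  unfolding grid_ceil_def by (simp add: pos_le_divide_eq del: of_nat_Suc)

lemma grid_ceil_less: "grid_ceil n u < u + 1 / real (Suc n)"
proof -
  have "of_int \<lceil>u * real (Suc n)\<rceil> < u * real (Suc n) + 1" by linarith
  then have "grid_ceil n u < (u * real (Suc n) + 1) / real (Suc n)"
    unfolding grid_ceil_def by (intro divide_strict_right_mono) auto
  also have "\<dots> = u + 1 / real (Suc n)" by (simp add: add_divide_distrib del: of_nat_Suc)
  finally show ?thesis .
qed

lemma grid_ceil_tendsto: "(\<lambda>n. grid_ceil n u) \<longlonglongrightarrow> u"
proof (rule tendsto_sandwich[of "\<lambda>_. u" _ _ "\<lambda>n. u + 1 / real (Suc n)"])
  have "(\<lambda>n. u + 1 / real (Suc n)) \<longlonglongrightarrow> u + 0"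
    by (intro tendsto_intros LIMSEQ_Suc[OF lim_1_over_n])
  then show "(\<lambda>n. u + 1 / real (Suc n)) \<longlonglongrightarrow> u" by simp
qed (auto intro!: always_eventually grid_ceil_ge less_imp_le[OF grid_ceil_less] simp del: of_nat_Suc)

lemma right_continuous_compose_seq:
  fixes y :: "real \<Rightarrow> 'b::metric_space"
  assumes y: "(y \<longlongrightarrow> y t) (at_right t)" and s: "s \<longlonglongrightarrow> t" "\<And>n. t \<le> s n"
  shows "(\<lambda>n. y (s n)) \<longlonglongrightarrow> y t"
proof (rule tendstoI)
  fix e :: real assume e: "e > 0"
  from tendstoD[OF y e] obtain b where b: "b > t" "\<And>z. t < z \<Longrightarrow> z < b \<Longrightarrow> dist (y z) (y t) < e"
    by (auto simp: eventually_at_right_field)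
  have "eventually (\<lambda>n. s n < b) sequentially" using order_tendstoD(2)[OF s(1) b(1)] .
  then show "eventually (\<lambda>n. dist (y (s n)) (y t) < e) sequentially"
  proof eventually_elim
    case (elim n)
    then show ?case using b(2)[of "s n"] s(2)[of n] e by (cases "s n = t") auto
  qed
qed

lemma cadlag_grid_ceil_tendsto:
  assumes "cadlag_on UNIV y"
  shows "(\<lambda>n. y (grid_ceil n u)) \<longlonglongrightarrow> y u"
proof (rule right_continuous_compose_seq[OF _ grid_ceil_tendsto grid_ceil_ge])
  show "(y \<longlongrightarrow> y u) (at_right u)" using assms by (auto simp: cadlag_on_UNIV_iff)
qed

text \<open>The step function factors through the integer-valued ceiling, so no regularity of
  \<open>y\<close> enters.\<close>

lemma borel_measurable_grid_ceil:
  fixes y :: "real \<Rightarrow> real"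
  shows "(\<lambda>u. y (grid_ceil n u)) \<in> borel_measurable borel"
proof -
  have "(\<lambda>u. (\<lambda>i::int. y (of_int i / real (Suc n))) \<lceil>u * real (Suc n)\<rceil>) \<in> borel_measurable borel"
    by measurable
  then show ?thesis by (simp add: grid_ceil_def)
qed

lemma cadlag_borel_measurable:
  assumes "cadlag_on UNIV y"
  shows "y \<in> borel_measurable borel"
  by (rule borel_measurable_LIMSEQ_metric[where f="\<lambda>n u. y (grid_ceil n u)"])
    (auto intro: borel_measurable_grid_ceil cadlag_grid_ceil_tendsto assms)

text \<open>Near each point the two one-sided limits confine the path to two unit balls, and the
  value at the point itself is the centre of one of them. Bisection extends local boundedness to
  compact intervals.\<close>

lemma cadlag_bounded:
  assumes y: "cadlag_on UNIV y"
  obtains B where "B > 0" "\<And>u. u \<in> {a..b} \<Longrightarrow> \<bar>y u\<bar> \<le> B"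
proof -
  have "bounded (y ` {a..b})"
  proof (cases "a \<le> b")
    case True
    then show ?thesis
    proof (induction a b rule: Bolzano)
      case (trans a b c)
      then have "{a..c} = {a..b} \<union> {b..c}" by auto
      then show ?case using trans by (simp add: image_Un)
    next
      case (local x)
      obtain l where r: "(y \<longlongrightarrow> y x) (at_right x)" and l: "(y \<longlongrightarrow> l) (at_left x)"
        using y by (auto simp: cadlag_on_UNIV_iff)
      obtain b where b: "b > x" "\<And>z. x < z \<Longrightarrow> z < b \<Longrightarrow> dist (y z) (y x) < 1"
        using tendstoD[OF r, of 1] by (auto simp: eventually_at_right_field)
      obtain a where a: "a < x" "\<And>z. a < z \<Longrightarrow> z < x \<Longrightarrow> dist (y z) l < 1"
        using tendstoD[OF l, of 1] by (auto simp: eventually_at_left_field)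
      have *: "y z \<in> ball (y x) 1 \<union> ball l 1" if "a < z" "z < b" for z
        using a(2)[of z] b(2)[of z] that by (cases z x rule: linorder_cases) (auto simp: dist_commute)
      show ?case
      proof (intro exI[of _ "min (x - a) (b - x)"] conjI allI impI)
        fix a' b' assume "a' \<le> x \<and> x \<le> b' \<and> b' - a' < min (x - a) (b - x)"
        then have "y ` {a'..b'} \<subseteq> ball (y x) 1 \<union> ball l 1" by (intro image_subsetI *) auto
        then show "bounded (y ` {a'..b'})" by (rule bounded_subset[rotated]) auto
      qed (use a b in auto)
    qed
  qed auto
  then show ?thesis using that by (auto simp: bounded_pos)
qed

lemma integrable_on_measurable_bounded:
  fixes f :: "real \<Rightarrow> real"
  assumes [measurable]: "f \<in> borel_measurable borel" and "\<And>u. u \<in> {a..b} \<Longrightarrow> \<bar>f u\<bar> \<le> B"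
  shows "f integrable_on {a..b}"
proof -
  have "set_integrable lborel {a..b} f" unfolding set_integrable_def
    using assms(2) by (intro integrableI_bounded_set_indicator[where B=B]) (auto simp: emeasure_lborel_Icc_eq)
  then show ?thesis by (rule set_borel_integral_eq_integral(1))
qed

lemma abs_exp_le:
  fixes k u :: real
  assumes "u \<in> {a..b}"
  shows "\<bar>k * exp (k * u)\<bar> \<le> \<bar>k\<bar> * exp (\<bar>k\<bar> * (\<bar>a\<bar> + \<bar>b\<bar>))"
proof -
  have "k * u \<le> \<bar>k * u\<bar>" by simp
  also have "\<dots> \<le> \<bar>k\<bar> * (\<bar>a\<bar> + \<bar>b\<bar>)" unfolding abs_mult using assms by (intro mult_left_mono) auto
  finally show ?thesis unfolding abs_mult by (intro mult_left_mono) auto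
qed

lemma integrable_on_exp_cadlag:
  assumes y: "cadlag_on UNIV y"
  shows "(\<lambda>u. k * exp (k * u) * y u) integrable_on {a..b}"
proof -
  note [measurable] = cadlag_borel_measurable[OF y]
  obtain B where B: "B > 0" "\<And>u. u \<in> {a..b} \<Longrightarrow> \<bar>y u\<bar> \<le> B" using cadlag_bounded[OF y] by blast
  show ?thesis
  proof (rule integrable_on_measurable_bounded[where B="\<bar>k\<bar> * exp (\<bar>k\<bar> * (\<bar>a\<bar> + \<bar>b\<bar>)) * B"])
    fix u assume u: "u \<in> {a..b}"
    show "\<bar>k * exp (k * u) * y u\<bar> \<le> \<bar>k\<bar> * exp (\<bar>k\<bar> * (\<bar>a\<bar> + \<bar>b\<bar>)) * B"
      unfolding abs_mult[of _ "y u"] by (intro mult_mono abs_exp_le B u) auto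
  qed measurable
qed

lemma exp_grid_error_bounded:
  assumes y: "cadlag_on UNIV y"
  obtains K where "\<And>n u. u \<in> {a..b} \<Longrightarrow> \<bar>\<bar>k\<bar> * exp (k * u) * \<bar>y (grid_ceil n u) - y u\<bar>\<bar> \<le> K"
proof -
  \<comment> \<open>Rounding up can leave \<open>{a..b}\<close>, but by at most one mesh width,
    which is at most 1.\<close>
  obtain B where B: "B > 0" "\<And>u. u \<in> {a..b + 1} \<Longrightarrow> \<bar>y u\<bar> \<le> B" using cadlag_bounded[OF y] by blast
  have "\<bar>\<bar>k\<bar> * exp (k * u) * \<bar>y (grid_ceil n u) - y u\<bar>\<bar> \<le> \<bar>k\<bar> * exp (\<bar>k\<bar> * (\<bar>a\<bar> + \<bar>b\<bar>)) * (2 * B)"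
    if u: "u \<in> {a..b}" for n u
  proof -
    have "1 / real (Suc n) \<le> 1" by simp
    then have "grid_ceil n u \<in> {a..b+1}" using grid_ceil_ge[of u n] grid_ceil_less[of n u] u unfolding atLeastAtMost_iff by linarith
    then have "\<bar>y (grid_ceil n u) - y u\<bar> \<le> 2 * B"
      using B(2)[of u] B(2)[of "grid_ceil n u"] u by auto
    then have "\<bar>k * exp (k * u)\<bar> * \<bar>y (grid_ceil n u) - y u\<bar> \<le> \<bar>k\<bar> * exp (\<bar>k\<bar> * (\<bar>a\<bar> + \<bar>b\<bar>)) * (2 * B)"
      by (intro mult_mono abs_exp_le u) auto
    then show ?thesis by (simp add: abs_mult)
  qed
  then show ?thesis by (rule that)
qed

lemma integrable_on_exp_grid_error:
  assumes y: "cadlag_on UNIV y"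
  shows "(\<lambda>u. \<bar>k\<bar> * exp (k * u) * \<bar>y (grid_ceil n u) - y u\<bar>) integrable_on {a..b}"
proof -
  note [measurable] = cadlag_borel_measurable[OF y] borel_measurable_grid_ceil[of y n]
  obtain K where "\<And>n u. u \<in> {a..b} \<Longrightarrow> \<bar>\<bar>k\<bar> * exp (k * u) * \<bar>y (grid_ceil n u) - y u\<bar>\<bar> \<le> K"
    using exp_grid_error_bounded[OF y] by blast
  then show ?thesis by (intro integrable_on_measurable_bounded) measurable
qed

section \<open>Integrals of an exponential along a cadlag path and their Riemann sums\<close>

lemma deriv_exp_mult: "deriv (\<lambda>u. exp (k * u)) t = k * exp (k * t)" for k t :: real
  by (rule DERIV_imp_deriv) (auto intro!: derivative_eq_intros)

text \<open>With the base point fixed at 0, integrals over all intervals, reversed ones included,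
  become differences of a single function of time.\<close>

definition exp_primitive :: "real \<Rightarrow> (real \<Rightarrow> real) \<Rightarrow> real \<Rightarrow> real" where
  "exp_primitive k y x = cadlag_integral (\<lambda>u. exp (k * u)) y 0 x"

lemma exp_primitive_0 [simp]: "exp_primitive k y 0 = 0"
  by (simp add: exp_primitive_def cadlag_integral_def)

lemma cadlag_integral_exp:
  assumes y: "cadlag_on UNIV y"
  shows "cadlag_integral (\<lambda>u. exp (k * u)) y a b = exp_primitive k y b - exp_primitive k y a"
proof -
  note int = integrable_on_exp_cadlag[OF y, of k]
  note comb = Henstock_Kurzweil_Integration.integral_combine[OF _ _ int]
  consider "a \<le> 0" "0 \<le> b" | "0 \<le> a" "a \<le> b" | "a \<le> b" "b \<le> 0" | "b \<le> 0" "0 \<le> a" | "0 \<le> b" "b \<le> a" | "b \<le> a" "a \<le> 0"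
    by linarith
  then show ?thesis
    by cases (use comb[of a 0 b] comb[of 0 a b] comb[of a b 0] comb[of b 0 a] comb[of 0 b a] comb[of b a 0]
      in \<open>auto simp: exp_primitive_def cadlag_integral_def Let_def deriv_exp_mult\<close>)
qed

text \<open>Constants may be pulled out of the Henstock-Kurzweil integral unconditionally, so this
  holds for every path \<open>y\<close>.\<close>

lemma cadlag_integral_exp_shift:
  "cadlag_integral (\<lambda>u. exp ((u - t) * k)) y a b = exp (- k * t) * cadlag_integral (\<lambda>u. exp (k * u)) y a b"
proof -
  have A: "exp ((u - t) * k) = exp (- k * t) * exp (k * u)" for u
    by (simp add: algebra_simps flip: exp_add)
  have d: "deriv (\<lambda>u. exp ((u - t) * k)) = (\<lambda>u. exp (- k * t) * (k * exp (k * u)))"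
    unfolding A by (rule ext, rule DERIV_imp_deriv) (auto intro!: derivative_eq_intros)
  show ?thesis
    unfolding cadlag_integral_def d deriv_exp_mult Let_def unfolding A mult.assoc integral_mult_right
    by (simp add: algebra_simps)
qed

lemma exp_primitive_right_continuous:
  assumes y: "cadlag_on UNIV y"
  shows "(exp_primitive k y \<longlongrightarrow> exp_primitive k y x) (at_right x)"
proof -
  define h where "h u = k * exp (k * u) * y u" for u
  have eq: "exp_primitive k y z - exp_primitive k y x = exp (k * z) * y z - exp (k * x) * y x - integral {x..z} h" if "x \<le> z" for z
    using that cadlag_integral_exp[OF y, of k x z] by (simp add: cadlag_integral_def deriv_exp_mult h_def[abs_def])
  have "continuous_on {x..x+1} (\<lambda>z. integral {x..z} h)"
    unfolding h_def by (intro indefinite_integral_continuous_1 integrable_on_exp_cadlag y)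
  then have "((\<lambda>z. integral {x..z} h) \<longlongrightarrow> integral {x..x} h) (at x within {x..x+1})"
    unfolding continuous_on_def by (rule bspec) simp
  then have "((\<lambda>z. integral {x..z} h) \<longlongrightarrow> 0) (at_right x)"
    by (simp add: at_within_Icc_at_right)
  then have "((\<lambda>z. exp_primitive k y x + (exp (k * z) * y z - exp (k * x) * y x - integral {x..z} h)) \<longlongrightarrow>
      exp_primitive k y x + (exp (k * x) * y x - exp (k * x) * y x - 0)) (at_right x)"
    using y by (intro tendsto_intros) (auto simp: cadlag_on_UNIV_iff)
  then show ?thesis
    by (simp only: diff_self diff_zero add_0_right)
       (erule Lim_transform_eventually, auto simp: eventually_at_filter eq[symmetric])
qed

text \<open>A constant path has integral 0, so \<open>y\<close> may be replaced by
  \<open>y - l\<close>. The boundary terms then contribute at most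
  \<open>(exp (k * b) + exp (k * a)) * B\<close> and the integral at most
  \<open>(exp (k * b) - exp (k * a)) * B\<close>, which explains the factor 2.\<close>

lemma exp_primitive_increment_bound:
  assumes y: "cadlag_on UNIV y" and k: "0 < k" and ab: "a \<le> b"
    and B: "\<And>u. u \<in> {a..b} \<Longrightarrow> \<bar>y u - l\<bar> \<le> B"
  shows "\<bar>exp_primitive k y b - exp_primitive k y a\<bar> \<le> 2 * exp (k * b) * B"
proof -
  have i: "((\<lambda>u. k * exp (k * u) * c) has_integral (exp (k * b) * c - exp (k * a) * c)) {a..b}" for c
    by (rule fundamental_theorem_of_calculus[OF ab])
      (auto simp flip: has_real_derivative_iff_has_vector_derivative intro!: derivative_eq_intros)
  have intl: "(\<lambda>u. k * exp (k * u) * (y u - l)) integrable_on {a..b}"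
    using integrable_diff[OF integrable_on_exp_cadlag[OF y] has_integral_integrable[OF i]]
    by (simp add: right_diff_distrib)
  have "exp_primitive k y b - exp_primitive k y a =
     exp (k * b) * (y b - l) - exp (k * a) * (y a - l) - integral {a..b} (\<lambda>u. k * exp (k * u) * (y u - l))"
  proof -
    have "integral {a..b} (\<lambda>u. k * exp (k * u) * y u - k * exp (k * u) * l) =
      integral {a..b} (\<lambda>u. k * exp (k * u) * y u) - (exp (k * b) * l - exp (k * a) * l)"
      by (simp only: integral_diff[OF integrable_on_exp_cadlag[OF y] has_integral_integrable[OF i]] integral_unique[OF i])
    then show ?thesis
      using cadlag_integral_exp[OF y, of k a b] ab
      by (simp add: cadlag_integral_def deriv_exp_mult right_diff_distrib)
  qed
  moreover have "\<bar>exp (k * b) * (y b - l)\<bar> \<le> exp (k * b) * B"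
    using B[of b] ab unfolding abs_mult by simp
  moreover have "\<bar>exp (k * a) * (y a - l)\<bar> \<le> exp (k * a) * B"
    using B[of a] ab unfolding abs_mult by simp
  moreover have "norm (integral {a..b} (\<lambda>u. k * exp (k * u) * (y u - l))) \<le> integral {a..b} (\<lambda>u. k * exp (k * u) * B)"
    using B k by (intro integral_norm_bound_integral intl has_integral_integrable[OF i]) (auto simp: abs_mult)
  ultimately show ?thesis using integral_unique[OF i, of B] unfolding real_norm_def by linarith
qed

text \<open>On one cell, integration by parts turns the difference between integral and Riemann term
  into the integral of \<open>k * exp (k * u)\<close> times the value at the right end of the cell
  minus \<open>y u\<close>; that right end is \<open>grid_ceil n u\<close>. Errors of consecutive
  cells add up.\<close>

lemma exp_riemann_sum_cells:
  fixes p q :: int and n :: nat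
  assumes y: "cadlag_on UNIV y" and pq: "p \<le> q"
  defines "g \<equiv> \<lambda>i::int. of_int i / real (Suc n)"
  shows "\<bar>exp_primitive k y (g q) - exp_primitive k y (g p) - (\<Sum>i\<in>{p..<q}. exp (k * g i) * (y (g (i + 1)) - y (g i)))\<bar>
     \<le> integral {g p..g q} (\<lambda>u. \<bar>k\<bar> * exp (k * u) * \<bar>y (grid_ceil n u) - y u\<bar>)"
  using pq
proof (induction q rule: int_ge_induct)
  case base
  then show ?case by simp
next
  case (step q)
  note [measurable] = cadlag_borel_measurable[OF y]
  define D where "D u = \<bar>k\<bar> * exp (k * u) * \<bar>y (grid_ceil n u) - y u\<bar>" for u
  have gle: "g i \<le> g j" if "i \<le> j" for i j
    unfolding g_def using that by (intro divide_right_mono) auto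
  have Dint: "D integrable_on {a..b}" for a b
    unfolding D_def[abs_def] by (rule integrable_on_exp_grid_error[OF y])
  have ceil: "grid_ceil n u = g (q + 1)" if "u \<in> {g q..g (q + 1)} - {g q}" for u
  proof -
    have "of_int q < u * real (Suc n)" "u * real (Suc n) \<le> of_int (q + 1)"
    proof -
      have "of_int q / real (Suc n) < u" "u \<le> of_int (q + 1) / real (Suc n)"
        using that by (auto simp: g_def)
      then show "of_int q < u * real (Suc n)" "u * real (Suc n) \<le> of_int (q + 1)"
        by (simp_all only: pos_divide_less_eq pos_le_divide_eq of_nat_0_less_iff zero_less_Suc)
    qed
    then have "\<lceil>u * real (Suc n)\<rceil> = q + 1" by linarith
    then show ?thesis by (simp add: grid_ceil_def g_def)
  qed
  have i: "((\<lambda>u. k * exp (k * u) * c) has_integral (exp (k * g (q+1)) * c - exp (k * g q) * c)) {g q..g (q + 1)}" for c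
    by (rule fundamental_theorem_of_calculus[OF gle])
      (auto simp flip: has_real_derivative_iff_has_vector_derivative intro!: derivative_eq_intros)
  have cell: "exp_primitive k y (g (q + 1)) - exp_primitive k y (g q) - exp (k * g q) * (y (g (q + 1)) - y (g q)) =
     integral {g q..g (q + 1)} (\<lambda>u. k * exp (k * u) * y (g (q + 1)) - k * exp (k * u) * y u)"
  proof -
    have "integral {g q..g (q + 1)} (\<lambda>u. k * exp (k * u) * y (g (q + 1)) - k * exp (k * u) * y u) =
      (exp (k * g (q+1)) * y (g (q + 1)) - exp (k * g q) * y (g (q + 1))) - integral {g q..g (q + 1)} (\<lambda>u. k * exp (k * u) * y u)"
      by (simp only: integral_diff[OF has_integral_integrable[OF i] integrable_on_exp_cadlag[OF y]] integral_unique[OF i])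
    then show ?thesis
      using cadlag_integral_exp[OF y, of k "g q" "g (q + 1)"] gle[of q "q + 1"]
      by (simp add: cadlag_integral_def deriv_exp_mult right_diff_distrib)
  qed
  \<comment> \<open>The left end of the cell is a grid point and rounds to itself rather than to
    \<open>g (q + 1)\<close>; this single point is removed as a null set.\<close>
  have "norm (integral {g q..g (q + 1)} (\<lambda>u. k * exp (k * u) * y (g (q + 1)) - k * exp (k * u) * y u)) \<le> integral {g q..g (q + 1)} (\<lambda>u. if u = g q then norm (k * exp (k * u) * y (g (q + 1)) - k * exp (k * u) * y u) else D u)"
  proof (rule integral_norm_bound_integral)
    show "(\<lambda>u. if u = g q then norm (k * exp (k * u) * y (g (q + 1)) - k * exp (k * u) * y u) else D u) integrable_on {g q..g (q + 1)}"
      by (rule integrable_spike[OF Dint, of "{g q}"]) auto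
    fix u assume "u \<in> {g q..g (q + 1)}"
    then show "norm (k * exp (k * u) * y (g (q + 1)) - k * exp (k * u) * y u) \<le> (if u = g q then norm (k * exp (k * u) * y (g (q + 1)) - k * exp (k * u) * y u) else D u)"
      using ceil[of u] by (auto simp: D_def abs_mult simp flip: right_diff_distrib)
  qed (intro integrable_diff has_integral_integrable[OF i] integrable_on_exp_cadlag y)
  also have "\<dots> = integral {g q..g (q + 1)} D"
    by (rule integral_spike[of "{g q}"]) auto
  finally have "\<bar>exp_primitive k y (g (q + 1)) - exp_primitive k y (g q) - exp (k * g q) * (y (g (q + 1)) - y (g q))\<bar> \<le> integral {g q..g (q + 1)} D"
    unfolding cell by simp
  moreover have "{p..<q + 1} = insert q {p..<q}" using step by auto
  moreover have "integral {g p..g (q + 1)} D = integral {g p..g q} D + integral {g q..g (q + 1)} D"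
    using step by (intro Henstock_Kurzweil_Integration.integral_combine[symmetric] gle Dint) auto
  ultimately show ?case using step.IH unfolding D_def[abs_def, symmetric] by simp
qed

text \<open>The error integral vanishes by dominated convergence, as
  \<open>y (grid_ceil n u)\<close> tends to \<open>y u\<close>. The sums run between the rounded
  endpoints, which right continuity of the primitive moves back to \<open>a\<close> and
  \<open>b\<close>.\<close>

lemma exp_riemann_sum_tendsto:
  assumes y: "cadlag_on UNIV y" and ab: "a \<le> b"
  shows "(\<lambda>n. \<Sum>i\<in>{\<lceil>a * real (Suc n)\<rceil>..<\<lceil>b * real (Suc n)\<rceil>}.
      exp (k * (of_int i / real (Suc n))) * (y (of_int (i + 1) / real (Suc n)) - y (of_int i / real (Suc n))))
     \<longlonglongrightarrow> exp_primitive k y b - exp_primitive k y a" (is "?S \<longlonglongrightarrow> ?I")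
proof -
  note [measurable] = cadlag_borel_measurable[OF y]
  define D where "D n u = \<bar>k\<bar> * exp (k * u) * \<bar>y (grid_ceil n u) - y u\<bar>" for n u
  obtain K where DK: "\<And>n u. u \<in> {a..b+1} \<Longrightarrow> \<bar>D n u\<bar> \<le> K"
    using exp_grid_error_bounded[OF y, of a "b + 1" k] unfolding D_def by blast
  have D: "D n integrable_on {a..b+1}" for n
    unfolding D_def[abs_def] by (rule integrable_on_exp_grid_error[OF y])
  have "(\<lambda>n. integral {a..b+1} (D n)) \<longlonglongrightarrow> integral {a..b+1} (\<lambda>u. 0)"
  proof (rule dominated_convergence(2)[where h="\<lambda>_. K"])
    show "(\<lambda>n. D n u) \<longlonglongrightarrow> 0" for u
    proof -
      have "(\<lambda>n. \<bar>k\<bar> * exp (k * u) * \<bar>y (grid_ceil n u) - y u\<bar>) \<longlonglongrightarrow> \<bar>k\<bar> * exp (k * u) * \<bar>y u - y u\<bar>"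
        by (intro tendsto_intros cadlag_grid_ceil_tendsto y)
      then show ?thesis by (simp add: D_def)
    qed
  qed (use DK D in auto)
  then have D0: "(\<lambda>n. integral {a..b+1} (D n)) \<longlonglongrightarrow> 0" by simp
  have P: "(\<lambda>n. exp_primitive k y (grid_ceil n x)) \<longlonglongrightarrow> exp_primitive k y x" for x
    by (rule right_continuous_compose_seq[OF exp_primitive_right_continuous[OF y] grid_ceil_tendsto grid_ceil_ge])
  have "(\<lambda>n. exp_primitive k y (grid_ceil n b) - exp_primitive k y (grid_ceil n a) - ?S n) \<longlonglongrightarrow> 0"
  proof (rule Lim_null_comparison[OF always_eventually D0], rule allI)
    fix n
    have le: "\<lceil>a * real (Suc n)\<rceil> \<le> \<lceil>b * real (Suc n)\<rceil>" using ab by (intro ceiling_mono mult_right_mono) auto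
    have "norm (exp_primitive k y (grid_ceil n b) - exp_primitive k y (grid_ceil n a) - ?S n)
      \<le> integral {grid_ceil n a..grid_ceil n b} (D n)"
      using exp_riemann_sum_cells[OF y le, of k n] by (simp add: grid_ceil_def D_def[abs_def])
    also have "\<dots> \<le> integral {a..b+1} (D n)"
    proof (rule integral_subset_le[OF _ integrable_on_subinterval[OF D] D])
      have "1 / real (Suc n) \<le> 1" by simp
      then have "grid_ceil n b \<le> b + 1" using grid_ceil_less[of n b] by linarith
      then show *: "{grid_ceil n a..grid_ceil n b} \<subseteq> {a..b + 1}"
        using grid_ceil_ge[of a n] by auto
      show "{grid_ceil n a..grid_ceil n b} \<subseteq> {a..b + 1}" by fact
    qed (simp add: D_def)
    finally show "norm (exp_primitive k y (grid_ceil n b) - exp_primitive k y (grid_ceil n a) - ?S n) \<le> integral {a..b+1} (D n)" .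
  qed
  then have "(\<lambda>n. (exp_primitive k y (grid_ceil n b) - exp_primitive k y (grid_ceil n a)) - (exp_primitive k y (grid_ceil n b) - exp_primitive k y (grid_ceil n a) - ?S n)) \<longlonglongrightarrow> (exp_primitive k y b - exp_primitive k y a) - 0"
    by (intro tendsto_intros P)
  then show ?thesis by simp
qed

section \<open>Path regularity of two-sided processes and of time changes\<close>

lemma tendsto_at_left_limits:
  fixes f l :: "real \<Rightarrow> real"
  assumes l: "\<And>v. v \<in> {a<..<b} \<Longrightarrow> (f \<longlongrightarrow> l v) (at_left v)"
    and "\<And>v. v \<in> {a<..<b} \<Longrightarrow> \<bar>f v - z\<bar> \<le> e" and v: "v \<in> {a<..<b}"
  shows "\<bar>l v - z\<bar> \<le> e"
proof -
  have "((\<lambda>w. \<bar>f w - z\<bar>) \<longlongrightarrow> \<bar>l v - z\<bar>) (at_left v)" by (intro tendsto_intros l v)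
  moreover have "eventually (\<lambda>w. \<bar>f w - z\<bar> \<le> e) (at_left v)"
    using v assms(2) by (auto simp: eventually_at_left_field intro!: exI[of _ a])
  ultimately show ?thesis by (intro tendsto_upperbound) auto
qed

lemma cadlag_on_halfline:
  assumes "cadlag_on {0..} f"
  shows "0 \<le> t \<Longrightarrow> (f \<longlongrightarrow> f t) (at_right t)" and "0 < t \<Longrightarrow> (f \<longlongrightarrow> Lim (at_left t) f) (at_left t)"
proof -
  show "(f \<longlongrightarrow> f t) (at_right t)" if "0 \<le> t"
  proof -
    have "{0..} \<inter> {t<..} = {t<..}" using that by auto
    moreover have "(f \<longlongrightarrow> f t) (at t within ({0..} \<inter> {t<..}))"
      using assms that unfolding cadlag_on_def by auto
    ultimately show ?thesis by simp
  qed
  show "(f \<longlongrightarrow> Lim (at_left t) f) (at_left t)" if "0 < t"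
  proof -
    have t: "0 \<le> t" using that by simp
    obtain l where "(f \<longlongrightarrow> l) (at t within ({0..} \<inter> {..<t}))"
      using assms[unfolded cadlag_on_def, rule_format, of t] t by auto
    moreover have "at t within ({0..} \<inter> {..<t}) = at_left t"
      using that by (intro at_within_nhd[of _ "{0<..}"]) auto
    ultimately show ?thesis by (simp add: tendsto_Lim)
  qed
qed

text \<open>Reflection exchanges the sides. The left-limit function \<open>l\<close> of
  \<open>h\<close> is continuous from the left and has the right limit \<open>h u\<close> at
  \<open>u\<close>; hence \<open>- l (- t)\<close> is continuous from the right and has the left
  limit \<open>- h (- t)\<close>.\<close>

lemma cadlag_two_sided:
  assumes f: "cadlag_on {0..} f" and h: "cadlag_on {0..} h" and "f 0 = 0" "h 0 = 0"
    and g: "\<And>t. t \<ge> 0 \<Longrightarrow> g t = f t" "\<And>t. t < 0 \<Longrightarrow> g t = - Lim (at_left (- t)) h"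
  shows "cadlag_on UNIV g"
proof -
  define l where "l v = Lim (at_left v) h" for v
  have hl: "(h \<longlongrightarrow> l v) (at_left v)" if "v > 0" for v
    unfolding l_def using cadlag_on_halfline(2)[OF h that] .
  have l_left: "(l \<longlongrightarrow> l u) (at_left u)" if u: "u > 0" for u
  proof (rule tendstoI)
    fix e :: real assume e: "e > 0"
    from tendstoD[OF hl[OF u], of "e/2"] e obtain a where a: "a < u" "\<And>v. a < v \<Longrightarrow> v < u \<Longrightarrow> dist (h v) (l u) < e / 2"
      by (auto simp: eventually_at_left_field)
    have "dist (l v) (l u) < e" if "max a 0 < v" "v < u" for v
      using tendsto_at_left_limits[of "max a 0" u h l "l u" "e/2" v] a that e hl
      by (force simp: dist_real_def less_imp_le)
    then show "eventually (\<lambda>v. dist (l v) (l u) < e) (at_left u)"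
      using a u by (auto simp: eventually_at_left_field intro!: exI[of _ "max a 0"])
  qed
  \<comment> \<open>The point \<open>u = 0\<close> is included because it provides the left limit of
    \<open>g\<close> at 0.\<close>
  have l_right: "(l \<longlongrightarrow> h u) (at_right u)" if u: "u \<ge> 0" for u
  proof (rule tendstoI)
    fix e :: real assume e: "e > 0"
    from tendstoD[OF cadlag_on_halfline(1)[OF h u], of "e/2"] e obtain a where a: "a > u" "\<And>v. u < v \<Longrightarrow> v < a \<Longrightarrow> dist (h v) (h u) < e / 2"
      by (auto simp: eventually_at_right_field)
    have "dist (l v) (h u) < e" if "u < v" "v < a" for v
      using tendsto_at_left_limits[of u a h l "h u" "e/2" v] a that e hl u
      by (force simp: dist_real_def less_imp_le)
    then show "eventually (\<lambda>v. dist (l v) (h u) < e) (at_right u)"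
      using a u by (auto simp: eventually_at_right_field)
  qed
  have right: "(g \<longlongrightarrow> g t) (at_right t)" for t
  proof (cases "t \<ge> 0")
    case True
    show ?thesis
      by (rule Lim_transform_eventually[of f])
        (use True cadlag_on_halfline(1)[OF f True] in \<open>auto simp: g eventually_at_filter\<close>)
  next
    case False
    have "((\<lambda>s. - l (- s)) \<longlongrightarrow> - l (- t)) (at_right t)"
      unfolding at_right_minus filterlim_filtermap using l_left[of "-t"] False by (auto intro!: tendsto_intros)
    then have "((\<lambda>s. - l (- s)) \<longlongrightarrow> g t) (at_right t)" using False by (simp add: g l_def)
    then show ?thesis
      by (rule Lim_transform_eventually)
        (use False in \<open>auto simp: g l_def eventually_at_right_field intro!: exI[of _ 0]\<close>)
  qed
  have left: "\<exists>l. (g \<longlongrightarrow> l) (at_left t)" for t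
  proof (cases "t > 0")
    case True
    have "(g \<longlongrightarrow> Lim (at_left t) f) (at_left t)"
      by (rule Lim_transform_eventually[OF cadlag_on_halfline(2)[OF f True]])
        (use True in \<open>auto simp: g eventually_at_left_field intro!: exI[of _ 0]\<close>)
    then show ?thesis ..
  next
    case False
    have "((\<lambda>s. - l (- s)) \<longlongrightarrow> - h (- t)) (at_left t)"
      unfolding at_left_minus filterlim_filtermap using l_right[of "-t"] False by (auto intro!: tendsto_intros)
    then have "(g \<longlongrightarrow> - h (- t)) (at_left t)"
      by (rule Lim_transform_eventually)
        (use False in \<open>auto simp: g l_def eventually_at_filter\<close>)
    then show ?thesis ..
  qed
  show ?thesis unfolding cadlag_on_UNIV_iff using left right by blast
qed

lemma cadlag_compose_strict_mono:
  assumes y: "cadlag_on UNIV y" and c: "continuous_on UNIV \<tau>" and m: "strict_mono \<tau>"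
  shows "cadlag_on UNIV (\<lambda>t. y (\<tau> t :: real))"
proof -
  have c': "(\<tau> \<longlongrightarrow> \<tau> t) (at t within S)" for t S
    using c by (meson UNIV_I continuous_on_def tendsto_within_subset subset_UNIV)
  have "filterlim \<tau> (at_right (\<tau> t)) (at_right t)" "filterlim \<tau> (at_left (\<tau> t)) (at_left t)" for t
    using c' m by (auto simp: filterlim_at eventually_at_filter strict_mono_less strict_mono_eq)
  note F = this
  show ?thesis unfolding cadlag_on_UNIV_iff
  proof (intro allI conjI)
    fix t
    obtain l where "(y \<longlongrightarrow> y (\<tau> t)) (at_right (\<tau> t))" "(y \<longlongrightarrow> l) (at_left (\<tau> t))"
      using y unfolding cadlag_on_UNIV_iff by metis
    with F[of t] show "((\<lambda>t. y (\<tau> t)) \<longlongrightarrow> y (\<tau> t)) (at_right t)" "\<exists>l. ((\<lambda>t. y (\<tau> t)) \<longlongrightarrow> l) (at_left t)"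
      by (auto intro: filterlim_compose)
  qed
qed

section \<open>Ottaviani's inequality and almost sure convergence\<close>

text \<open>The sums are tails rather than initial sums because the convergence sought is at the
  left end of the time axis. The event is split by the last \<open>k\<close> whose tail
  \<open>T k\<close> exceeds \<open>2 * \<epsilon>\<close>. That event depends on the variables from
  \<open>k\<close> on only, so it is independent of \<open>\<bar>S k\<bar> \<le> \<epsilon>\<close>,
  which has probability at least 1/2; on the intersection the full sum exceeds
  \<open>\<epsilon>\<close>.\<close>

lemma (in prob_space) ottaviani_tail_inequality:
  fixes X :: "nat \<Rightarrow> 'a \<Rightarrow> real"
  assumes ind: "indep_vars (\<lambda>_. borel) X {..<n}"
    and half: "\<And>k. k \<le> n \<Longrightarrow> prob {\<omega>\<in>space M. \<bar>\<Sum>i<k. X i \<omega>\<bar> > \<epsilon>} \<le> 1/2"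
  shows "prob {\<omega>\<in>space M. \<exists>k\<le>n. \<bar>\<Sum>i\<in>{k..<n}. X i \<omega>\<bar> > 2 * \<epsilon>} \<le> 2 * prob {\<omega>\<in>space M. \<bar>\<Sum>i<n. X i \<omega>\<bar> > \<epsilon>}"
proof -
  have X[measurable]: "X i \<in> borel_measurable M" if "i < n" for i
    using ind that by (auto simp: indep_vars_def)
  define T where "T k \<omega> = (\<Sum>i\<in>{k..<n}. X i \<omega>)" for k \<omega>
  define S where "S k \<omega> = (\<Sum>i<k. X i \<omega>)" for k \<omega>
  have T[measurable]: "T k \<in> borel_measurable M" for k unfolding T_def by measurable
  have S[measurable]: "S k \<in> borel_measurable M" if "k \<le> n" for k
    unfolding S_def using that by (intro borel_measurable_sum X) auto
  define A where "A k = {\<omega>\<in>space M. \<bar>T k \<omega>\<bar> > 2 * \<epsilon> \<and> (\<forall>j\<in>{k<..n}. \<bar>T j \<omega>\<bar> \<le> 2 * \<epsilon>)}" for k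
  define B where "B k = {\<omega>\<in>space M. \<bar>S k \<omega>\<bar> \<le> \<epsilon>}" for k
  have A[measurable]: "A k \<in> events" for k unfolding A_def by measurable
  have B: "B k \<in> events" if "k \<le> n" for k unfolding B_def using S[OF that] by measurable
  have AB: "prob (A k \<inter> B k) = prob (A k) * prob (B k)" if k: "k \<le> n" for k
  proof -
    define A' where "A' = {x\<in>space (PiM {k..<n} (\<lambda>_. borel)). \<bar>\<Sum>i\<in>{k..<n}. x i\<bar> > 2 * \<epsilon> \<and> (\<forall>j\<in>{k<..n}. \<bar>\<Sum>i\<in>{j..<n}. x i :: real\<bar> \<le> 2 * \<epsilon>)}"
    define B' where "B' = {x\<in>space (PiM {..<k} (\<lambda>_. borel)). \<bar>\<Sum>i<k. x i :: real\<bar> \<le> \<epsilon>}"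
    have c: "(\<lambda>x. \<Sum>i\<in>{j..<n}. x i :: real) \<in> borel_measurable (PiM {k..<n} (\<lambda>_. borel))" if "k \<le> j" for j
      using that by (intro borel_measurable_sum measurable_component_singleton) auto
    have A': "A' \<in> sets (PiM {k..<n} (\<lambda>_. borel))"
      unfolding A'_def using c by measurable
    have B': "B' \<in> sets (PiM {..<k} (\<lambda>_. borel))"
      unfolding B'_def by measurable
    have iv: "indep_var (PiM {k..<n} (\<lambda>_. borel)) (\<lambda>\<omega>. restrict (\<lambda>i. X i \<omega>) {k..<n}) (PiM {..<k} (\<lambda>_. borel)) (\<lambda>\<omega>. restrict (\<lambda>i. X i \<omega>) {..<k})"
      using k by (intro indep_var_restrict[OF ind]) auto
    have 1: "(\<lambda>x. (restrict (\<lambda>i. X i x) {k..<n}, restrict (\<lambda>i. X i x) {..<k})) -` (A' \<times> B') \<inter> space M = A k \<inter> B k"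
      by (auto simp: A'_def B'_def A_def B_def T_def S_def space_PiM)
    have 2: "(\<lambda>x. restrict (\<lambda>i. X i x) {k..<n}) -` A' \<inter> space M = A k"
      by (auto simp: A'_def A_def T_def space_PiM)
    have 3: "(\<lambda>x. restrict (\<lambda>i. X i x) {..<k}) -` B' \<inter> space M = B k"
      by (auto simp: B'_def B_def S_def space_PiM)
    show ?thesis using indep_varD[OF iv A' B'] unfolding 1 2 3 .
  qed
  have Bhalf: "prob (B k) \<ge> 1/2" if k: "k \<le> n" for k
  proof -
    have "B k = space M - {\<omega>\<in>space M. \<bar>\<Sum>i<k. X i \<omega>\<bar> > \<epsilon>}" by (auto simp: B_def S_def)
    moreover have "{\<omega>\<in>space M. \<bar>\<Sum>i<k. X i \<omega>\<bar> > \<epsilon>} \<in> events" using S[OF k] unfolding S_def by measurable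
    ultimately have "prob (B k) = 1 - prob {\<omega>\<in>space M. \<bar>\<Sum>i<k. X i \<omega>\<bar> > \<epsilon>}" by (simp add: prob_compl)
    then show ?thesis using half[OF k] by simp
  qed
  have disj: "disjoint_family_on A {..n}"
  proof (unfold disjoint_family_on_def, intro ballI impI)
    fix i j assume "i \<in> {..n}" "j \<in> {..n}" "i \<noteq> j"
    moreover have "A i \<inter> A j = {}" if "i < j" "j \<le> n" for i j
      using that by (force simp: A_def)
    ultimately show "A i \<inter> A j = {}"
      by (metis Int_commute atMost_iff linorder_neqE_nat)
  qed
  have sub: "A k \<inter> B k \<subseteq> {\<omega>\<in>space M. \<bar>\<Sum>i<n. X i \<omega>\<bar> > \<epsilon>}" if "k \<le> n" for k
  proof -
    have "(\<Sum>i<n. X i \<omega>) = S k \<omega> + T k \<omega>" for \<omega>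
      unfolding S_def T_def using that by (subst sum.union_disjoint[symmetric]) (auto intro!: sum.cong)
    then show ?thesis by (auto simp: A_def B_def)
  qed
  have un: "{\<omega>\<in>space M. \<exists>k\<le>n. \<bar>\<Sum>i\<in>{k..<n}. X i \<omega>\<bar> > 2 * \<epsilon>} \<subseteq> (\<Union>k\<le>n. A k)"
  proof safe
    fix \<omega> k assume w: "\<omega> \<in> space M" "k \<le> n" "\<bar>\<Sum>i\<in>{k..<n}. X i \<omega>\<bar> > 2 * \<epsilon>"
    define K where "K = {k. k \<le> n \<and> \<bar>T k \<omega>\<bar> > 2 * \<epsilon>}"
    have K: "finite K" "k \<in> K" using w by (auto simp: K_def T_def)
    then have m: "Max K \<in> K" "\<And>j. j \<in> K \<Longrightarrow> j \<le> Max K" by (auto intro: Max_in)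
    have "Max K \<le> n \<and> \<bar>T (Max K) \<omega>\<bar> > 2 * \<epsilon>" using m(1) unfolding K_def by blast
    moreover have "\<bar>T j \<omega>\<bar> \<le> 2 * \<epsilon>" if "Max K < j" "j \<le> n" for j
      using m(2)[of j] that by (force simp: K_def[THEN eqset_imp_iff])
    ultimately have "\<omega> \<in> A (Max K)" using w(1) by (simp add: A_def)
    then show "\<omega> \<in> (\<Union>k\<le>n. A k)" using m(1) by (auto simp: K_def)
  qed
  have "prob {\<omega>\<in>space M. \<exists>k\<le>n. \<bar>\<Sum>i\<in>{k..<n}. X i \<omega>\<bar> > 2 * \<epsilon>} \<le> prob (\<Union>k\<le>n. A k)"
    by (rule finite_measure_mono[OF un]) auto
  also have "\<dots> = (\<Sum>k\<le>n. prob (A k))"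
    by (rule finite_measure_finite_Union) (use disj in auto)
  also have "\<dots> \<le> (\<Sum>k\<le>n. 2 * prob (A k \<inter> B k))"
  proof (rule sum_mono)
    fix k assume "k \<in> {..n}"
    then show "prob (A k) \<le> 2 * prob (A k \<inter> B k)"
      using AB[of k] mult_left_mono[OF Bhalf[of k], of "prob (A k)"] by simp
  qed
  also have "\<dots> = 2 * prob (\<Union>k\<le>n. A k \<inter> B k)"
  proof -
    have "disjoint_family_on (\<lambda>k. A k \<inter> B k) {..n}" using disj by (auto simp: disjoint_family_on_def)
    then show ?thesis using B
      by (subst finite_measure_finite_Union) (auto simp: sum_distrib_left)
  qed
  also have "\<dots> \<le> 2 * prob {\<omega>\<in>space M. \<bar>\<Sum>i<n. X i \<omega>\<bar> > \<epsilon>}"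
    using sub by (intro mult_left_mono finite_measure_mono UN_least) auto
  finally show ?thesis .
qed

lemma convergent_at_bot_if_Cauchy:
  fixes x :: "real \<Rightarrow> real"
  assumes C: "\<And>e. 0 < e \<Longrightarrow> \<exists>b. \<forall>a\<le>b. \<bar>x a - x b\<bar> \<le> e"
  shows "\<exists>l. (x \<longlongrightarrow> l) at_bot"
proof -
  have "Cauchy (\<lambda>n::nat. x (- real n))"
  proof (rule CauchyI)
    fix e :: real assume "e > 0"
    then obtain b where b: "\<And>a. a \<le> b \<Longrightarrow> \<bar>x a - x b\<bar> \<le> e / 3" using C[of "e/3"] by auto
    obtain N :: nat where N: "- b \<le> real N" using real_arch_simple by blast
    show "\<exists>N. \<forall>m\<ge>N. \<forall>n\<ge>N. norm (x (- real m) - x (- real n)) < e"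
    proof (intro exI allI impI)
      fix m n assume mn: "N \<le> m" "N \<le> n"
      have "- real m \<le> b" "- real n \<le> b" using N mn by (auto intro: order_trans[of _ "- real N"])
      then show "norm (x (- real m) - x (- real n)) < e"
        using b[of "- real m"] b[of "- real n"] \<open>e > 0\<close> unfolding real_norm_def by linarith
    qed
  qed
  then obtain l where l: "(\<lambda>n::nat. x (- real n)) \<longlonglongrightarrow> l"
    using real_Cauchy_convergent convergent_def by blast
  have "(x \<longlongrightarrow> l) at_bot"
  proof (rule tendstoI)
    fix e :: real assume e: "e > 0"
    then obtain b where b: "\<And>a. a \<le> b \<Longrightarrow> \<bar>x a - x b\<bar> \<le> e / 3" using C[of "e/3"] by auto
    obtain N :: nat where N: "- b \<le> real N" using real_arch_simple by blast
    have "\<bar>l - x b\<bar> \<le> e / 3"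
    proof (rule tendsto_upperbound)
      show "(\<lambda>n::nat. \<bar>x (- real n) - x b\<bar>) \<longlonglongrightarrow> \<bar>l - x b\<bar>" by (intro tendsto_intros l)
      show "eventually (\<lambda>n. \<bar>x (- real n) - x b\<bar> \<le> e / 3) sequentially"
        using eventually_ge_at_top[of N] by eventually_elim (use N b in auto)
    qed simp
    then have "dist (x a) l < e" if "a \<le> b" for a using b[OF that] e unfolding dist_real_def by linarith
    then show "eventually (\<lambda>a. dist (x a) l < e) at_bot" unfolding eventually_at_bot_linorder by blast
  qed
  then show ?thesis ..
qed

text \<open>The points \<open>s m\<close> of the grids anchored at \<open>b\<close> approach
  \<open>a\<close> from the right. Level \<open>m\<close> has \<open>4 ^ m\<close> steps of length
  \<open>2 ^ - m\<close> and so reaches back to \<open>b - 2 ^ m\<close>, which eventually passes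
  any given \<open>a\<close>.\<close>

lemma right_continuous_bound_dyadic:
  fixes x :: "real \<Rightarrow> real"
  assumes rc: "\<And>t. (x \<longlongrightarrow> x t) (at_right t)" and a: "a \<le> b"
    and bound: "\<And>m i::nat. i \<le> 4 ^ m \<Longrightarrow> \<bar>x b - x (b - real i / 2 ^ m)\<bar> \<le> e"
  shows "\<bar>x a - x b\<bar> \<le> e"
proof -
  define i where "i m = nat \<lfloor>(b - a) * 2 ^ m\<rfloor>" for m :: nat
  define s where "s m = b - real (i m) / 2 ^ m" for m
  have i: "real (i m) \<le> (b - a) * 2 ^ m" "(b - a) * 2 ^ m < real (i m) + 1" for m
    using a by (simp_all add: i_def)
  have sge: "a \<le> s m" for m using i(1)[of m] by (simp add: s_def field_simps)
  have sle: "s m \<le> a + (1/2) ^ m" for m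
  proof -
    have "b - a < (real (i m) + 1) / 2 ^ m" using i(2)[of m] by (simp add: pos_less_divide_eq)
    then show ?thesis by (simp add: s_def add_divide_distrib power_one_over)
  qed
  have "s \<longlonglongrightarrow> a"
  proof (rule tendsto_sandwich[of "\<lambda>_. a" _ _ "\<lambda>m. a + (1/2) ^ m"])
    have "(\<lambda>m. a + (1/2) ^ m) \<longlonglongrightarrow> a + 0" by (intro tendsto_intros LIMSEQ_realpow_zero) auto
    then show "(\<lambda>m. a + (1/2) ^ m) \<longlonglongrightarrow> a" by simp
  qed (use sge sle in auto)
  then have lim: "(\<lambda>m. x (s m)) \<longlonglongrightarrow> x a"
    using sge by (intro right_continuous_compose_seq[OF rc])
  have "\<bar>x b - x a\<bar> \<le> e"
  proof (rule tendsto_upperbound)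
    show "(\<lambda>m. \<bar>x b - x (s m)\<bar>) \<longlonglongrightarrow> \<bar>x b - x a\<bar>" by (intro tendsto_intros lim)
    obtain N :: nat where N: "b - a \<le> real N" using real_arch_simple by blast
    show "eventually (\<lambda>m. \<bar>x b - x (s m)\<bar> \<le> e) sequentially"
      using eventually_ge_at_top[of N]
    proof eventually_elim
      case (elim m)
      have "real N \<le> 2 ^ m" using elim less_exp[of m] by (metis less_imp_le of_nat_le_iff of_nat_numeral of_nat_power order_trans)
      then have "b - a \<le> 2 ^ m" using N by linarith
      then have "(b - a) * 2 ^ m \<le> 2 ^ m * 2 ^ m" by (intro mult_right_mono) auto
      also have "\<dots> = 4 ^ m" by (simp flip: power_mult_distrib)
      finally have "real (i m) \<le> 4 ^ m" using i(1)[of m] by linarith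
      then have "i m \<le> 4 ^ m" by (metis of_nat_le_iff of_nat_numeral of_nat_power)
      then show ?case unfolding s_def by (rule bound)
    qed
  qed simp
  then show ?thesis by (simp add: abs_minus_commute)
qed

text \<open>Ottaviani's inequality on a finite grid left of \<open>b\<close> bounds the probability
  of a large deviation from \<open>X b\<close> independently of the grid. The dyadic grids are
  nested, so the bound survives their union, and right continuity carries it from dyadic points to
  all \<open>a \<le> b\<close>.\<close>

lemma (in prob_space) AE_convergent_at_bot_if_Cauchy_in_prob:
  fixes X :: "real \<Rightarrow> 'a \<Rightarrow> real"
  assumes X[measurable]: "\<And>t. X t \<in> borel_measurable M"
    and rc: "AE \<omega> in M. \<forall>t. ((\<lambda>s. X s \<omega>) \<longlongrightarrow> X t \<omega>) (at_right t)"
    and ind: "independent_increments_on M UNIV X"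
    and Cauchy: "\<And>\<epsilon> \<eta>. 0 < \<epsilon> \<Longrightarrow> 0 < \<eta> \<Longrightarrow> \<exists>b. \<forall>a\<le>b. prob {\<omega>\<in>space M. \<bar>X a \<omega> - X b \<omega>\<bar> > \<epsilon>} \<le> \<eta>"
  shows "AE \<omega> in M. \<exists>l. ((\<lambda>t. X t \<omega>) \<longlongrightarrow> l) at_bot"
proof -
  have key: "\<exists>b E. E \<in> events \<and> prob E \<le> \<eta> \<and> (\<forall>\<omega>\<in>space M - E. (\<forall>t. ((\<lambda>s. X s \<omega>) \<longlongrightarrow> X t \<omega>) (at_right t)) \<longrightarrow> (\<forall>a\<le>b. \<bar>X a \<omega> - X b \<omega>\<bar> \<le> \<epsilon>))"
    if eps: "\<epsilon> > 0" and eta: "\<eta> > 0" for \<epsilon> \<eta>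
  proof -
    \<comment> \<open>The bound 1/4, used at two times, yields the 1/2 that Ottaviani's inequality
      requires; \<open>\<eta> / 2\<close> absorbs its factor 2.\<close>
    define \<eta>' where "\<eta>' = min (1/4) (\<eta>/2)"
    have eta': "\<eta>' > 0" using eta by (simp add: \<eta>'_def)
    obtain b where b: "\<And>a. a \<le> b \<Longrightarrow> prob {\<omega>\<in>space M. \<bar>X a \<omega> - X b \<omega>\<bar> > \<epsilon>/4} \<le> \<eta>'"
      using Cauchy[of "\<epsilon>/4" \<eta>'] eps eta' by auto
    have b2: "prob {\<omega>\<in>space M. \<bar>X a \<omega> - X a' \<omega>\<bar> > \<epsilon>/2} \<le> 1/2" if "a \<le> b" "a' \<le> b" for a a'
    proof -
      have "prob {\<omega>\<in>space M. \<bar>X a \<omega> - X a' \<omega>\<bar> > \<epsilon>/2} \<le> prob ({\<omega>\<in>space M. \<bar>X a \<omega> - X b \<omega>\<bar> > \<epsilon>/4} \<union> {\<omega>\<in>space M. \<bar>X a' \<omega> - X b \<omega>\<bar> > \<epsilon>/4})"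
      proof (rule finite_measure_mono)
        have "\<bar>X a \<omega> - X b \<omega>\<bar> > \<epsilon>/4 \<or> \<bar>X a' \<omega> - X b \<omega>\<bar> > \<epsilon>/4" if "\<bar>X a \<omega> - X a' \<omega>\<bar> > \<epsilon>/2" for \<omega>
          using that by linarith
        then show "{\<omega>\<in>space M. \<bar>X a \<omega> - X a' \<omega>\<bar> > \<epsilon>/2} \<subseteq> {\<omega>\<in>space M. \<bar>X a \<omega> - X b \<omega>\<bar> > \<epsilon>/4} \<union> {\<omega>\<in>space M. \<bar>X a' \<omega> - X b \<omega>\<bar> > \<epsilon>/4}"
          by blast
      qed measurable
      also have "\<dots> \<le> prob {\<omega>\<in>space M. \<bar>X a \<omega> - X b \<omega>\<bar> > \<epsilon>/4} + prob {\<omega>\<in>space M. \<bar>X a' \<omega> - X b \<omega>\<bar> > \<epsilon>/4}"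
        by (rule measure_Un_le) measurable
      also have "\<dots> \<le> 1/4 + 1/4" using b[OF that(1)] b[OF that(2)] by (intro add_mono) (auto simp: \<eta>'_def)
      finally show ?thesis by simp
    qed
    define E where "E m = {\<omega>\<in>space M. \<exists>i\<le>(4::nat)^m. \<bar>X b \<omega> - X (b - real i / 2 ^ m) \<omega>\<bar> > \<epsilon>}" for m :: nat
    have E[measurable]: "E m \<in> events" for m unfolding E_def by measurable
    have PE: "prob (E m) \<le> \<eta>" for m
    proof -
      define n where "n = (4::nat)^m"
      \<comment> \<open>The grid is listed from left to right so that it ends in
        \<open>t n = b\<close>; the index \<open>i\<close> in \<open>E m\<close> counts steps back
        from \<open>b\<close>.\<close>
      define t where "t i = b - (real n - real i) / 2 ^ m" for i
      define D where "D i \<omega> = X (t (Suc i)) \<omega> - X (t i) \<omega>" for i \<omega>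
      have tle: "t k \<le> b" if "k \<le> n" for k using that by (simp add: t_def)
      have tn: "t n = b" by (simp add: t_def)
      have "indep_vars (\<lambda>_. borel) D {..<n}"
        using ind[unfolded independent_increments_on_def, rule_format, of n t] unfolding D_def
        by (simp add: t_def divide_strict_right_mono)
      then have "prob {\<omega>\<in>space M. \<exists>k\<le>n. \<bar>\<Sum>i\<in>{k..<n}. D i \<omega>\<bar> > 2 * (\<epsilon>/2)} \<le> 2 * prob {\<omega>\<in>space M. \<bar>\<Sum>i<n. D i \<omega>\<bar> > \<epsilon>/2}"
      proof (rule ottaviani_tail_inequality)
        fix k assume k: "k \<le> n"
        have "(\<Sum>i<k. D i \<omega>) = X (t k) \<omega> - X (t 0) \<omega>" for \<omega>
          unfolding D_def by (rule sum_lessThan_telescope)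
        then show "prob {\<omega>\<in>space M. \<bar>\<Sum>i<k. D i \<omega>\<bar> > \<epsilon>/2} \<le> 1/2" using b2[OF tle tle] k by simp
      qed
      also have "(\<Sum>i<n. D i \<omega>) = X b \<omega> - X (t 0) \<omega>" for \<omega>
        unfolding D_def tn[symmetric] by (rule sum_lessThan_telescope)
      then have "{\<omega>\<in>space M. \<bar>\<Sum>i<n. D i \<omega>\<bar> > \<epsilon>/2} \<subseteq> {\<omega>\<in>space M. \<bar>X (t 0) \<omega> - X b \<omega>\<bar> > \<epsilon>/4}"
        using eps by (auto simp: abs_minus_commute)
      then have "prob {\<omega>\<in>space M. \<bar>\<Sum>i<n. D i \<omega>\<bar> > \<epsilon>/2} \<le> prob {\<omega>\<in>space M. \<bar>X (t 0) \<omega> - X b \<omega>\<bar> > \<epsilon>/4}"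
        by (intro finite_measure_mono) auto
      also have "\<dots> \<le> \<eta>'" using b tle by auto
      also have "2 * \<eta>' \<le> \<eta>" by (simp add: \<eta>'_def)
      finally have le: "prob {\<omega>\<in>space M. \<exists>k\<le>n. \<bar>\<Sum>i\<in>{k..<n}. D i \<omega>\<bar> > 2 * (\<epsilon>/2)} \<le> \<eta>" by simp
      have "{\<omega>\<in>space M. \<exists>k\<le>n. \<bar>\<Sum>i\<in>{k..<n}. D i \<omega>\<bar> > 2 * (\<epsilon>/2)} = E m"
      proof -
        have tail: "(\<Sum>i\<in>{k..<n}. D i \<omega>) = X b \<omega> - X (t k) \<omega>" if "k \<le> n" for k \<omega>
          unfolding D_def tn[symmetric] using that by (rule sum_Suc_diff')
        have "(\<exists>k\<le>n. \<bar>X b \<omega> - X (t k) \<omega>\<bar> > \<epsilon>) \<longleftrightarrow> (\<exists>i\<le>n. \<bar>X b \<omega> - X (b - real i / 2 ^ m) \<omega>\<bar> > \<epsilon>)" for \<omega>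
        proof safe
          fix k assume "k \<le> n" "\<epsilon> < \<bar>X b \<omega> - X (t k) \<omega>\<bar>"
          then show "\<exists>i\<le>n. \<bar>X b \<omega> - X (b - real i / 2 ^ m) \<omega>\<bar> > \<epsilon>"
            by (intro exI[of _ "n - k"]) (auto simp: t_def of_nat_diff)
        next
          fix k assume "k \<le> n" "\<epsilon> < \<bar>X b \<omega> - X (b - real k / 2 ^ m) \<omega>\<bar>"
          then show "\<exists>i\<le>n. \<bar>X b \<omega> - X (t i) \<omega>\<bar> > \<epsilon>"
            by (intro exI[of _ "n - k"]) (auto simp: t_def of_nat_diff)
        qed
        then show ?thesis unfolding E_def n_def[symmetric] using tail by (auto cong: conj_cong)
      qed
      then show ?thesis using le by simp
    qed
    \<comment> \<open>Index \<open>i\<close> at level \<open>m\<close> is index \<open>2 * i\<close>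
      at the next level, and \<open>2 * 4 ^ m\<close> is still in range there.\<close>
    have incE: "incseq E"
    proof (rule incseq_SucI, rule subsetI)
      fix m \<omega> assume "\<omega> \<in> E m"
      then obtain i where "\<omega> \<in> space M" "i \<le> 4 ^ m" "\<bar>X b \<omega> - X (b - real i / 2 ^ m) \<omega>\<bar> > \<epsilon>" by (auto simp: E_def)
      moreover have "real (2 * i) / 2 ^ Suc m = real i / 2 ^ m" by simp
      ultimately show "\<omega> \<in> E (Suc m)" unfolding E_def
        by (auto simp del: power_Suc of_nat_mult intro!: exI[of _ "2 * i"]) simp
    qed
    have "prob (\<Union>m. E m) \<le> \<eta>"
      by (rule LIMSEQ_le_const2[OF finite_Lim_measure_incseq[OF _ incE]]) (use PE in auto)
    moreover have "\<bar>X a \<omega> - X b \<omega>\<bar> \<le> \<epsilon>" if "\<omega> \<in> space M - (\<Union>m. E m)" "\<forall>t. ((\<lambda>s. X s \<omega>) \<longlongrightarrow> X t \<omega>) (at_right t)" "a \<le> b" for \<omega> a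
      by (rule right_continuous_bound_dyadic[of "\<lambda>t. X t \<omega>"]) (use that in \<open>auto simp: E_def not_less\<close>)
    moreover have "(\<Union>m. E m) \<in> events" by measurable
    ultimately show ?thesis by blast
  qed
  have "AE \<omega> in M. \<exists>b. \<forall>a\<le>b. \<bar>X a \<omega> - X b \<omega>\<bar> \<le> \<epsilon>" if eps: "\<epsilon> > 0" for \<epsilon>
  proof -
    \<comment> \<open>The time \<open>b n\<close> varies with the exceptional set
      \<open>E n\<close>. As the intersection of these sets is null, almost every point avoids one
      of them and may use the corresponding \<open>b n\<close>.\<close>
    have "\<forall>n. \<exists>b E. E \<in> events \<and> prob E \<le> 1 / real (Suc n) \<and> (\<forall>\<omega>\<in>space M - E. (\<forall>t. ((\<lambda>s. X s \<omega>) \<longlongrightarrow> X t \<omega>) (at_right t)) \<longrightarrow> (\<forall>a\<le>b. \<bar>X a \<omega> - X b \<omega>\<bar> \<le> \<epsilon>))"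
      using key[OF eps] by simp
    then obtain b E where E[measurable]: "\<And>n. E n \<in> events" and PE: "\<And>n. prob (E n) \<le> 1 / real (Suc n)"
      and good: "\<And>n \<omega>. \<omega> \<in> space M - E n \<Longrightarrow> \<forall>t. ((\<lambda>s. X s \<omega>) \<longlongrightarrow> X t \<omega>) (at_right t) \<Longrightarrow> \<forall>a\<le>b n. \<bar>X a \<omega> - X (b n) \<omega>\<bar> \<le> \<epsilon>"
      by metis
    have "prob (\<Inter>n. E n) \<le> 1 / real (Suc n)" for n
      by (rule order_trans[OF finite_measure_mono PE]) auto
    then have "prob (\<Inter>n. E n) \<le> 0"
      by (intro LIMSEQ_le_const[OF LIMSEQ_Suc[OF lim_1_over_n]]) auto
    then have "prob (\<Inter>n. E n) = 0" using measure_nonneg[of M "\<Inter>n. E n"] by linarith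
    moreover have "(\<Inter>n. E n) \<in> events" by measurable
    ultimately have "(\<Inter>n. E n) \<in> null_sets M" by (auto simp: null_sets_def emeasure_eq_measure)
    then have "AE \<omega> in M. \<omega> \<notin> (\<Inter>n. E n)" by (rule AE_not_in)
    with rc AE_space show ?thesis
    proof eventually_elim
      case (elim \<omega>)
      then obtain n where "\<omega> \<in> space M - E n" by blast
      then show ?case using good elim by blast
    qed
  qed
  then have "AE \<omega> in M. \<forall>n. \<exists>b. \<forall>a\<le>b. \<bar>X a \<omega> - X b \<omega>\<bar> \<le> 1 / real (Suc n)"
    by (subst AE_all_countable) (simp del: of_nat_Suc)
  then show ?thesis
  proof eventually_elim
    case (elim \<omega>)
    show ?case
    proof (rule convergent_at_bot_if_Cauchy)
      fix e :: real assume "e > 0"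
      then obtain n where "1 / real (Suc n) < e" using nat_approx_posE by blast
      moreover obtain b where "\<forall>a\<le>b. \<bar>X a \<omega> - X b \<omega>\<bar> \<le> 1 / real (Suc n)" using elim by blast
      ultimately show "\<exists>b. \<forall>a\<le>b. \<bar>X a \<omega> - X b \<omega>\<bar> \<le> e" by (meson less_imp_le order_trans)
    qed
  qed
qed

text \<open>The mean of \<open>min 1 \<bar>X n - Z'\<bar>\<close> converges to that of
  \<open>min 1 \<bar>Z - Z'\<bar>\<close> by dominated convergence, and it is at most
  \<open>\<epsilon>\<close> plus the probability of a deviation beyond
  \<open>\<epsilon>\<close>.\<close>

lemma (in prob_space) AE_limit_eq_limit_in_prob:
  fixes X :: "nat \<Rightarrow> 'a \<Rightarrow> real"
  assumes [measurable]: "\<And>n. X n \<in> borel_measurable M" "Z \<in> borel_measurable M" "Z' \<in> borel_measurable M"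
    and Z: "AE \<omega> in M. (\<lambda>n. X n \<omega>) \<longlonglongrightarrow> Z \<omega>" and Z': "tendsto_in_prob M X Z' sequentially"
  shows "AE \<omega> in M. Z \<omega> = Z' \<omega>"
proof -
  let ?E = "\<lambda>\<epsilon> n. {\<omega>\<in>space M. \<bar>X n \<omega> - Z' \<omega>\<bar> > \<epsilon>}"
  let ?d = "LINT \<omega>|M. min 1 \<bar>Z \<omega> - Z' \<omega>\<bar>"
  have int: "integrable M (\<lambda>\<omega>. min 1 \<bar>f \<omega>\<bar>)" if [measurable]: "f \<in> borel_measurable M" for f :: "'a \<Rightarrow> real"
    by (rule integrable_const_bound[of _ 1]) auto
  have lim: "(\<lambda>n. LINT \<omega>|M. min 1 \<bar>X n \<omega> - Z' \<omega>\<bar>) \<longlonglongrightarrow> ?d"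
  proof (rule integral_dominated_convergence[where w="\<lambda>_. 1"])
    show "AE \<omega> in M. (\<lambda>n. min 1 \<bar>X n \<omega> - Z' \<omega>\<bar>) \<longlonglongrightarrow> min 1 \<bar>Z \<omega> - Z' \<omega>\<bar>"
      using Z by eventually_elim (intro tendsto_intros)
  qed auto
  have le: "?d \<le> \<epsilon>" if eps: "\<epsilon> > 0" for \<epsilon>
  proof (rule LIMSEQ_le[OF lim])
    have "(\<lambda>n. \<epsilon> + prob (?E \<epsilon> n)) \<longlonglongrightarrow> \<epsilon> + 0"
      using Z' eps unfolding tendsto_in_prob_def by (intro tendsto_intros) auto
    then show "(\<lambda>n. \<epsilon> + prob (?E \<epsilon> n)) \<longlonglongrightarrow> \<epsilon>" by simp
    have "(LINT \<omega>|M. min 1 \<bar>X n \<omega> - Z' \<omega>\<bar>) \<le> \<epsilon> + prob (?E \<epsilon> n)" for n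
    proof -
      have ev[measurable]: "?E \<epsilon> n \<in> events" by measurable
      have iE: "integrable M (indicator (?E \<epsilon> n) :: _ \<Rightarrow> real)"
        by (rule integrable_real_indicator[OF ev]) (simp add: less_top[symmetric])
      have "(LINT \<omega>|M. min 1 \<bar>X n \<omega> - Z' \<omega>\<bar>) \<le> (LINT \<omega>|M. \<epsilon> + indicator (?E \<epsilon> n) \<omega>)"
        using eps by (intro integral_mono int Bochner_Integration.integrable_add iE)
          (auto simp: indicator_def)
      also have "\<dots> = \<epsilon> + prob (?E \<epsilon> n)"
        by (subst Bochner_Integration.integral_add[OF _ iE]) (auto simp: prob_space)
      finally show ?thesis .
    qed
    then show "\<exists>N. \<forall>n\<ge>N. (LINT \<omega>|M. min 1 \<bar>X n \<omega> - Z' \<omega>\<bar>) \<le> \<epsilon> + prob (?E \<epsilon> n)" by blast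
  qed
  then have "?d \<le> 0" by (rule field_le_epsilon[of _ 0, simplified])
  then have "?d = 0"
    by (intro antisym integral_nonneg_AE) auto
  then have "AE \<omega> in M. min 1 \<bar>Z \<omega> - Z' \<omega>\<bar> = 0"
    by (subst (asm) integral_nonneg_eq_0_iff_AE) (auto intro!: int)
  then show ?thesis by eventually_elim (auto simp: min_def split: if_splits)
qed

lemma tendsto_in_prob_compose:
  "tendsto_in_prob M X Z F \<Longrightarrow> filterlim s F G \<Longrightarrow> tendsto_in_prob M (\<lambda>n. X (s n)) Z G"
  unfolding tendsto_in_prob_def by (auto intro: filterlim_compose)

section \<open>Moments of order at most one\<close>

lemma integral_PiM_iexp_sum:
  assumes "prob_space \<nu>" and [measurable]: "f \<in> borel_measurable \<nu>"
  shows "(CLINT x|PiM {..<n::nat} (\<lambda>_. \<nu>). iexp (\<Sum>i<n. f (x i))) = (CLINT y|\<nu>. iexp (f y)) ^ n"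
proof -
  interpret prob_space \<nu> by fact
  interpret P: product_prob_space "\<lambda>_. \<nu>" "{..<n}" ..
  have "(CLINT x|PiM {..<n} (\<lambda>_. \<nu>). iexp (\<Sum>i<n. f (x i))) = (CLINT x|PiM {..<n} (\<lambda>_. \<nu>). (\<Prod>i<n. iexp (f (x i))))"
    by (simp add: exp_sum sum_distrib_left)
  also have "\<dots> = (\<Prod>i<n. CLINT y|\<nu>. iexp (f y))"
    by (rule P.product_integral_prod) (auto intro: integrable_iexp_real)
  finally show ?thesis by simp
qed

text \<open>After division by \<open>a + b\<close> both terms lie in [0, 1], where raising to a
  power at most 1 does not decrease them.\<close>

lemma powr_add_le:
  fixes a b g :: real
  assumes "0 < g" "g \<le> 1" "0 \<le> a" "0 \<le> b"
  shows "(a + b) powr g \<le> a powr g + b powr g"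
proof (cases "a + b = 0")
  case False
  define s where "s = a + b"
  have s: "s > 0" using False assms by (simp add: s_def)
  have le: "c / s \<le> (c / s) powr g" if "0 \<le> c" "c \<le> s" for c
    using powr_mono'[of g 1 "c / s"] that s assms by simp
  have "1 = a / s + b / s" using s by (simp add: s_def flip: add_divide_distrib)
  also have "\<dots> \<le> (a / s) powr g + (b / s) powr g" using assms by (intro add_mono le) (auto simp: s_def)
  also have "\<dots> = (a powr g + b powr g) / s powr g" using s assms by (simp add: powr_divide add_divide_distrib)
  finally show ?thesis using s by (simp add: s_def)
qed (use assms in auto)

lemma abs_sum_powr_le:
  fixes f :: "'i \<Rightarrow> real"
  assumes "0 < g" "g \<le> 1"
  shows "\<bar>\<Sum>i\<in>A. f i\<bar> powr g \<le> (\<Sum>i\<in>A. \<bar>f i\<bar> powr g)"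
proof (induction A rule: infinite_finite_induct)
  case (insert x F)
  have "\<bar>\<Sum>i\<in>insert x F. f i\<bar> powr g \<le> (\<bar>f x\<bar> + \<bar>\<Sum>i\<in>F. f i\<bar>) powr g"
    using insert assms by (intro powr_mono2) auto
  also have "\<dots> \<le> \<bar>f x\<bar> powr g + \<bar>\<Sum>i\<in>F. f i\<bar> powr g" using assms by (intro powr_add_le) auto
  finally show ?case using insert by simp
qed (use assms in auto)

text \<open>By uniqueness of characteristic functions, \<open>X\<close> has the law of a sum of
  \<open>n\<close> independent copies of \<open>Y\<close>, realized on a product space;
  subadditivity of the power then bounds the moment term by term. Nonnegative integrals allow
  infinite moments.\<close>

lemma (in prob_space) moment_le_if_char_power:
  fixes X Y :: "'a \<Rightarrow> real"
  assumes [measurable]: "X \<in> borel_measurable M" "Y \<in> borel_measurable M"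
    and char: "\<And>t. (CLINT \<omega>|M. iexp (t * X \<omega>)) = (CLINT \<omega>|M. iexp (t * Y \<omega>)) ^ n"
    and g: "0 < g" "g \<le> 1"
  shows "(\<integral>\<^sup>+\<omega>. ennreal (\<bar>X \<omega>\<bar> powr g) \<partial>M) \<le> of_nat n * (\<integral>\<^sup>+\<omega>. ennreal (\<bar>Y \<omega>\<bar> powr g) \<partial>M)"
proof -
  define \<nu> where "\<nu> = distr M borel Y"
  define P where "P = PiM {..<n} (\<lambda>_. \<nu>)"
  interpret N: prob_space \<nu> unfolding \<nu>_def by (rule prob_space_distr) simp
  interpret PP: product_prob_space "\<lambda>_. \<nu>" "{..<n}" ..
  interpret P: prob_space P unfolding P_def by (rule PP.prob_space_axioms)
  have [simp, measurable_cong]: "sets \<nu> = sets borel" by (simp add: \<nu>_def)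
  have c: "(\<lambda>x. x i) \<in> borel_measurable P" if "i < n" for i
    using measurable_component_singleton[of i "{..<n}" "\<lambda>_. \<nu>"] that unfolding P_def by (simp cong: measurable_cong_sets)
  have s[measurable]: "(\<lambda>x. \<Sum>i<n. x i) \<in> borel_measurable P" using c by (intro borel_measurable_sum) auto
  have "distr M borel X = distr P borel (\<lambda>x. \<Sum>i<n. x i)"
  proof (rule Levy_uniqueness)
    show "char (distr M borel X) = char (distr P borel (\<lambda>x. \<Sum>i<n. x i))"
    proof
      fix t
      have "char (distr P borel (\<lambda>x. \<Sum>i<n. x i)) t = (CLINT x|P. iexp (\<Sum>i<n. t * x i))"
        by (subst P.char_distr_eq) (auto simp: sum_distrib_left)
      also have "\<dots> = (CLINT y|\<nu>. iexp (t * y)) ^ n"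
        unfolding P_def by (rule integral_PiM_iexp_sum) (auto intro: N.prob_space_axioms)
      also have "(CLINT y|\<nu>. iexp (t * y)) = (CLINT \<omega>|M. iexp (t * Y \<omega>))"
        unfolding \<nu>_def by (subst integral_distr) auto
      finally show "char (distr M borel X) t = char (distr P borel (\<lambda>x. \<Sum>i<n. x i)) t"
        using char[of t] by (simp add: char_distr_eq)
    qed
  qed (auto intro!: real_distribution_distr P.real_distribution_distr)
  then have "(\<integral>\<^sup>+\<omega>. ennreal (\<bar>X \<omega>\<bar> powr g) \<partial>M) = (\<integral>\<^sup>+x. ennreal (\<bar>\<Sum>i<n. x i\<bar> powr g) \<partial>P)"
    using nn_integral_distr[of X M borel "\<lambda>x. ennreal (\<bar>x\<bar> powr g)"] nn_integral_distr[of "\<lambda>x. \<Sum>i<n. x i" P borel "\<lambda>x. ennreal (\<bar>x\<bar> powr g)"]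
    by simp
  also have "\<dots> \<le> (\<integral>\<^sup>+x. (\<Sum>i<n. ennreal (\<bar>x i\<bar> powr g)) \<partial>P)"
    using abs_sum_powr_le[OF g, of _ "{..<n}"] by (intro nn_integral_mono) (simp add: ennreal_leI)
  also have "\<dots> = (\<Sum>i<n. \<integral>\<^sup>+x. ennreal (\<bar>x i\<bar> powr g) \<partial>P)"
    using c by (intro nn_integral_sum) (measurable, auto)
  also have "\<dots> = (\<Sum>i<n. \<integral>\<^sup>+\<omega>. ennreal (\<bar>Y \<omega>\<bar> powr g) \<partial>M)"
  proof (rule sum.cong[OF refl])
    fix i assume i: "i \<in> {..<n}"
    have "(\<integral>\<^sup>+x. ennreal (\<bar>x i\<bar> powr g) \<partial>P) = (\<integral>\<^sup>+y. ennreal (\<bar>y\<bar> powr g) \<partial>distr P \<nu> (\<lambda>x. x i))"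
      using c[of i] i by (subst nn_integral_distr) (auto cong: measurable_cong_sets)
    also have "distr P \<nu> (\<lambda>x. x i) = \<nu>" unfolding P_def using i by (intro distr_PiM_component) (auto intro: N.prob_space_axioms)
    also have "(\<integral>\<^sup>+y. ennreal (\<bar>y\<bar> powr g) \<partial>\<nu>) = (\<integral>\<^sup>+\<omega>. ennreal (\<bar>Y \<omega>\<bar> powr g) \<partial>M)"
      unfolding \<nu>_def by (subst nn_integral_distr) auto
    finally show "(\<integral>\<^sup>+x. ennreal (\<bar>x i\<bar> powr g) \<partial>P) = (\<integral>\<^sup>+\<omega>. ennreal (\<bar>Y \<omega>\<bar> powr g) \<partial>M)" .
  qed
  finally show ?thesis by simp
qed

section \<open>Two-sided Levy processes\<close>

lemma cmod_iexp_minus_1_le: "cmod (iexp x - 1) \<le> \<bar>x\<bar>" "cmod (iexp x - 1) \<le> 2"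
proof -
  show "cmod (iexp x - 1) \<le> \<bar>x\<bar>" using iexp_approx1[of x 0] by simp
  show "cmod (iexp x - 1) \<le> 2" using norm_triangle_ineq4[of "iexp x" 1] by simp
qed

context prob_space begin

lemma tendsto_in_prob_imp_char_tendsto_1:
  fixes X :: "'i \<Rightarrow> 'a \<Rightarrow> real"
  assumes X: "tendsto_in_prob M X Z F" and meas: "eventually (\<lambda>c. X c \<in> borel_measurable M) F"
    and Z[measurable]: "Z \<in> borel_measurable M"
  shows "((\<lambda>c. CLINT \<omega>|M. iexp (w * (X c \<omega> - Z \<omega>))) \<longlongrightarrow> 1) F"
proof (rule tendstoI)
  fix e :: real assume e: "e > 0"
  \<comment> \<open>The summand 1 in the denominator covers \<open>w = 0\<close>. With this
    \<open>d\<close> the integrand is at most \<open>e / 4\<close> off the exceptional event, and at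
    most 2 on it.\<close>
  define d where "d = (e / 4) / (\<bar>w\<bar> + 1)"
  have d: "d > 0" using e by (simp add: d_def add_nonneg_pos)
  have "\<bar>w\<bar> * d \<le> (\<bar>w\<bar> + 1) * d" using d by (intro mult_right_mono) auto
  also have "\<dots> = e / 4" unfolding d_def by (rule nonzero_mult_div_cancel_left[of "\<bar>w\<bar> + 1" "e / 4", unfolded times_divide_eq_right[symmetric]]) linarith
  finally have wd: "\<bar>w\<bar> * d \<le> e / 4" .
  have "((\<lambda>c. prob {\<omega>\<in>space M. \<bar>X c \<omega> - Z \<omega>\<bar> > d}) \<longlongrightarrow> 0) F" using X d by (simp add: tendsto_in_prob_def)
  then have "eventually (\<lambda>c. prob {\<omega>\<in>space M. \<bar>X c \<omega> - Z \<omega>\<bar> > d} < e/4) F"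
    using e by (intro order_tendstoD(2)) auto
  with meas show "eventually (\<lambda>c. dist (CLINT \<omega>|M. iexp (w * (X c \<omega> - Z \<omega>))) 1 < e) F"
  proof eventually_elim
    case (elim c)
    define D where "D \<omega> = w * (X c \<omega> - Z \<omega>)" for \<omega>
    define E where "E = {\<omega>\<in>space M. \<bar>X c \<omega> - Z \<omega>\<bar> > d}"
    note [measurable] = elim(1)
    have [measurable]: "D \<in> borel_measurable M" and E[measurable]: "E \<in> events"
      unfolding E_def D_def[abs_def] by measurable
    have iE: "integrable M (indicator E :: _ \<Rightarrow> real)"
      by (rule integrable_real_indicator[OF E]) (simp add: less_top[symmetric])
    have int: "integrable M (\<lambda>\<omega>. iexp (D \<omega>) - 1)"
      by (intro Bochner_Integration.integrable_diff integrable_iexp_real) auto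
    have "(CLINT \<omega>|M. iexp (D \<omega>)) - 1 = (CLINT \<omega>|M. iexp (D \<omega>) - 1)"
      by (subst Bochner_Integration.integral_diff) (auto intro: integrable_iexp_real simp: prob_space)
    then have "cmod ((CLINT \<omega>|M. iexp (D \<omega>)) - 1) \<le> (LINT \<omega>|M. cmod (iexp (D \<omega>) - 1))"
      by (simp only: integral_norm_bound)
    also have "\<dots> \<le> (LINT \<omega>|M. e/4 + 2 * indicator E \<omega>)"
    proof (rule integral_mono)
      fix \<omega> assume \<omega>: "\<omega> \<in> space M"
      show "cmod (iexp (D \<omega>) - 1) \<le> e/4 + 2 * indicator E \<omega>"
      proof (cases "\<omega> \<in> E")
        case True
        then show ?thesis using cmod_iexp_minus_1_le(2)[of "D \<omega>"] e by simp
      next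
        case False
        then have "\<bar>w\<bar> * \<bar>X c \<omega> - Z \<omega>\<bar> \<le> \<bar>w\<bar> * d" using \<omega> by (intro mult_left_mono) (auto simp: E_def)
        then have "\<bar>D \<omega>\<bar> \<le> e / 4" using wd by (simp add: D_def abs_mult)
        then show ?thesis using cmod_iexp_minus_1_le(1)[of "D \<omega>"] False by simp
      qed
    qed (use int iE in auto)
    also have "\<dots> = e/4 + 2 * prob E"
      using iE by (subst Bochner_Integration.integral_add) (auto simp: prob_space)
    also have "\<dots> < e" using elim(2) e by (simp add: E_def)
    finally show ?case by (simp add: dist_norm D_def)
  qed
qed

lemma char_sum_indep:
  fixes D :: "nat \<Rightarrow> 'a \<Rightarrow> real"
  assumes "indep_vars (\<lambda>_. borel) D {..<n}"
  shows "(CLINT \<omega>|M. iexp (\<Sum>i<n. w i * D i \<omega>)) = (\<Prod>i<n. CLINT \<omega>|M. iexp (w i * D i \<omega>))"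
proof -
  have D: "D i \<in> borel_measurable M" if "i < n" for i using assms that by (auto simp: indep_vars_def)
  have "indep_vars (\<lambda>_. borel) (\<lambda>i \<omega>. w i * D i \<omega>) {..<n}"
    by (rule indep_vars_compose2[OF assms]) auto
  from char_distr_sum[OF this, of 1] show ?thesis using D
    by (subst (asm) char_distr_eq) (auto intro!: borel_measurable_sum simp: char_distr_eq cong: prod.cong_simp)
qed

text \<open>Stationary independent increments make the characteristic function multiplicative in
  time, and stochastic continuity at 0 gives the limit 1. The general semigroup lemma is used for
  vectors of length one.\<close>

lemma levy_process_exponent:
  fixes X :: "real \<Rightarrow> 'a \<Rightarrow> real"
  assumes X: "levy_process M X"
  obtains \<psi> where "continuous_on UNIV \<psi>" "\<psi> 0 = 0"
    "\<And>h w. 0 \<le> h \<Longrightarrow> (CLINT \<omega>|M. iexp (w * X h \<omega>)) = exp (of_real h * \<psi> w)"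
    "\<And>s t w. 0 \<le> s \<Longrightarrow> s \<le> t \<Longrightarrow> (CLINT \<omega>|M. iexp (w * (X t \<omega> - X s \<omega>))) = exp (of_real (t - s) * \<psi> w)"
proof -
  have meas[measurable]: "X t \<in> borel_measurable M" if "0 \<le> t" for t
    using X that by (auto simp: levy_process_def additive_process_on_def process_on_def)
  have X0: "AE \<omega> in M. X 0 \<omega> = 0" using X by (auto simp: levy_process_def additive_process_on_def)
  have stat: "(CLINT \<omega>|M. iexp (w * (X t \<omega> - X s \<omega>))) = (CLINT \<omega>|M. iexp (w * X (t - s) \<omega>))" if st: "0 \<le> s" "s \<le> t" for s t w
  proof -
    have "distr M borel (\<lambda>\<omega>. X (t - s + s) \<omega> - X (0 + s) \<omega>) = distr M borel (\<lambda>\<omega>. X (t - s) \<omega> - X 0 \<omega>)"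
      using X st unfolding levy_process_def by (metis diff_ge_0_iff_ge order_refl)
    then have "char (distr M borel (\<lambda>\<omega>. X t \<omega> - X s \<omega>)) w = char (distr M borel (\<lambda>\<omega>. X (t - s) \<omega> - X 0 \<omega>)) w" by simp
    then have "(CLINT \<omega>|M. iexp (w * (X t \<omega> - X s \<omega>))) = (CLINT \<omega>|M. iexp (w * (X (t - s) \<omega> - X 0 \<omega>)))"
      using st by (subst (asm) (1 2) char_distr_eq) auto
    also have "\<dots> = (CLINT \<omega>|M. iexp (w * X (t - s) \<omega>))"
      using st X0 by (intro integral_cong_AE) auto
    finally show ?thesis .
  qed
  have mult: "(CLINT \<omega>|M. iexp (w * X (c + c') \<omega>)) = (CLINT \<omega>|M. iexp (w * X c \<omega>)) * (CLINT \<omega>|M. iexp (w * X c' \<omega>))"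
    if c: "0 < c" "0 < c'" for c c' w
  proof -
    define t where "t i = (if i = 0 then 0 else if i = 1 then c else c + c')" for i :: nat
    have "indep_vars (\<lambda>_. borel) (\<lambda>i \<omega>. X (t (Suc i)) \<omega> - X (t i) \<omega>) {..<2}"
    proof -
      have "independent_increments_on M {0..} X" using X by (simp add: levy_process_def additive_process_on_def)
      moreover have "\<forall>i\<le>2. t i \<in> {0..}" "\<forall>i<2. t i < t (Suc i)"
        using c by (auto simp: t_def less_2_cases_iff)
      ultimately show ?thesis unfolding independent_increments_on_def by blast
    qed
    from char_sum_indep[OF this, of "\<lambda>_. w"]
    have "(CLINT \<omega>|M. iexp (w * (X (c + c') \<omega> - X 0 \<omega>))) = (CLINT \<omega>|M. iexp (w * (X c \<omega> - X 0 \<omega>))) * (CLINT \<omega>|M. iexp (w * (X (c + c') \<omega> - X c \<omega>)))"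
      by (simp add: numeral_2_eq_2 t_def algebra_simps)
    then show ?thesis using stat[of 0 "c + c'" w] stat[of 0 c w] stat[of c "c + c'" w] c by simp
  qed
  have lim: "((\<lambda>c. CLINT \<omega>|M. iexp (w * X c \<omega>)) \<longlongrightarrow> 1) (at_right 0)" for w
  proof -
    have "tendsto_in_prob M X (X 0) (at 0 within {0..})" using X by (auto simp: levy_process_def additive_process_on_def)
    then have "((\<lambda>c. CLINT \<omega>|M. iexp (w * (X c \<omega> - X 0 \<omega>))) \<longlongrightarrow> 1) (at 0 within {0..})"
      by (rule tendsto_in_prob_imp_char_tendsto_1) (auto simp: eventually_at_filter intro!: always_eventually meas)
    then have "((\<lambda>c. CLINT \<omega>|M. iexp (w * (X c \<omega> - X 0 \<omega>))) \<longlongrightarrow> 1) (at_right 0)"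
      by (rule tendsto_within_subset) auto
    then show ?thesis
    proof (rule Lim_transform_eventually)
      show "eventually (\<lambda>c. (CLINT \<omega>|M. iexp (w * (X c \<omega> - X 0 \<omega>))) = (CLINT \<omega>|M. iexp (w * X c \<omega>))) (at_right 0)"
        using stat[of 0 _ w] by (simp add: eventually_at_filter)
    qed
  qed
  have one: "(\<Sum>j<1. f j) = f 0" for f :: "nat \<Rightarrow> real" by (simp add: lessThan_Suc)
  obtain \<Psi> where \<Psi>: "\<And>c \<theta>. 0 < c \<Longrightarrow> (CLINT \<omega>|M. iexp (\<theta> 0 * X c \<omega>)) = exp (of_real c * \<Psi> \<theta>)"
    and cont: "\<And>\<theta> \<eta>. (\<lambda>n. \<eta> n 0) \<longlonglongrightarrow> \<theta> 0 \<Longrightarrow> (\<lambda>n. \<Psi> (\<eta> n)) \<longlonglongrightarrow> \<Psi> \<theta>"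
    and zero: "\<And>\<theta>. \<theta> 0 = 0 \<Longrightarrow> \<Psi> \<theta> = 0"
  proof (rule char_semigroup_exponent[of 1 "\<lambda>c j. X c", unfolded one], goal_cases)
    case 1
    show ?case by (rule meas[OF less_imp_le[OF 1(2)]])
  next
    case 2
    show ?case by (rule mult[OF 2(2,3)])
  next
    case 3
    show ?case by (rule lim)
  next
    case 4
    show ?case by (rule 4(1)[OF 4(2-4)]) auto
  qed
  define \<psi> where "\<psi> w = \<Psi> (\<lambda>_. w)" for w
  have char: "(CLINT \<omega>|M. iexp (w * X h \<omega>)) = exp (of_real h * \<psi> w)" if "0 \<le> h" for h w
  proof (cases "h = 0")
    case True
    have "(CLINT \<omega>|M. iexp (w * X 0 \<omega>)) = (CLINT \<omega>|M. 1)"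
      using X0 by (intro integral_cong_AE) auto
    then show ?thesis using True by (simp add: prob_space)
  next
    case False
    then have "0 < h" using that by simp
    from \<Psi>[OF this, of "\<lambda>_. w"] show ?thesis by (simp only: \<psi>_def)
  qed
  show ?thesis
  proof (rule that[of \<psi>])
    show "continuous_on UNIV \<psi>"
      unfolding continuous_on_sequentially \<psi>_def by (auto intro!: cont simp: o_def)
    show "\<psi> 0 = 0" unfolding \<psi>_def by (rule zero) simp
    show "(CLINT \<omega>|M. iexp (w * (X t \<omega> - X s \<omega>))) = exp (of_real (t - s) * \<psi> w)" if "0 \<le> s" "s \<le> t" for s t w
      using stat[OF that] char[of "t - s"] that by simp
  qed (rule char)
qed

lemma levy_process_increments_char:
  fixes X :: "real \<Rightarrow> 'a \<Rightarrow> real"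
  assumes X: "levy_process M X"
    and \<psi>: "\<And>s t w. 0 \<le> s \<Longrightarrow> s \<le> t \<Longrightarrow> (CLINT \<omega>|M. iexp (w * (X t \<omega> - X s \<omega>))) = exp (of_real (t - s) * \<psi> w)"
    and r: "\<And>i. i \<le> n \<Longrightarrow> 0 \<le> r i" "\<And>i. i < n \<Longrightarrow> r i \<le> r (Suc i)"
  shows "(CLINT \<omega>|M. iexp (\<Sum>i<n. w i * (X (r (Suc i)) \<omega> - X (r i) \<omega>))) = exp (\<Sum>i<n. of_real (r (Suc i) - r i) * \<psi> (w i))"
proof -
  have meas[measurable]: "X t \<in> borel_measurable M" if "0 \<le> t" for t
    using X that by (auto simp: levy_process_def additive_process_on_def process_on_def)
  have strict: "(CLINT \<omega>|M. iexp (\<Sum>i<n. w i * (X (r (Suc i)) \<omega> - X (r i) \<omega>))) = exp (\<Sum>i<n. of_real (r (Suc i) - r i) * \<psi> (w i))"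
    if r: "\<And>i. i \<le> n \<Longrightarrow> 0 \<le> r i" "\<And>i. i < n \<Longrightarrow> r i < r (Suc i)" for r :: "nat \<Rightarrow> real"
  proof -
    have "indep_vars (\<lambda>_. borel) (\<lambda>i \<omega>. X (r (Suc i)) \<omega> - X (r i) \<omega>) {..<n}"
      using X r unfolding levy_process_def additive_process_on_def independent_increments_on_def by auto
    from char_sum_indep[OF this] show ?thesis
      using r \<psi> by (simp add: exp_sum less_imp_le)
  qed
  \<comment> \<open>Independence of increments is given for strict partitions only, hence the perturbation.\<close>
  define s where "s m i = r i + real i / real (Suc m)" for m i :: nat
  have s_ge: "0 \<le> s m i" "r i \<le> s m i" if "i \<le> n" for m i using r(1)[OF that] by (simp_all add: s_def)
  have s_lim: "(\<lambda>m. s m i) \<longlonglongrightarrow> r i" for i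
  proof -
    have "(\<lambda>m. r i + real i * (1 / real (Suc m))) \<longlonglongrightarrow> r i + real i * 0"
      by (intro tendsto_intros LIMSEQ_Suc[OF lim_1_over_n])
    then show ?thesis by (simp add: s_def)
  qed
  have eq: "(CLINT \<omega>|M. iexp (\<Sum>i<n. w i * (X (s m (Suc i)) \<omega> - X (s m i) \<omega>))) = exp (\<Sum>i<n. of_real (s m (Suc i) - s m i) * \<psi> (w i))" for m
    by (rule strict) (use s_ge r(2) in \<open>auto simp: s_def add_divide_distrib add_le_less_mono intro!: add_le_less_mono divide_strict_right_mono\<close>)
  have "(\<lambda>m. CLINT \<omega>|M. iexp (\<Sum>i<n. w i * (X (s m (Suc i)) \<omega> - X (s m i) \<omega>))) \<longlonglongrightarrow> (CLINT \<omega>|M. iexp (\<Sum>i<n. w i * (X (r (Suc i)) \<omega> - X (r i) \<omega>)))"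
  proof (rule iexp_dominated_convergence)
    have "AE \<omega> in M. cadlag_on {0..} (\<lambda>t. X t \<omega>)" using X by (auto simp: levy_process_def additive_process_on_def)
    then show "AE \<omega> in M. (\<lambda>m. \<Sum>i<n. w i * (X (s m (Suc i)) \<omega> - X (s m i) \<omega>)) \<longlonglongrightarrow> (\<Sum>i<n. w i * (X (r (Suc i)) \<omega> - X (r i) \<omega>))"
    proof eventually_elim
      case (elim \<omega>)
      have "(\<lambda>m. X (s m i) \<omega>) \<longlonglongrightarrow> X (r i) \<omega>" if "i \<le> n" for i
        using right_continuous_compose_seq[OF cadlag_on_halfline(1)[OF elim r(1)[OF that]] s_lim s_ge(2)[OF that]] .
      then show ?case by (intro tendsto_intros) auto
    qed
  qed (use s_ge r in \<open>auto intro!: borel_measurable_sum borel_measurable_times borel_measurable_diff meas\<close>)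
  moreover have "(\<lambda>m. CLINT \<omega>|M. iexp (\<Sum>i<n. w i * (X (s m (Suc i)) \<omega> - X (s m i) \<omega>))) \<longlonglongrightarrow> exp (\<Sum>i<n. of_real (r (Suc i) - r i) * \<psi> (w i))"
    unfolding eq by (intro tendsto_intros s_lim)
  ultimately show ?thesis by (rule LIMSEQ_unique)
qed

text \<open>There are no jumps at fixed times: along a sequence increasing to \<open>t\<close>, the
  path converges almost surely to its left limit and, by stochastic continuity, in probability to
  \<open>X t\<close>.\<close>

lemma levy_process_left_limit:
  fixes X :: "real \<Rightarrow> 'a \<Rightarrow> real"
  assumes X: "levy_process M X" and t: "0 < t"
    and [measurable]: "Z \<in> borel_measurable M" and Z: "AE \<omega> in M. Z \<omega> = Lim (at_left t) (\<lambda>s. X s \<omega>)"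
  shows "AE \<omega> in M. Z \<omega> = X t \<omega>"
proof -
  have meas[measurable]: "X s \<in> borel_measurable M" if "0 \<le> s" for s
    using X that by (auto simp: levy_process_def additive_process_on_def process_on_def)
  \<comment> \<open>The double successor keeps \<open>s 0 = t / 2\<close> positive.\<close>
  define s where "s n = t - t / real (Suc (Suc n))" for n
  have s0: "0 < s n" "s n < t" for n using t by (auto simp: s_def field_simps add_pos_nonneg)
  have "(\<lambda>n. t - t * (1 / real (Suc (Suc n)))) \<longlonglongrightarrow> t - t * 0"
    by (intro tendsto_intros LIMSEQ_Suc[OF LIMSEQ_Suc[OF lim_1_over_n]])
  then have "s \<longlonglongrightarrow> t" by (simp add: s_def[abs_def])
  then have fl: "filterlim s (at_left t) sequentially" and fl': "filterlim s (at t within {0..}) sequentially"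
    using s0 by (auto simp: filterlim_at less_imp_neq less_imp_le)
  show ?thesis
  proof (rule AE_limit_eq_limit_in_prob[of "\<lambda>n. X (s n)"])
    have "AE \<omega> in M. cadlag_on {0..} (\<lambda>t. X t \<omega>)" using X by (auto simp: levy_process_def additive_process_on_def)
    then show "AE \<omega> in M. (\<lambda>n. X (s n) \<omega>) \<longlonglongrightarrow> Z \<omega>"
      using Z
    proof eventually_elim
      case (elim \<omega>)
      have "((\<lambda>s. X s \<omega>) \<longlongrightarrow> Z \<omega>) (at_left t)" using cadlag_on_halfline(2)[OF elim(1) t] elim(2) by simp
      then show ?case by (rule filterlim_compose[OF _ fl])
    qed
    have "tendsto_in_prob M X (X t) (at t within {0..})" using X t by (auto simp: levy_process_def additive_process_on_def)
    then show "tendsto_in_prob M (\<lambda>n. X (s n)) (X t) sequentially"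
      using fl' by (rule tendsto_in_prob_compose)
  qed (use s0 t in \<open>auto intro: meas less_imp_le\<close>)
qed

end

text \<open>At a fixed time the left limit of \<open>L2\<close> equals its value almost surely, so
  \<open>L\<close> becomes a difference of \<open>L1\<close> and \<open>L2\<close> at clipped times.
  A combination of increments splits accordingly into a part from \<open>L1\<close> and a part from
  \<open>L2\<close>, which are independent and share one exponent.\<close>

lemma two_sided_levy_processE:
  assumes "prob_space M" and L: "two_sided_levy_process M L"
  obtains L1 L2 \<psi> where "levy_process M L1" "levy_process M L2"
    and "\<And>r. AE \<omega> in M. L r \<omega> = L1 (max r 0) \<omega> - L2 (max (- r) 0) \<omega>"
    and "AE \<omega> in M. cadlag_on UNIV (\<lambda>t. L t \<omega>)" "AE \<omega> in M. L 0 \<omega> = 0" "process_on M UNIV L" "\<psi> 0 = 0"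
    and "\<And>h w. 0 \<le> h \<Longrightarrow> (CLINT \<omega>|M. iexp (w * L1 h \<omega>)) = exp (of_real h * \<psi> w)"
    and "\<And>n r w. (\<And>i. i < n \<Longrightarrow> r i \<le> r (Suc i)) \<Longrightarrow>
       (CLINT \<omega>|M. iexp (\<Sum>i<n. w i * (L (r (Suc i)) \<omega> - L (r i) \<omega>))) = exp (\<Sum>i<n. of_real (r (Suc i) - r i) * \<psi> (w i))"
proof -
  interpret prob_space M by fact
  obtain L1 L2 where Lm: "process_on M UNIV L" and L1: "levy_process M L1" and L2: "levy_process M L2"
    and d: "distr M borel (L1 1) = distr M borel (L2 1)"
    and ind: "indep_var (PiM {0..} (\<lambda>_. borel)) (\<lambda>\<omega>. \<lambda>t\<in>{0..}. L1 t \<omega>) (PiM {0..} (\<lambda>_. borel)) (\<lambda>\<omega>. \<lambda>t\<in>{0..}. L2 t \<omega>)"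
    and path: "AE \<omega> in M. (\<forall>t\<ge>0. L t \<omega> = L1 t \<omega>) \<and> (\<forall>t<0. L t \<omega> = - Lim (at_left (- t)) (\<lambda>s. L2 s \<omega>))"
    using L unfolding two_sided_levy_process_def by blast
  have [measurable]: "L t \<in> borel_measurable M" for t using Lm by (auto simp: process_on_def)
  have [measurable]: "L1 t \<in> borel_measurable M" if "0 \<le> t" for t
    using L1 that by (auto simp: levy_process_def additive_process_on_def process_on_def)
  have [measurable]: "L2 t \<in> borel_measurable M" if "0 \<le> t" for t
    using L2 that by (auto simp: levy_process_def additive_process_on_def process_on_def)
  have z: "AE \<omega> in M. L1 0 \<omega> = 0" "AE \<omega> in M. L2 0 \<omega> = 0"
    using L1 L2 by (auto simp: levy_process_def additive_process_on_def)
  have c: "AE \<omega> in M. cadlag_on {0..} (\<lambda>t. L1 t \<omega>)" "AE \<omega> in M. cadlag_on {0..} (\<lambda>t. L2 t \<omega>)"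
    using L1 L2 by (auto simp: levy_process_def additive_process_on_def)
  have decomp: "AE \<omega> in M. L r \<omega> = L1 (max r 0) \<omega> - L2 (max (- r) 0) \<omega>" for r
  proof (cases "r \<ge> 0")
    case True
    then have "max (- r) 0 = 0" "max r 0 = r" by auto
    then show ?thesis using path z(2) True by auto
  next
    case False
    have "AE \<omega> in M. - L r \<omega> = L2 (- r) \<omega>"
      by (rule levy_process_left_limit[OF L2]) (use False path in auto)
    moreover have "max (- r) 0 = - r" "max r 0 = 0" using False by auto
    ultimately show ?thesis using z(1) by auto
  qed
  have cad: "AE \<omega> in M. cadlag_on UNIV (\<lambda>t. L t \<omega>)"
    using path z c by eventually_elim (rule cadlag_two_sided, auto)
  obtain \<psi> where \<psi>: "continuous_on UNIV \<psi>" "\<psi> 0 = 0"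
    "\<And>h w. 0 \<le> h \<Longrightarrow> (CLINT \<omega>|M. iexp (w * L1 h \<omega>)) = exp (of_real h * \<psi> w)"
    "\<And>s t w. 0 \<le> s \<Longrightarrow> s \<le> t \<Longrightarrow> (CLINT \<omega>|M. iexp (w * (L1 t \<omega> - L1 s \<omega>))) = exp (of_real (t - s) * \<psi> w)"
    using levy_process_exponent[OF L1] by blast
  obtain \<psi>' where \<psi>': "continuous_on UNIV \<psi>'" "\<psi>' 0 = 0"
    "\<And>h w. 0 \<le> h \<Longrightarrow> (CLINT \<omega>|M. iexp (w * L2 h \<omega>)) = exp (of_real h * \<psi>' w)"
    "\<And>s t w. 0 \<le> s \<Longrightarrow> s \<le> t \<Longrightarrow> (CLINT \<omega>|M. iexp (w * (L2 t \<omega> - L2 s \<omega>))) = exp (of_real (t - s) * \<psi>' w)"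
    using levy_process_exponent[OF L2] by blast
  \<comment> \<open>Equal laws at time 1 give equal exponentials only; continuity and the common
    value at 0 identify the exponents.\<close>
  have "\<psi>' w = \<psi> w" for w
  proof (rule continuous_log_unique[OF \<psi>'(1) \<psi>(1)])
    fix w
    have "char (distr M borel (L1 1)) w = char (distr M borel (L2 1)) w" using d by simp
    then have "(CLINT \<omega>|M. iexp (w * L1 1 \<omega>)) = (CLINT \<omega>|M. iexp (w * L2 1 \<omega>))" by (simp add: char_distr_eq)
    then show "exp (\<psi>' w) = exp (\<psi> w)" using \<psi>(3)[of 1 w] \<psi>'(3)[of 1 w] by simp
  qed (simp add: \<psi> \<psi>')
  then have \<psi>'\<psi>: "\<psi>' = \<psi>" by auto
  have main: "(CLINT \<omega>|M. iexp (\<Sum>i<n. w i * (L (r (Suc i)) \<omega> - L (r i) \<omega>))) = exp (\<Sum>i<n. of_real (r (Suc i) - r i) * \<psi> (w i))"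
    if r: "\<And>i. i < n \<Longrightarrow> r i \<le> r (Suc i)" for n r and w :: "nat \<Rightarrow> real"
  proof -
    define p where "p i = max (r i) 0" for i
    define q where "q i = max (- r i) 0" for i
    define f where "f x = (\<Sum>i<n. w i * (x (p (Suc i)) - x (p i)))" for x :: "real \<Rightarrow> real"
    define g where "g x = (\<Sum>i<n. w i * (x (q i) - x (q (Suc i))))" for x :: "real \<Rightarrow> real"
    let ?S = "\<lambda>\<omega>. \<Sum>i<n. w i * (L (r (Suc i)) \<omega> - L (r i) \<omega>)"
    let ?S1 = "\<lambda>\<omega>. \<Sum>i<n. w i * (L1 (p (Suc i)) \<omega> - L1 (p i) \<omega>)"
    let ?S2 = "\<lambda>\<omega>. \<Sum>i<n. w i * (L2 (q i) \<omega> - L2 (q (Suc i)) \<omega>)"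
    have fm: "f \<in> borel_measurable (PiM {0..} (\<lambda>_. borel))" unfolding f_def
      by (intro borel_measurable_sum borel_measurable_times borel_measurable_diff measurable_component_singleton) (auto simp: p_def)
    have gm: "g \<in> borel_measurable (PiM {0..} (\<lambda>_. borel))" unfolding g_def
      by (intro borel_measurable_sum borel_measurable_times borel_measurable_diff measurable_component_singleton) (auto simp: q_def)
    have fL: "f \<circ> (\<lambda>\<omega>. \<lambda>t\<in>{0..}. L1 t \<omega>) = ?S1"
      by (auto simp: f_def fun_eq_iff p_def)
    have gL: "g \<circ> (\<lambda>\<omega>. \<lambda>t\<in>{0..}. L2 t \<omega>) = ?S2"
      by (auto simp: g_def fun_eq_iff q_def)
    have iv: "indep_var borel ?S1 borel ?S2"
      using indep_var_compose[OF ind fm gm] unfolding fL gL .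
    have m1: "?S1 \<in> borel_measurable M" and
      m2: "?S2 \<in> borel_measurable M"
      by (rule indep_var_rv1[OF iv]) (rule indep_var_rv2[OF iv])
    have "AE \<omega> in M. \<forall>i. L (r i) \<omega> = L1 (p i) \<omega> - L2 (q i) \<omega>"
      unfolding p_def q_def by (subst AE_all_countable) (use decomp in auto)
    then have "AE \<omega> in M. ?S \<omega> =
       ?S1 \<omega> + ?S2 \<omega>"
    proof eventually_elim
      case (elim \<omega>)
      then have e: "L (r i) \<omega> = L1 (p i) \<omega> - L2 (q i) \<omega>" for i by blast
      show ?case unfolding e sum.distrib[symmetric] by (intro sum.cong refl) (simp add: algebra_simps)
    qed
    note sum_eq = this
    have "(CLINT \<omega>|M. iexp (?S \<omega>)) =
      (CLINT \<omega>|M. iexp (?S1 \<omega> + ?S2 \<omega>))"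
    proof (intro integral_cong_AE)
      have im: "iexp \<in> borel_measurable borel" by measurable
      have m0: "?S \<in> borel_measurable M" by measurable
      show "(\<lambda>\<omega>. iexp (?S1 \<omega> + ?S2 \<omega>)) \<in> borel_measurable M"
        by (rule measurable_compose[OF borel_measurable_add[OF m1 m2] im])
      show "(\<lambda>\<omega>. iexp (?S \<omega>)) \<in> borel_measurable M"
        by (rule measurable_compose[OF m0 im])
      show "AE \<omega> in M. iexp (?S \<omega>) =
          iexp (?S1 \<omega> + ?S2 \<omega>)"
        using sum_eq by eventually_elim (simp only:)
    qed
    also have "\<dots> = (CLINT \<omega>|M. iexp (?S1 \<omega>)) * (CLINT \<omega>|M. iexp (?S2 \<omega>))"
      using char_distr_add[OF iv, of 1]
      unfolding char_distr_eq[OF borel_measurable_add[OF m1 m2]] char_distr_eq[OF m1] char_distr_eq[OF m2] mult_1 .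
    also have "(CLINT \<omega>|M. iexp (?S1 \<omega>)) = exp (\<Sum>i<n. of_real (p (Suc i) - p i) * \<psi> (w i))"
    proof (rule levy_process_increments_char[OF L1 \<psi>(4)])
      fix i assume "i < n"
      then show "p i \<le> p (Suc i)" unfolding p_def using r by (intro max.mono) auto
    qed (auto simp: p_def)
    also have "(CLINT \<omega>|M. iexp (?S2 \<omega>)) = exp (\<Sum>i<n. of_real (q i - q (Suc i)) * \<psi> (w i))"
    proof -
      \<comment> \<open>The clipped times \<open>q\<close> decrease with the index, so the partition
        is traversed backwards.\<close>
      have "(CLINT \<omega>|M. iexp (\<Sum>i<n. w (n - Suc i) * (L2 (q (n - Suc i)) \<omega> - L2 (q (n - i)) \<omega>))) = exp (\<Sum>i<n. of_real (q (n - Suc i) - q (n - i)) * \<psi> (w (n - Suc i)))"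
      proof (rule levy_process_increments_char[OF L2 \<psi>'(4), unfolded \<psi>'\<psi>])
        fix i assume "i < n"
        then have "r (n - Suc i) \<le> r (n - i)" using r[of "n - Suc i"] by (simp add: Suc_diff_Suc)
        then show "q (n - i) \<le> q (n - Suc i)" by (auto simp: q_def)
      qed (auto simp: q_def)
      moreover have "(\<Sum>i<n. w (n - Suc i) * (L2 (q (n - Suc i)) \<omega> - L2 (q (n - i)) \<omega>)) = ?S2 \<omega>" for \<omega>
        by (subst (2) sum.nat_diff_reindex[symmetric]) (auto intro!: sum.cong simp: Suc_diff_Suc)
      moreover have "(\<Sum>i<n. of_real (q (n - Suc i) - q (n - i)) * \<psi> (w (n - Suc i))) = (\<Sum>i<n. of_real (q i - q (Suc i)) * \<psi> (w i))"
        by (subst (2) sum.nat_diff_reindex[symmetric]) (auto intro!: sum.cong simp: Suc_diff_Suc)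
      ultimately show ?thesis by simp
    qed
    also have "exp (\<Sum>i<n. of_real (p (Suc i) - p i) * \<psi> (w i)) * exp (\<Sum>i<n. of_real (q i - q (Suc i)) * \<psi> (w i)) = exp (\<Sum>i<n. of_real (r (Suc i) - r i) * \<psi> (w i))"
    proof -
      have "r (Suc i) - r i = (p (Suc i) - p i) + (q i - q (Suc i))" for i
        by (auto simp: p_def q_def max_def)
      then show ?thesis by (simp only: of_real_add distrib_right sum.distrib exp_add)
    qed
    finally show ?thesis .
  qed
  have L0: "AE \<omega> in M. L 0 \<omega> = 0" using path z(1) by auto
  show ?thesis by (rule that[OF L1 L2 decomp cad L0 Lm \<psi>(2,3) main])
qed

lemma additive_process_two_sided_levy:
  assumes "prob_space M" and L: "two_sided_levy_process M L"
  shows "additive_process M L"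
proof -
  interpret prob_space M by fact
  obtain L1 L2 \<psi> where L1: "levy_process M L1"
    and cad: "AE \<omega> in M. cadlag_on UNIV (\<lambda>t. L t \<omega>)" and L0: "AE \<omega> in M. L 0 \<omega> = 0" and Lm: "process_on M UNIV L"
    and \<psi>: "\<And>h w. 0 \<le> h \<Longrightarrow> (CLINT \<omega>|M. iexp (w * L1 h \<omega>)) = exp (of_real h * \<psi> w)"
    and char: "\<And>n r w. (\<And>i. i < n \<Longrightarrow> r i \<le> r (Suc i)) \<Longrightarrow>
       (CLINT \<omega>|M. iexp (\<Sum>i<n. w i * (L (r (Suc i)) \<omega> - L (r i) \<omega>))) = exp (\<Sum>i<n. of_real (r (Suc i) - r i) * \<psi> (w i))"
    by (rule two_sided_levy_processE[OF assms]) blast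
  have [measurable]: "L t \<in> borel_measurable M" for t using Lm by (auto simp: process_on_def)
  have m1[measurable]: "L1 t \<in> borel_measurable M" if "0 \<le> t" for t
    using L1 that by (auto simp: levy_process_def additive_process_on_def process_on_def)
  have char1: "(CLINT \<omega>|M. iexp (w * (L t \<omega> - L s \<omega>))) = exp (of_real (t - s) * \<psi> w)" if "s \<le> t" for s t w
    using char[of 1 "\<lambda>i. if i = 0 then s else t" "\<lambda>_. w"] that by simp
  have "independent_increments_on M UNIV L"
    unfolding independent_increments_on_def
  proof (intro allI impI indep_vars_if_char_prod)
    fix n :: nat and t :: "nat \<Rightarrow> real" and \<theta> :: "nat \<Rightarrow> real"
    assume "(\<forall>i\<le>n. t i \<in> UNIV) \<and> (\<forall>i<n. t i < t (Suc i))"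
    then have t: "\<And>i. i < n \<Longrightarrow> t i \<le> t (Suc i)" by (simp add: less_imp_le)
    show "(CLINT \<omega>|M. iexp (\<Sum>j<n. \<theta> j * (L (t (Suc j)) \<omega> - L (t j) \<omega>))) = (\<Prod>j<n. CLINT \<omega>|M. iexp (\<theta> j * (L (t (Suc j)) \<omega> - L (t j) \<omega>)))"
    proof -
      have "(\<Prod>j<n. CLINT \<omega>|M. iexp (\<theta> j * (L (t (Suc j)) \<omega> - L (t j) \<omega>))) = (\<Prod>j<n. exp (of_real (t (Suc j) - t j) * \<psi> (\<theta> j)))"
        by (rule prod.cong[OF refl char1]) (use t in auto)
      also have "\<dots> = exp (\<Sum>j<n. of_real (t (Suc j) - t j) * \<psi> (\<theta> j))" by (rule exp_sum[symmetric]) simp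
      finally show ?thesis using char[of n t \<theta>] t by metis
    qed
  qed measurable
  moreover have "tendsto_in_prob M L (L t) (at t within UNIV)" for t
    unfolding tendsto_in_prob_def
  proof (intro allI impI)
    fix e :: real assume e: "e > 0"
    have law: "prob {\<omega>\<in>space M. e < \<bar>L s \<omega> - L u \<omega>\<bar>} = prob {\<omega>\<in>space M. e < \<bar>L1 (s - u) \<omega>\<bar>}" if "u \<le> s" for s u
    proof -
      have "distr M borel (\<lambda>\<omega>. L s \<omega> - L u \<omega>) = distr M borel (L1 (s - u))"
      proof (intro Levy_uniqueness real_distribution_distr ext)
        fix w
        have [measurable]: "L1 (s - u) \<in> borel_measurable M" using that by (auto intro: m1)
        have "char (distr M borel (\<lambda>\<omega>. L s \<omega> - L u \<omega>)) w = (CLINT \<omega>|M. iexp (w * (L s \<omega> - L u \<omega>)))" by (rule char_distr_eq) measurable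
        also have "\<dots> = (CLINT \<omega>|M. iexp (w * L1 (s - u) \<omega>))" using char1[OF that] \<psi>[of "s - u"] that by simp
        also have "\<dots> = char (distr M borel (L1 (s - u))) w" by (rule char_distr_eq[symmetric]) measurable
        finally show "char (distr M borel (\<lambda>\<omega>. L s \<omega> - L u \<omega>)) w = char (distr M borel (L1 (s - u))) w" .
      qed (use that in auto)
      then have "measure (distr M borel (\<lambda>\<omega>. L s \<omega> - L u \<omega>)) {x. e < \<bar>x\<bar>} = measure (distr M borel (L1 (s - u))) {x. e < \<bar>x\<bar>}" by simp
      then show ?thesis using that by (simp add: measure_distr vimage_def Int_def conj_commute)
    qed
    \<comment> \<open>The absolute value makes the two orders of \<open>s\<close> and
      \<open>t\<close> agree, which reduces stochastic continuity at \<open>t\<close> to that of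
      \<open>L1\<close> at 0.\<close>
    have law': "prob {\<omega>\<in>space M. e < \<bar>L s \<omega> - L t \<omega>\<bar>} = prob {\<omega>\<in>space M. e < \<bar>L1 \<bar>s - t\<bar> \<omega>\<bar>}" for s
      using law[of t s] law[of s t] by (cases "t \<le> s") (auto simp: abs_minus_commute)
    have "tendsto_in_prob M L1 (L1 0) (at 0 within {0..})" using L1 by (auto simp: levy_process_def additive_process_on_def)
    then have "((\<lambda>h. prob {\<omega>\<in>space M. e < \<bar>L1 h \<omega> - L1 0 \<omega>\<bar>}) \<longlongrightarrow> 0) (at 0 within {0..})"
      using e by (simp add: tendsto_in_prob_def)
    moreover have "prob {\<omega>\<in>space M. e < \<bar>L1 h \<omega> - L1 0 \<omega>\<bar>} = prob {\<omega>\<in>space M. e < \<bar>L1 h \<omega>\<bar>}" if "h \<ge> 0" for h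
    proof (rule finite_measure_eq_AE)
      have [measurable]: "L1 h \<in> borel_measurable M" "L1 0 \<in> borel_measurable M" using that by (auto intro: m1)
      show "{\<omega>\<in>space M. e < \<bar>L1 h \<omega> - L1 0 \<omega>\<bar>} \<in> events" "{\<omega>\<in>space M. e < \<bar>L1 h \<omega>\<bar>} \<in> events"
        by measurable
      have "AE \<omega> in M. L1 0 \<omega> = 0" using L1 by (auto simp: levy_process_def additive_process_on_def)
      then show "AE \<omega> in M. (\<omega> \<in> {\<omega>\<in>space M. e < \<bar>L1 h \<omega> - L1 0 \<omega>\<bar>}) = (\<omega> \<in> {\<omega>\<in>space M. e < \<bar>L1 h \<omega>\<bar>})"
        by eventually_elim auto
    qed
    then have "eventually (\<lambda>h. prob {\<omega>\<in>space M. e < \<bar>L1 h \<omega> - L1 0 \<omega>\<bar>} = prob {\<omega>\<in>space M. e < \<bar>L1 h \<omega>\<bar>}) (at 0 within {0..})"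
      by (auto simp: eventually_at_filter)
    ultimately have "((\<lambda>h. prob {\<omega>\<in>space M. e < \<bar>L1 h \<omega>\<bar>}) \<longlongrightarrow> 0) (at 0 within {0..})"
      by (rule Lim_transform_eventually)
    moreover have "filterlim (\<lambda>s. \<bar>s - t\<bar>) (at 0 within {0..}) (at t)"
    proof -
      have "((\<lambda>s. \<bar>s - t\<bar>) \<longlongrightarrow> \<bar>t - t\<bar>) (at t)" by (intro tendsto_intros)
      then show ?thesis by (simp add: filterlim_at eventually_at_filter)
    qed
    ultimately show "((\<lambda>s. prob {\<omega>\<in>space M. e < \<bar>L s \<omega> - L t \<omega>\<bar>}) \<longlongrightarrow> 0) (at t within UNIV)"
      unfolding law' by (rule filterlim_compose)
  qed
  ultimately show ?thesis using cad L0 Lm by (simp add: additive_process_on_def)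
qed

section \<open>The exponential time change\<close>

lemma time_change_0 [simp]: "time_change \<delta> 0 = 0"
  by (simp add: time_change_def)

lemma strict_mono_time_change: "strict_mono (time_change \<delta>)"
proof (rule strict_monoI)
  fix s t :: real assume st: "s < t"
  consider "\<delta> = 0" | "\<delta> > 0" | "\<delta> < 0" by linarith
  then show "time_change \<delta> s < time_change \<delta> t"
  proof cases
    case 2
    then show ?thesis using st by (simp add: time_change_def divide_strict_right_mono)
  next
    case 3
    then show ?thesis using st by (simp add: time_change_def divide_strict_right_mono_neg)
  qed (use st in \<open>simp add: time_change_def\<close>)
qed

lemma continuous_on_time_change: "continuous_on S (time_change \<delta>)"
proof (cases "\<delta> = 0")
  case True
  then have "time_change \<delta> = (\<lambda>t. t)" by (auto simp: time_change_def)
  then show ?thesis by simp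
next
  case False
  then have "time_change \<delta> = (\<lambda>t. (exp (\<delta> * t) - 1) / (exp \<delta> - 1))" by (auto simp: time_change_def)
  then show ?thesis using False by (auto intro!: continuous_intros)
qed

lemma time_change_shift: "time_change \<delta> (t + T) - time_change \<delta> (s + T) = exp (\<delta> * T) * (time_change \<delta> t - time_change \<delta> s)"
proof (cases "\<delta> = 0")
  case False
  have "(x - 1) / (exp \<delta> - 1) - (y - 1) / (exp \<delta> - 1) = (x - y) / (exp \<delta> - 1)" for x y
    by (simp flip: diff_divide_distrib)
  moreover have "exp (\<delta> * (t + T)) - exp (\<delta> * (s + T)) = exp (\<delta> * T) * (exp (\<delta> * t) - exp (\<delta> * s))"
    by (simp add: exp_add algebra_simps)
  ultimately show ?thesis using False by (simp add: time_change_def)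
qed (simp add: time_change_def)

lemma additive_process_time_changed:
  assumes L: "additive_process M L"
  shows "additive_process M (time_changed \<delta> L)"
proof -
  have ct: "(time_change \<delta> \<longlongrightarrow> time_change \<delta> t) (at t within S)" for t S
    using continuous_on_time_change[of UNIV \<delta>] by (meson UNIV_I continuous_on_def tendsto_within_subset subset_UNIV)
  note m = strict_mono_time_change[of \<delta>]
  have "tendsto_in_prob M (time_changed \<delta> L) (time_changed \<delta> L t) (at t within UNIV)" for t
    unfolding time_changed_def
  proof (rule tendsto_in_prob_compose)
    show "tendsto_in_prob M L (L (time_change \<delta> t)) (at (time_change \<delta> t) within UNIV)"
      using L by (auto simp: additive_process_on_def)
    show "filterlim (time_change \<delta>) (at (time_change \<delta> t)) (at t)"
      using ct m by (auto simp: filterlim_at eventually_at_filter strict_mono_eq)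
  qed
  moreover have "AE \<omega> in M. cadlag_on UNIV (\<lambda>t. time_changed \<delta> L t \<omega>)"
  proof -
    have "AE \<omega> in M. cadlag_on UNIV (\<lambda>t. L t \<omega>)" using L by (auto simp: additive_process_on_def)
    then show ?thesis unfolding time_changed_def
      by eventually_elim (rule cadlag_compose_strict_mono[OF _ continuous_on_time_change m])
  qed
  moreover have "independent_increments_on M UNIV (time_changed \<delta> L)"
    unfolding independent_increments_on_def time_changed_def
  proof (intro allI impI)
    fix n :: nat and t :: "nat \<Rightarrow> real" assume "(\<forall>i\<le>n. t i \<in> UNIV) \<and> (\<forall>i<n. t i < t (Suc i))"
    then have t: "\<forall>i<n. time_change \<delta> (t i) < time_change \<delta> (t (Suc i))" using m by (simp add: strict_mono_less)
    then show "prob_space.indep_vars M (\<lambda>_. borel) (\<lambda>i \<omega>. L (time_change \<delta> (t (Suc i))) \<omega> - L (time_change \<delta> (t i)) \<omega>) {..<n}"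
    proof -
      have "independent_increments_on M UNIV L" using L by (simp add: additive_process_on_def)
      from spec[OF spec[OF this[unfolded independent_increments_on_def], of n], of "\<lambda>i. time_change \<delta> (t i)"]
      show ?thesis using t by simp
    qed
  qed
  ultimately show ?thesis using L unfolding additive_process_on_def
    by (auto simp: process_on_def time_changed_def)
qed

section \<open>The integral process\<close>

lemma cadlag_on_shift:
  assumes y: "cadlag_on UNIV y"
  shows "cadlag_on UNIV (\<lambda>t. y (t + T :: real))"
  by (rule cadlag_compose_strict_mono[OF y]) (auto intro!: continuous_intros strict_monoI)

lemma exp_primitive_shift:
  assumes y: "cadlag_on UNIV y" and ab: "a \<le> b"
  shows "exp_primitive k (\<lambda>u. y (u + T)) b - exp_primitive k (\<lambda>u. y (u + T)) a
    = exp (- k * T) * (exp_primitive k y (b + T) - exp_primitive k y (a + T))"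
proof -
  have "integral {a..b} (\<lambda>u. k * exp (k * u) * y (u + T)) = integral {a..b} ((\<lambda>u. exp (- k * T) * (k * exp (k * u) * y u)) \<circ> (+) T)"
    by (intro integral_cong) (simp add: algebra_simps flip: exp_add)
  also have "\<dots> = exp (- k * T) * integral {a + T..b + T} (\<lambda>u. k * exp (k * u) * y u)"
    by (subst integral_shift_Icc_real) simp
  finally have I: "integral {a..b} (\<lambda>u. k * exp (k * u) * y (u + T)) = exp (- k * T) * integral {a + T..b + T} (\<lambda>u. k * exp (k * u) * y u)" .
  have e: "exp (k * u) = exp (- k * T) * exp (k * (u + T))" for u
    by (simp add: algebra_simps flip: exp_add)
  have "exp_primitive k (\<lambda>u. y (u + T)) b - exp_primitive k (\<lambda>u. y (u + T)) a =
     exp (k * b) * y (b + T) - exp (k * a) * y (a + T) - integral {a..b} (\<lambda>u. k * exp (k * u) * y (u + T))"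
    using cadlag_integral_exp[OF cadlag_on_shift[OF y], of k T a b] ab by (simp add: cadlag_integral_def deriv_exp_mult)
  also have "\<dots> = exp (- k * T) * (exp (k * (b + T)) * y (b + T) - exp (k * (a + T)) * y (a + T) - integral {a + T..b + T} (\<lambda>u. k * exp (k * u) * y u))"
    unfolding I e[of b] e[of a] by (simp add: algebra_simps)
  also have "exp (k * (b + T)) * y (b + T) - exp (k * (a + T)) * y (a + T) - integral {a + T..b + T} (\<lambda>u. k * exp (k * u) * y u) =
     exp_primitive k y (b + T) - exp_primitive k y (a + T)"
    using cadlag_integral_exp[OF y, of k "a + T" "b + T"] ab by (simp add: cadlag_integral_def deriv_exp_mult)
  finally show ?thesis .
qed

text \<open>Meant for the exponent of the driving process, which is not additive in general but is
  so on weights with disjoint supports. This is how increments of the integral process over disjoint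
  intervals become independent.\<close>

lemma sum_at_most_one_nonzero:
  fixes f :: "real \<Rightarrow> complex" and x :: "'i \<Rightarrow> real"
  assumes f0: "f 0 = 0" and "finite J" and one: "\<And>i j. i \<in> J \<Longrightarrow> j \<in> J \<Longrightarrow> i \<noteq> j \<Longrightarrow> x i = 0 \<or> x j = 0"
  shows "f (\<Sum>j\<in>J. x j) = (\<Sum>j\<in>J. f (x j))"
proof (cases "\<exists>i\<in>J. x i \<noteq> 0")
  case True
  then obtain i where i: "i \<in> J" "x i \<noteq> 0" by blast
  then have z: "x j = 0" if "j \<in> J - {i}" for j using one[of i j] that by auto
  have "(\<Sum>j\<in>J. x j) = x i" using sum.remove[OF \<open>finite J\<close> i(1), of x] z by simp
  moreover have "(\<Sum>j\<in>J. f (x j)) = f (x i)" using sum.remove[OF \<open>finite J\<close> i(1), of "\<lambda>j. f (x j)"] z f0 by simp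
  ultimately show ?thesis by simp
qed (simp add: f0)

lemma sum_int_nat_reindex:
  fixes p q :: int
  assumes "p \<le> q"
  shows "(\<Sum>i\<in>{p..<q}. f i) = (\<Sum>l<nat (q - p). f (p + int l))"
  by (rule sum.reindex_bij_witness[of _ "\<lambda>l. p + int l" "\<lambda>i. nat (i - p)"]) (use assms in auto)

text \<open>Inside the locale the Levy process is visible only through the joint characteristic
  function of the increments of \<open>Y\<close>, stated for arbitrary weights.\<close>

locale levy_driven = prob_space M for M :: "'a measure" +
  fixes Y :: "real \<Rightarrow> 'a \<Rightarrow> real" and \<delta> k :: real and \<psi> :: "real \<Rightarrow> complex"
  assumes Y_measurable [measurable]: "\<And>t. Y t \<in> borel_measurable M"
    and Y_cadlag: "AE \<omega> in M. cadlag_on UNIV (\<lambda>t. Y t \<omega>)"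
    and exponent_0: "\<psi> 0 = 0"
    and Y_char: "\<And>n r w. (\<And>i. i < n \<Longrightarrow> r i \<le> r (Suc i)) \<Longrightarrow>
       (CLINT \<omega>|M. iexp (\<Sum>i<n. w i * (Y (r (Suc i)) \<omega> - Y (r i) \<omega>))) =
       exp (\<Sum>i<n. of_real (time_change \<delta> (r (Suc i)) - time_change \<delta> (r i)) * \<psi> (w i))"
begin

text \<open>The shift \<open>T\<close> acts on the path only, while grid and weights stay put. Sums
  with different shifts thus have the same weights, and their exponents differ only through the
  increments of the time change.\<close>

definition riemann :: "nat \<Rightarrow> real \<Rightarrow> real \<Rightarrow> real \<Rightarrow> 'a \<Rightarrow> real" where
  "riemann n T a b \<omega> = (\<Sum>i\<in>{\<lceil>a * real (Suc n)\<rceil>..<\<lceil>b * real (Suc n)\<rceil>}.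
      exp (k * (of_int i / real (Suc n))) * (Y (of_int (i + 1) / real (Suc n) + T) \<omega> - Y (of_int i / real (Suc n) + T) \<omega>))"

text \<open>A measurable version of the integral process \<open>\<integral>\<^sub>0\<^sup>t exp (k s) dY\<^sub>s\<close>: the pathwise integral is only
  almost surely a limit of measurable functions, and \<open>M\<close> need not be complete.\<close>

definition W :: "real \<Rightarrow> 'a \<Rightarrow> real" where
  "W t \<omega> = (if 0 \<le> t then lim (\<lambda>n. riemann n 0 0 t \<omega>) else - lim (\<lambda>n. riemann n 0 t 0 \<omega>))"

lemma riemann_measurable [measurable]: "riemann n T a b \<in> borel_measurable M"
  unfolding riemann_def[abs_def] by measurable

lemma W_measurable [measurable]: "W t \<in> borel_measurable M"
  unfolding W_def[abs_def] by (cases "0 \<le> t") (simp_all add: borel_measurable_lim_metric)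

lemma W_eq_exp_primitive: "AE \<omega> in M. \<forall>t. W t \<omega> = exp_primitive k (\<lambda>u. Y u \<omega>) t"
  using Y_cadlag
proof eventually_elim
  case (elim \<omega>)
  show ?case
  proof
    fix t
    show "W t \<omega> = exp_primitive k (\<lambda>u. Y u \<omega>) t"
    proof (cases "0 \<le> t")
      case True
      have "(\<lambda>n. riemann n 0 0 t \<omega>) \<longlonglongrightarrow> exp_primitive k (\<lambda>u. Y u \<omega>) t"
        using exp_riemann_sum_tendsto[OF elim True, of k] by (simp add: riemann_def del: of_nat_Suc)
      then show ?thesis using True by (simp add: W_def limI)
    next
      case False
      have "(\<lambda>n. riemann n 0 t 0 \<omega>) \<longlonglongrightarrow> - exp_primitive k (\<lambda>u. Y u \<omega>) t"
        using exp_riemann_sum_tendsto[OF elim, of t 0 k] False by (simp add: riemann_def del: of_nat_Suc)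
      then show ?thesis using False by (simp add: W_def limI)
    qed
  qed
qed

lemma W_right_continuous: "AE \<omega> in M. \<forall>t. ((\<lambda>s. W s \<omega>) \<longlongrightarrow> W t \<omega>) (at_right t)"
  using W_eq_exp_primitive Y_cadlag
proof eventually_elim
  case (elim \<omega>)
  then have "(\<lambda>s. W s \<omega>) = exp_primitive k (\<lambda>u. Y u \<omega>)" by auto
  then show ?case using exp_primitive_right_continuous[OF elim(2)] by metis
qed

lemma cadlag_integral_W:
  "AE \<omega> in M. \<forall>a b. cadlag_integral (\<lambda>u. exp (k * u)) (\<lambda>u. Y u \<omega>) a b = W b \<omega> - W a \<omega>"
  using W_eq_exp_primitive Y_cadlag by eventually_elim (simp add: cadlag_integral_exp)

lemma riemann_tendsto:
  \<comment> \<open>The factor \<open>exp (- k * T)\<close> accounts for the weights not having been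
    shifted along with the path.\<close>
  "AE \<omega> in M. \<forall>a b. a \<le> b \<longrightarrow> (\<lambda>n. riemann n T a b \<omega>) \<longlonglongrightarrow> exp (- k * T) * (W (b + T) \<omega> - W (a + T) \<omega>)"
  using W_eq_exp_primitive Y_cadlag
proof eventually_elim
  case (elim \<omega>)
  show ?case
  proof (intro allI impI)
    fix a b :: real assume ab: "a \<le> b"
    show "(\<lambda>n. riemann n T a b \<omega>) \<longlonglongrightarrow> exp (- k * T) * (W (b + T) \<omega> - W (a + T) \<omega>)"
      using exp_riemann_sum_tendsto[OF cadlag_on_shift[OF elim(2), of T] ab, of k] exp_primitive_shift[OF elim(2) ab, of k T] elim(1)
      by (simp add: riemann_def del: of_nat_Suc)
  qed
qed

lemma Y_char_int:
  fixes p q :: int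
  assumes r: "mono r" and pq: "p \<le> q"
  shows "(CLINT \<omega>|M. iexp (\<Sum>i\<in>{p..<q}. w i * (Y (r (i + 1)) \<omega> - Y (r i) \<omega>))) =
    exp (\<Sum>i\<in>{p..<q}. of_real (time_change \<delta> (r (i + 1)) - time_change \<delta> (r i)) * \<psi> (w i))"
proof -
  define s where "s l = r (p + int l)" for l
  have s: "s (Suc l) = r (p + int l + 1)" for l by (simp add: s_def add.assoc add.commute[of 1])
  have "s i \<le> s (Suc i)" for i unfolding s_def by (rule monoD[OF r]) simp
  then have "(CLINT \<omega>|M. iexp (\<Sum>l<nat (q - p). w (p + int l) * (Y (s (Suc l)) \<omega> - Y (s l) \<omega>))) =
    exp (\<Sum>l<nat (q - p). of_real (time_change \<delta> (s (Suc l)) - time_change \<delta> (s l)) * \<psi> (w (p + int l)))"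
    by (rule Y_char)
  then show ?thesis unfolding sum_int_nat_reindex[OF pq] s by (simp only: s_def)
qed

text \<open>Extending the weights by 0 outside their interval puts sums over different intervals on
  one common grid.\<close>

definition cell_weight :: "nat \<Rightarrow> real \<Rightarrow> real \<Rightarrow> int \<Rightarrow> real" where
  "cell_weight n a b i = (if \<lceil>a * real (Suc n)\<rceil> \<le> i \<and> i < \<lceil>b * real (Suc n)\<rceil> then exp (k * (of_int i / real (Suc n))) else 0)"

text \<open>The exponent of a weighted sum of unshifted increments over the grid on
  \<open>[-N, N]\<close>, with weight \<open>g i\<close> on cell \<open>i\<close>.\<close>

definition log_char_sum :: "nat \<Rightarrow> nat \<Rightarrow> (int \<Rightarrow> real) \<Rightarrow> complex" where
  "log_char_sum N n g = (\<Sum>i\<in>{- int (N * Suc n)..<int (N * Suc n)}.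
     of_real (time_change \<delta> (of_int (i + 1) / real (Suc n)) - time_change \<delta> (of_int i / real (Suc n))) * \<psi> (g i))"

lemma riemann_eq_cell_weight_sum:
  assumes "- real N \<le> a" "b \<le> real N"
  shows "riemann n T a b \<omega> = (\<Sum>i\<in>{- int (N * Suc n)..<int (N * Suc n)}. cell_weight n a b i *
     (Y (of_int (i + 1) / real (Suc n) + T) \<omega> - Y (of_int i / real (Suc n) + T) \<omega>))"
proof -
  have "- real N * real (Suc n) \<le> a * real (Suc n)" using assms(1) by (intro mult_right_mono) auto
  then have "- real (N * Suc n) \<le> a * real (Suc n)" by (simp only: of_nat_mult mult_minus_left)
  then have lo: "- int (N * Suc n) \<le> \<lceil>a * real (Suc n)\<rceil>" by linarith
  have "b * real (Suc n) \<le> real (N * Suc n)" unfolding of_nat_mult using assms(2) by (intro mult_right_mono) auto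
  then have hi: "\<lceil>b * real (Suc n)\<rceil> \<le> int (N * Suc n)" by linarith
  have "{\<lceil>a * real (Suc n)\<rceil>..<\<lceil>b * real (Suc n)\<rceil>} \<subseteq> {- int (N * Suc n)..<int (N * Suc n)}" using lo hi by auto
  then show ?thesis unfolding riemann_def
    by (intro sum.mono_neutral_cong_left) (auto simp: cell_weight_def)
qed

text \<open>All laws of the integral process are accessed through this limit. The shift
  \<open>T\<close> enters on the left solely as the scalar \<open>exp (\<delta> * T)\<close>, and
  only the exponentials are claimed to converge.\<close>

theorem W_increments_char:
  fixes a b \<theta> :: "nat \<Rightarrow> real"
  assumes ab: "\<And>j. j < m \<Longrightarrow> a j \<le> b j" and N: "\<And>j. j < m \<Longrightarrow> - real N \<le> a j" "\<And>j. j < m \<Longrightarrow> b j \<le> real N"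
  shows "(\<lambda>n. exp (of_real (exp (\<delta> * T)) * log_char_sum N n (\<lambda>i. \<Sum>j<m. \<theta> j * cell_weight n (a j) (b j) i)))
     \<longlonglongrightarrow> (CLINT \<omega>|M. iexp (\<Sum>j<m. \<theta> j * (exp (- k * T) * (W (b j + T) \<omega> - W (a j + T) \<omega>))))"
proof -
  have eq: "exp (of_real (exp (\<delta> * T)) * log_char_sum N n (\<lambda>i. \<Sum>j<m. \<theta> j * cell_weight n (a j) (b j) i)) =
      (CLINT \<omega>|M. iexp (\<Sum>j<m. \<theta> j * riemann n T (a j) (b j) \<omega>))" for n
  proof -
    define g where "g i = (\<Sum>j<m. \<theta> j * cell_weight n (a j) (b j) i)" for i
    define I where "I = {- int (N * Suc n)..<int (N * Suc n)}"
    define r where "r i = of_int i / real (Suc n) + T" for i :: int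
    have r: "mono r" unfolding r_def by (intro monoI add_right_mono divide_right_mono) auto
    have "(\<Sum>j<m. \<theta> j * riemann n T (a j) (b j) \<omega>) = (\<Sum>i\<in>I. g i * (Y (r (i + 1)) \<omega> - Y (r i) \<omega>))" for \<omega>
    proof -
      have "(\<Sum>j<m. \<theta> j * riemann n T (a j) (b j) \<omega>) = (\<Sum>j<m. \<Sum>i\<in>I. \<theta> j * cell_weight n (a j) (b j) i * (Y (r (i + 1)) \<omega> - Y (r i) \<omega>))"
        using N by (intro sum.cong refl) (simp add: riemann_eq_cell_weight_sum[of N] sum_distrib_left I_def r_def mult.assoc del: of_nat_Suc)
      also have "\<dots> = (\<Sum>i\<in>I. g i * (Y (r (i + 1)) \<omega> - Y (r i) \<omega>))"
        unfolding g_def sum_distrib_right by (rule sum.swap)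
      finally show ?thesis .
    qed
    then have "(CLINT \<omega>|M. iexp (\<Sum>j<m. \<theta> j * riemann n T (a j) (b j) \<omega>)) =
      exp (\<Sum>i\<in>I. of_real (time_change \<delta> (r (i + 1)) - time_change \<delta> (r i)) * \<psi> (g i))"
      using Y_char_int[OF r, of "- int (N * Suc n)" "int (N * Suc n)" g] by (simp add: I_def)
    also have "(\<Sum>i\<in>I. of_real (time_change \<delta> (r (i + 1)) - time_change \<delta> (r i)) * \<psi> (g i)) =
      of_real (exp (\<delta> * T)) * log_char_sum N n g"
      unfolding log_char_sum_def I_def[symmetric] sum_distrib_left r_def time_change_shift by (simp add: mult.assoc)
    finally show ?thesis unfolding g_def[abs_def] by (rule sym)
  qed
  show ?thesis unfolding eq
  proof (rule iexp_dominated_convergence)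
    show "AE \<omega> in M. (\<lambda>n. \<Sum>j<m. \<theta> j * riemann n T (a j) (b j) \<omega>) \<longlonglongrightarrow> (\<Sum>j<m. \<theta> j * (exp (- k * T) * (W (b j + T) \<omega> - W (a j + T) \<omega>)))"
      using riemann_tendsto[of T] by eventually_elim (intro tendsto_intros, use ab in auto)
  qed measurable
qed

text \<open>On each cell at most one of the weights is nonzero, since disjoint intervals keep
  disjoint index ranges after rounding. The exponent therefore splits into a sum already before the
  limit, and the characteristic functions factor.\<close>

lemma W_independent_increments: "independent_increments_on M UNIV W"
  unfolding independent_increments_on_def
proof (intro allI impI indep_vars_if_char_prod)
  fix m :: nat and t :: "nat \<Rightarrow> real" and \<theta> :: "nat \<Rightarrow> real"
  assume "(\<forall>i\<le>m. t i \<in> UNIV) \<and> (\<forall>i<m. t i < t (Suc i))"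
  then have t: "t i < t (Suc i)" if "i < m" for i using that by blast
  have tm: "t i \<le> t j" if "i \<le> j" "j \<le> m" for i j
    using that by (induction j rule: dec_induct) (auto intro: order_trans[OF _ less_imp_le[OF t]])
  obtain N :: nat where N: "Max ((\<lambda>i. \<bar>t i\<bar>) ` {..m}) \<le> real N" using real_arch_simple by blast
  have tN: "\<bar>t i\<bar> \<le> real N" if "i \<le> m" for i
    using that by (intro order_trans[OF _ N] Max_ge) auto
  have bnd: "- real N \<le> t i" "t (Suc i) \<le> real N" if "i < m" for i using tN[of i] tN[of "Suc i"] that by auto
  define x where "x n j i = \<theta> j * cell_weight n (t j) (t (Suc j)) i" for n j i
  have lim: "(\<lambda>n. exp (log_char_sum N n (\<lambda>i. \<Sum>j<m. x n j i))) \<longlonglongrightarrow> (CLINT \<omega>|M. iexp (\<Sum>j<m. \<theta> j * (W (t (Suc j)) \<omega> - W (t j) \<omega>)))"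
    using W_increments_char[of m t "\<lambda>j. t (Suc j)" N 0 \<theta>] t bnd by (simp add: x_def less_imp_le)
  have lim1: "(\<lambda>n. exp (log_char_sum N n (x n j))) \<longlonglongrightarrow> (CLINT \<omega>|M. iexp (\<theta> j * (W (t (Suc j)) \<omega> - W (t j) \<omega>)))" if "j < m" for j
    using W_increments_char[of 1 "\<lambda>_. t j" "\<lambda>_. t (Suc j)" N 0 "\<lambda>_. \<theta> j"] t[OF that] bnd[OF that] by (simp add: x_def[abs_def] lessThan_Suc less_imp_le)
  have "log_char_sum N n (\<lambda>i. \<Sum>j<m. x n j i) = (\<Sum>j<m. log_char_sum N n (x n j))" for n
  proof -
    have "\<psi> (\<Sum>j<m. x n j i) = (\<Sum>j<m. \<psi> (x n j i))" for i
    proof (rule sum_at_most_one_nonzero[where f=\<psi>, OF exponent_0])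
      have lt: "x n j i = 0 \<or> x n j' i = 0" if "j < j'" "j' < m" for j j'
      proof -
        have "t (Suc j) \<le> t j'" using that by (intro tm) auto
        then have "\<lceil>t (Suc j) * real (Suc n)\<rceil> \<le> \<lceil>t j' * real (Suc n)\<rceil>" by (intro ceiling_mono mult_right_mono) auto
        then show ?thesis by (auto simp: x_def cell_weight_def simp del: of_nat_Suc)
      qed
      fix j j' assume "j \<in> {..<m}" "j' \<in> {..<m}" "j \<noteq> j'"
      then show "x n j i = 0 \<or> x n j' i = 0" using lt[of j j'] lt[of j' j] by (cases j j' rule: linorder_cases) auto
    qed simp
    then show ?thesis unfolding log_char_sum_def by (simp only: sum_distrib_left) (rule sum.swap)
  qed
  then have "(\<lambda>n. \<Prod>j<m. exp (log_char_sum N n (x n j))) \<longlonglongrightarrow> (CLINT \<omega>|M. iexp (\<Sum>j<m. \<theta> j * (W (t (Suc j)) \<omega> - W (t j) \<omega>)))"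
    using lim by (simp add: exp_sum)
  moreover have "(\<lambda>n. \<Prod>j<m. exp (log_char_sum N n (x n j))) \<longlonglongrightarrow> (\<Prod>j<m. CLINT \<omega>|M. iexp (\<theta> j * (W (t (Suc j)) \<omega> - W (t j) \<omega>)))"
    by (intro tendsto_prod) (use lim1 in auto)
  ultimately show "(CLINT \<omega>|M. iexp (\<Sum>j<m. \<theta> j * (W (t (Suc j)) \<omega> - W (t j) \<omega>))) = (\<Prod>j<m. CLINT \<omega>|M. iexp (\<theta> j * (W (t (Suc j)) \<omega> - W (t j) \<omega>)))"
    by (rule LIMSEQ_unique)
qed measurable

text \<open>Reduces the improper integrals for all \<open>t\<close> to one random variable
  \<open>l\<close>, the limit of \<open>W\<close> at the left end.\<close>

lemma has_left_improper_integral_iff: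
  assumes [measurable]: "l \<in> borel_measurable M" and l: "AE \<omega> in M. ((\<lambda>a. W a \<omega>) \<longlongrightarrow> l \<omega>) at_bot"
  shows "has_left_improper_integral M (\<lambda>u. exp ((u - t) * k)) Y t Z \<longleftrightarrow>
    Z \<in> borel_measurable M \<and> (AE \<omega> in M. Z \<omega> = exp (- k * t) * (W t \<omega> - l \<omega>))"
proof -
  have lim: "AE \<omega> in M. ((\<lambda>a. cadlag_integral (\<lambda>u. exp ((u - t) * k)) (\<lambda>u. Y u \<omega>) a t) \<longlongrightarrow> exp (- k * t) * (W t \<omega> - l \<omega>)) at_bot"
    using cadlag_integral_W l
  proof eventually_elim
    case (elim \<omega>)
    have "((\<lambda>a. exp (- k * t) * (W t \<omega> - W a \<omega>)) \<longlongrightarrow> exp (- k * t) * (W t \<omega> - l \<omega>)) at_bot"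
      by (intro tendsto_intros elim)
    then show ?case unfolding cadlag_integral_exp_shift using elim(1) by simp
  qed
  show ?thesis
  proof (intro iffI conjI; (elim conjE)?)
    assume h: "has_left_improper_integral M (\<lambda>u. exp ((u - t) * k)) Y t Z"
    then show "Z \<in> borel_measurable M" by (simp add: has_left_improper_integral_def)
    have "AE \<omega> in M. ((\<lambda>a. cadlag_integral (\<lambda>u. exp ((u - t) * k)) (\<lambda>u. Y u \<omega>) a t) \<longlongrightarrow> Z \<omega>) at_bot"
      using h by (simp add: has_left_improper_integral_def)
    then show "AE \<omega> in M. Z \<omega> = exp (- k * t) * (W t \<omega> - l \<omega>)"
      using lim by eventually_elim (rule tendsto_unique[OF trivial_limit_at_bot_linorder])
  next
    assume Z: "Z \<in> borel_measurable M" and "AE \<omega> in M. Z \<omega> = exp (- k * t) * (W t \<omega> - l \<omega>)"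
    from this(2) lim have "AE \<omega> in M. ((\<lambda>a. cadlag_integral (\<lambda>u. exp ((u - t) * k)) (\<lambda>u. Y u \<omega>) a t) \<longlongrightarrow> Z \<omega>) at_bot"
      by eventually_elim simp
    with Z show "has_left_improper_integral M (\<lambda>u. exp ((u - t) * k)) Y t Z" by (simp add: has_left_improper_integral_def)
  qed
qed

lemma W_limit_exists:
  assumes "AE \<omega> in M. \<exists>l. ((\<lambda>a. W a \<omega>) \<longlongrightarrow> l) at_bot"
  obtains l where "l \<in> borel_measurable M" "AE \<omega> in M. ((\<lambda>a. W a \<omega>) \<longlongrightarrow> l \<omega>) at_bot"
proof
  show "(\<lambda>\<omega>. lim (\<lambda>n. W (- real n) \<omega>)) \<in> borel_measurable M" by (rule borel_measurable_lim_metric) measurable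
  show "AE \<omega> in M. ((\<lambda>a. W a \<omega>) \<longlongrightarrow> lim (\<lambda>n. W (- real n) \<omega>)) at_bot"
    using assms
  proof eventually_elim
    case (elim \<omega>)
    then obtain l where l: "((\<lambda>a. W a \<omega>) \<longlongrightarrow> l) at_bot" by blast
    have "filterlim (\<lambda>n. - real n) at_bot sequentially"
      by (simp add: filterlim_uminus_at_top[symmetric] filterlim_real_sequentially)
    then have "(\<lambda>n. W (- real n) \<omega>) \<longlonglongrightarrow> l" by (rule filterlim_compose[OF l])
    then show ?case using l by (simp add: limI)
  qed
qed

end

section \<open>Behaviour of the integral process at infinity\<close>

lemma exp_primitive_convergent_at_bot:
  assumes y: "cadlag_on UNIV y" and k: "0 < k" and lim: "(y \<longlongrightarrow> z) at_bot"
  shows "\<exists>l. (exp_primitive k y \<longlongrightarrow> l) at_bot"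
proof (rule convergent_at_bot_if_Cauchy)
  fix e :: real assume e: "e > 0"
  have "eventually (\<lambda>u. \<bar>y u - z\<bar> \<le> 1) at_bot"
    by (rule eventually_mono[OF tendstoD[OF lim, of "1"]]) (auto simp: dist_real_def)
  then obtain b0 where b0: "\<And>u. u \<le> b0 \<Longrightarrow> \<bar>y u - z\<bar> \<le> 1"
    unfolding eventually_at_bot_linorder by blast
  \<comment> \<open>Chosen so that the increment bound \<open>2 * exp (k * b)\<close> is at most
    \<open>e\<close>.\<close>
  define b where "b = min b0 (ln (e / 2) / k)"
  have "k * b \<le> ln (e / 2)" using k by (simp add: b_def min_def field_simps)
  then have "exp (k * b) \<le> e / 2" using e by (metis exp_le_cancel_iff exp_ln half_gt_zero)
  then have "\<bar>exp_primitive k y a - exp_primitive k y b\<bar> \<le> e" if "a \<le> b" for a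
    using exp_primitive_increment_bound[OF y k that, of z 1] b0 by (auto simp: b_def abs_minus_commute)
  then show "\<exists>b. \<forall>a\<le>b. \<bar>exp_primitive k y a - exp_primitive k y b\<bar> \<le> e" by blast
qed

text \<open>The factor \<open>exp (k * t)\<close> in the increment bound cancels
  \<open>exp (- k * t)\<close>; what remains is the oscillation of \<open>y\<close> to the left of
  \<open>t\<close>, which is small because \<open>y\<close> converges.\<close>

lemma exp_primitive_tail_at_bot:
  assumes y: "cadlag_on UNIV y" and k: "0 < k" and lim: "(y \<longlongrightarrow> z) at_bot"
    and l: "(exp_primitive k y \<longlongrightarrow> l) at_bot"
  shows "((\<lambda>t. exp (- k * t) * (exp_primitive k y t - l)) \<longlongrightarrow> 0) at_bot"
proof (rule tendstoI)
  fix e :: real assume e: "e > 0"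
  have "eventually (\<lambda>u. \<bar>y u - z\<bar> \<le> e / 4) at_bot"
    by (rule eventually_mono[OF tendstoD[OF lim, of "e/4"]]) (use e in \<open>auto simp: dist_real_def\<close>)
  then obtain b where b: "\<And>u. u \<le> b \<Longrightarrow> \<bar>y u - z\<bar> \<le> e / 4"
    unfolding eventually_at_bot_linorder by blast
  have "dist (exp (- k * t) * (exp_primitive k y t - l)) 0 < e" if t: "t \<le> b" for t
  proof -
    have "\<bar>exp_primitive k y t - l\<bar> \<le> 2 * exp (k * t) * (e / 4)"
    proof (rule tendsto_upperbound)
      show "((\<lambda>a. \<bar>exp_primitive k y t - exp_primitive k y a\<bar>) \<longlongrightarrow> \<bar>exp_primitive k y t - l\<bar>) at_bot"
        by (intro tendsto_intros l)
      show "eventually (\<lambda>a. \<bar>exp_primitive k y t - exp_primitive k y a\<bar> \<le> 2 * exp (k * t) * (e / 4)) at_bot"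
        using eventually_le_at_bot[of t]
      proof eventually_elim
        case (elim a)
        show ?case by (rule exp_primitive_increment_bound[OF y k elim, of z]) (use b t in auto)
      qed
    qed simp
    then have "exp (- k * t) * \<bar>exp_primitive k y t - l\<bar> \<le> exp (- k * t) * (2 * exp (k * t) * (e / 4))" by (intro mult_left_mono) auto
    also have "\<dots> = e / 2" by (simp add: exp_minus)
    finally show ?thesis using e by (simp add: abs_mult)
  qed
  then show "eventually (\<lambda>t. dist (exp (- k * t) * (exp_primitive k y t - l)) 0 < e) at_bot"
    unfolding eventually_at_bot_linorder by blast
qed

text \<open>Here \<open>l\<close> is arbitrary. Splitting at a late time \<open>s\<close>, the fixed
  difference \<open>exp_primitive k y s - l\<close> is damped by \<open>exp (- k * t)\<close>, and
  the increment after \<open>s\<close> is controlled by the oscillation of \<open>y\<close>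
  there.\<close>

lemma exp_primitive_tail_at_top:
  assumes y: "cadlag_on UNIV y" and k: "0 < k" and lim: "(y \<longlongrightarrow> z) at_top"
  shows "((\<lambda>t. exp (- k * t) * (exp_primitive k y t - l)) \<longlongrightarrow> 0) at_top"
proof (rule tendstoI)
  fix e :: real assume e: "e > 0"
  have "eventually (\<lambda>u. \<bar>y u - z\<bar> \<le> e / 8) at_top"
    by (rule eventually_mono[OF tendstoD[OF lim, of "e/8"]]) (use e in \<open>auto simp: dist_real_def\<close>)
  then obtain s where s: "\<And>u. s \<le> u \<Longrightarrow> \<bar>y u - z\<bar> \<le> e / 8"
    unfolding eventually_at_top_linorder by blast
  have "filterlim (\<lambda>t. - (k * t)) at_bot at_top"
    unfolding filterlim_uminus_at_top[symmetric] using k by (intro filterlim_tendsto_pos_mult_at_top[OF tendsto_const] filterlim_ident)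
  then have "((\<lambda>t. exp (- (k * t))) \<longlongrightarrow> 0) at_top" by (rule filterlim_compose[OF exp_at_bot])
  then have "((\<lambda>t. exp (- (k * t)) * \<bar>exp_primitive k y s - l\<bar>) \<longlongrightarrow> 0) at_top" by (rule tendsto_mult_left_zero)
  from order_tendstoD(2)[OF this, of "e/4"] e
  have "eventually (\<lambda>t. exp (- (k * t)) * \<bar>exp_primitive k y s - l\<bar> < e / 4) at_top" by simp
  with eventually_ge_at_top[of s] show "eventually (\<lambda>t. dist (exp (- k * t) * (exp_primitive k y t - l)) 0 < e) at_top"
  proof eventually_elim
    case (elim t)
    have "\<bar>exp_primitive k y t - exp_primitive k y s\<bar> \<le> 2 * exp (k * t) * (e / 8)"
      by (rule exp_primitive_increment_bound[OF y k elim(1)]) (use s in auto)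
    then have "exp (- (k * t)) * \<bar>exp_primitive k y t - exp_primitive k y s\<bar> \<le> exp (- (k * t)) * (2 * exp (k * t) * (e / 8))"
      by (intro mult_left_mono) auto
    also have "\<dots> = e / 4" by (simp add: exp_minus)
    finally have 1: "exp (- (k * t)) * \<bar>exp_primitive k y t - exp_primitive k y s\<bar> \<le> e / 4" .
    have "exp (- (k * t)) * \<bar>exp_primitive k y t - l\<bar> \<le> exp (- (k * t)) * (\<bar>exp_primitive k y t - exp_primitive k y s\<bar> + \<bar>exp_primitive k y s - l\<bar>)"
      by (intro mult_left_mono) auto
    also have "\<dots> < e" using 1 elim(2) e unfolding distrib_left by linarith
    finally show ?case by (simp add: abs_mult)
  qed
qed

context levy_driven
begin

lemma W_tail_at_bot:
  assumes k: "0 < k" and lim: "AE \<omega> in M. \<exists>z. ((\<lambda>t. Y t \<omega>) \<longlongrightarrow> z) at_bot"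
  shows "AE \<omega> in M. \<exists>l. ((\<lambda>t. W t \<omega>) \<longlongrightarrow> l) at_bot"
    and "AE \<omega> in M. \<forall>l. ((\<lambda>t. W t \<omega>) \<longlongrightarrow> l) at_bot \<longrightarrow> ((\<lambda>t. exp (- k * t) * (W t \<omega> - l)) \<longlongrightarrow> 0) at_bot"
proof -
  have "AE \<omega> in M. cadlag_on UNIV (\<lambda>t. Y t \<omega>) \<and> (\<exists>z. ((\<lambda>t. Y t \<omega>) \<longlongrightarrow> z) at_bot) \<and> (\<lambda>t. W t \<omega>) = exp_primitive k (\<lambda>u. Y u \<omega>)"
    using W_eq_exp_primitive Y_cadlag lim by eventually_elim auto
  note * = this
  from * show "AE \<omega> in M. \<exists>l. ((\<lambda>t. W t \<omega>) \<longlongrightarrow> l) at_bot"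
    by eventually_elim (metis exp_primitive_convergent_at_bot[OF _ k])
  from * show "AE \<omega> in M. \<forall>l. ((\<lambda>t. W t \<omega>) \<longlongrightarrow> l) at_bot \<longrightarrow> ((\<lambda>t. exp (- k * t) * (W t \<omega> - l)) \<longlongrightarrow> 0) at_bot"
  proof eventually_elim
    case (elim \<omega>)
    then obtain z where "cadlag_on UNIV (\<lambda>t. Y t \<omega>)" "((\<lambda>t. Y t \<omega>) \<longlongrightarrow> z) at_bot"
      and W: "\<And>t. W t \<omega> = exp_primitive k (\<lambda>u. Y u \<omega>) t" by metis
    from exp_primitive_tail_at_bot[OF this(1) k this(2)] show ?case unfolding W by blast
  qed
qed

lemma W_tail_at_top:
  assumes k: "0 < k" and lim: "AE \<omega> in M. \<exists>z. ((\<lambda>t. Y t \<omega>) \<longlongrightarrow> z) at_top"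
  shows "AE \<omega> in M. \<forall>l. ((\<lambda>t. exp (- k * t) * (W t \<omega> - l)) \<longlongrightarrow> 0) at_top"
  using W_eq_exp_primitive Y_cadlag lim
proof eventually_elim
  case (elim \<omega>)
  then obtain z where "((\<lambda>t. Y t \<omega>) \<longlongrightarrow> z) at_top" by blast
  from exp_primitive_tail_at_top[OF elim(2) k this] show ?case using elim(1) by simp
qed

text \<open>An integer scaling factor turns the exponential of the scaled exponent into an integer
  power, so the identity survives the limit without logarithms.\<close>

lemma W_eq_char_power:
  assumes c: "exp (\<delta> * T) = real n" and s: "s \<le> 0"
  shows "(CLINT \<omega>|M. iexp (t * (exp (- k * T) * (W T \<omega> - W (s + T) \<omega>)))) = (CLINT \<omega>|M. iexp (t * (W 0 \<omega> - W s \<omega>))) ^ n"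
proof -
  obtain N :: nat where N: "- s \<le> real N" using real_arch_simple by blast
  define K where "K m = log_char_sum N m (\<lambda>i. t * cell_weight m s 0 i)" for m
  have 1: "(\<lambda>m. exp (of_real (exp (\<delta> * T)) * K m)) \<longlonglongrightarrow> (CLINT \<omega>|M. iexp (t * (exp (- k * T) * (W (0 + T) \<omega> - W (s + T) \<omega>))))" for T
    using W_increments_char[of 1 "\<lambda>_. s" "\<lambda>_. 0" N T "\<lambda>_. t"] N s by (simp add: K_def lessThan_Suc)
  have "(\<lambda>m. exp (K m) ^ n) \<longlonglongrightarrow> (CLINT \<omega>|M. iexp (t * (W 0 \<omega> - W s \<omega>))) ^ n"
    using 1[of 0] by (intro tendsto_power) simp
  moreover have "(\<lambda>m. exp (K m) ^ n) \<longlonglongrightarrow> (CLINT \<omega>|M. iexp (t * (exp (- k * T) * (W T \<omega> - W (s + T) \<omega>))))"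
    using 1[of T] by (simp add: c exp_of_nat_mult[symmetric])
  ultimately show ?thesis by (rule LIMSEQ_unique[symmetric])
qed

text \<open>The geometric decay below only needs moments of order at most one, for which
  \<open>x \<mapsto> \<bar>x\<bar> powr g\<close> is subadditive, so that independence of the pieces plays no role.\<close>

lemma W_Cauchy_in_prob:
  assumes \<delta>: "\<delta> < 0" and g: "0 < g" "g \<le> 1" and kg: "- \<delta> < k * g"
    and K: "0 \<le> K" "\<And>s. s \<in> {ln 2 / \<delta>..0} \<Longrightarrow> (\<integral>\<^sup>+\<omega>. ennreal (\<bar>W 0 \<omega> - W s \<omega>\<bar> powr g) \<partial>M) \<le> ennreal K"
    and eps: "0 < \<epsilon>" and eta: "0 < \<eta>"
  shows "\<exists>b. \<forall>a\<le>b. prob {\<omega>\<in>space M. \<bar>W a \<omega> - W b \<omega>\<bar> > \<epsilon>} \<le> \<eta>"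
proof -
  let ?N = "\<lambda>X. \<integral>\<^sup>+\<omega>. ennreal (\<bar>X \<omega>\<bar> powr g) \<partial>M"
  \<comment> \<open>A shift by \<open>T1\<close> doubles the increments of the time change.\<close>
  define T1 where "T1 = ln 2 / \<delta>"
  have T1: "T1 < 0" using \<delta> by (simp add: T1_def divide_pos_neg)
  \<comment> \<open>The 2 counts the independent copies gained per step and
    \<open>exp (k * g * T1)\<close> is the effect of the weights; \<open>q < 1\<close> is equivalent
    to \<open>kg\<close>.\<close>
  define q where "q = 2 * exp (k * g * T1)"
  have q: "0 < q" "q < 1"
  proof -
    show "0 < q" by (simp add: q_def)
    have "k * g * T1 < - \<delta> * T1" using kg T1 by (rule mult_strict_right_mono_neg)
    then have "k * g * T1 < - ln 2" using \<delta> by (simp add: T1_def)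
    then have "exp (k * g * T1) < exp (- ln 2)" by simp
    then show "q < 1" by (simp add: q_def exp_minus)
  qed
  have decay: "?N (\<lambda>\<omega>. W (real n * T1) \<omega> - W (s + real n * T1) \<omega>) \<le> ennreal (K * q ^ n)" if s: "s \<in> {T1..0}" for s n
  proof -
    define T where "T = real n * T1"
    have c: "exp (\<delta> * T) = real (2 ^ n)" using \<delta> by (simp add: T_def T1_def exp_of_nat_mult)
    have "?N (\<lambda>\<omega>. exp (- k * T) * (W T \<omega> - W (s + T) \<omega>)) \<le> of_nat (2 ^ n) * ?N (\<lambda>\<omega>. W 0 \<omega> - W s \<omega>)"
      by (rule moment_le_if_char_power[OF _ _ W_eq_char_power[OF c] g]) (use s in auto)
    also have "\<dots> \<le> of_nat (2 ^ n) * ennreal K" using K(2)[of s] s by (intro mult_left_mono) (auto simp: T1_def)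
    finally have 1: "?N (\<lambda>\<omega>. exp (- k * T) * (W T \<omega> - W (s + T) \<omega>)) \<le> of_nat (2 ^ n) * ennreal K" .
    have "\<bar>x\<bar> powr g = exp (k * g * T) * \<bar>exp (- k * T) * x\<bar> powr g" for x
    proof -
      have "\<bar>exp (- k * T) * x\<bar> powr g = exp (- k * T * g) * \<bar>x\<bar> powr g" by (simp add: abs_mult powr_mult exp_powr_real)
      moreover have "exp (k * g * T) * exp (- k * T * g) = 1" by (simp add: exp_add[symmetric] algebra_simps)
      ultimately show ?thesis by (simp add: mult.assoc[symmetric])
    qed
    then have "?N (\<lambda>\<omega>. W T \<omega> - W (s + T) \<omega>) = (\<integral>\<^sup>+\<omega>. ennreal (exp (k * g * T)) * ennreal (\<bar>exp (- k * T) * (W T \<omega> - W (s + T) \<omega>)\<bar> powr g) \<partial>M)"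
      by (intro nn_integral_cong) (metis ennreal_mult' exp_ge_zero)
    also have "\<dots> = ennreal (exp (k * g * T)) * ?N (\<lambda>\<omega>. exp (- k * T) * (W T \<omega> - W (s + T) \<omega>))"
      by (rule nn_integral_cmult) measurable
    also have "\<dots> \<le> ennreal (exp (k * g * T)) * (of_nat (2 ^ n) * ennreal K)" by (intro mult_left_mono 1) auto
    also have "\<dots> = ennreal (exp (k * g * T) * (2 ^ n * K))" using K(1) by (simp add: ennreal_mult ennreal_power[symmetric] flip: ennreal_of_nat_eq_real_of_nat)
    also have "exp (k * g * T) * (2 ^ n * K) = K * q ^ n"
      by (simp add: q_def T_def power_mult_distrib exp_of_nat_mult[symmetric] mult_ac)
    finally show ?thesis by (simp add: T_def)
  qed
  have sub: "?N (\<lambda>\<omega>. A \<omega> + B \<omega>) \<le> ?N A + ?N B"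
    if [measurable]: "A \<in> borel_measurable M" "B \<in> borel_measurable M" for A B
  proof -
    have "\<bar>x + y\<bar> powr g \<le> \<bar>x\<bar> powr g + \<bar>y\<bar> powr g" for x y
      using abs_sum_powr_le[OF g, of "\<lambda>b. if b then x else y" "{True, False}"] by simp
    then have "?N (\<lambda>\<omega>. A \<omega> + B \<omega>) \<le> (\<integral>\<^sup>+\<omega>. ennreal (\<bar>A \<omega>\<bar> powr g) + ennreal (\<bar>B \<omega>\<bar> powr g) \<partial>M)"
      by (intro nn_integral_mono) (simp add: ennreal_plus[symmetric] ennreal_leI del: ennreal_plus)
    also have "\<dots> = ?N A + ?N B"
      by (rule nn_integral_add) measurable
    finally show ?thesis .
  qed
  \<comment> \<open>The geometric sum of \<open>K * q ^ i\<close> for \<open>i\<close> from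
    \<open>n\<close> to \<open>m\<close> in closed form.\<close>
  define B where "B n m = K * (q ^ n - q ^ Suc m) / (1 - q)" for n m
  have B0: "0 \<le> B n m" if "n \<le> m" for n m
    unfolding B_def using that q K(1) by (intro divide_nonneg_pos mult_nonneg_nonneg) (auto intro!: power_decreasing simp del: power_Suc)
  have claim: "?N (\<lambda>\<omega>. W (real n * T1) \<omega> - W (s + real m * T1) \<omega>) \<le> ennreal (B n m)" if "n \<le> m" "s \<in> {T1..0}" for n m s
    using that
  proof (induction m arbitrary: s rule: dec_induct)
    case base
    have "B n n = K * q ^ n" using q by (simp add: B_def field_simps)
    then show ?case using decay[OF base] by simp
  next
    case (step m)
    \<comment> \<open>The path is cut at \<open>(m + 1) * T1\<close>, written as
      \<open>T1 + m * T1\<close> so that the induction hypothesis applies with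
      \<open>s = T1\<close>.\<close>
    have e: "W (real n * T1) \<omega> - W (s + real (Suc m) * T1) \<omega> =
      (W (real n * T1) \<omega> - W (T1 + real m * T1) \<omega>) + (W (real (Suc m) * T1) \<omega> - W (s + real (Suc m) * T1) \<omega>)" for \<omega>
      by (simp add: algebra_simps)
    have "?N (\<lambda>\<omega>. W (real n * T1) \<omega> - W (s + real (Suc m) * T1) \<omega>) \<le>
      ?N (\<lambda>\<omega>. W (real n * T1) \<omega> - W (T1 + real m * T1) \<omega>) +
      ?N (\<lambda>\<omega>. W (real (Suc m) * T1) \<omega> - W (s + real (Suc m) * T1) \<omega>)"
      unfolding e by (rule sub) measurable
    also have "\<dots> \<le> ennreal (B n m) + ennreal (K * q ^ Suc m)"
      using T1 step.prems by (intro add_mono step.IH decay) auto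
    also have "\<dots> = ennreal (B n m + K * q ^ Suc m)"
      using B0[OF step.hyps(1)] K(1) q by (intro ennreal_plus[symmetric]) auto
    also have "B n m + K * q ^ Suc m = B n (Suc m)" using q by (simp add: B_def field_simps)
    finally show ?case .
  qed
  have BK: "B n m \<le> K * q ^ n / (1 - q)" for n m
    unfolding B_def using q K(1) by (intro divide_right_mono mult_left_mono) auto
  have tail: "prob {\<omega>\<in>space M. \<bar>W a \<omega> - W (real n * T1) \<omega>\<bar> > \<epsilon>} \<le> \<epsilon> powr - g * (K * q ^ n / (1 - q))" if a: "a \<le> real n * T1" for a n
  proof -
    \<comment> \<open>The number of whole steps \<open>T1\<close> that fit between 0 and
      \<open>a\<close>; since \<open>T1\<close> is negative, the remainder \<open>s\<close> lies in
      \<open>{T1..0}\<close>.\<close>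
    define m where "m = nat \<lfloor>a / T1\<rfloor>"
    define s where "s = a - real m * T1"
    have "real n \<le> a / T1" using a T1 by (simp add: neg_le_divide_eq)
    then have nm: "n \<le> m" and fl: "real m \<le> a / T1" "a / T1 < real m + 1" unfolding m_def by linarith+
    have "a \<le> real m * T1" "(real m + 1) * T1 < a" using fl T1 by (simp_all add: neg_le_divide_eq neg_divide_less_eq)
    then have s: "s \<in> {T1..0}" by (simp add: s_def algebra_simps)
    have as: "s + real m * T1 = a" by (simp add: s_def)
    have I: "?N (\<lambda>\<omega>. W a \<omega> - W (real n * T1) \<omega>) \<le> ennreal (K * q ^ n / (1 - q))"
      using order_trans[OF claim[OF nm s] ennreal_leI[OF BK]] unfolding as by (simp add: abs_minus_commute)
    have "emeasure M {\<omega>\<in>space M. \<bar>W a \<omega> - W (real n * T1) \<omega>\<bar> > \<epsilon>} \<le>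
        emeasure M {\<omega>\<in>space M. 1 \<le> ennreal (\<epsilon> powr - g) * ennreal (\<bar>W a \<omega> - W (real n * T1) \<omega>\<bar> powr g)}"
    proof (rule emeasure_mono)
      have "1 \<le> ennreal (\<epsilon> powr - g) * ennreal (x powr g)" if "\<epsilon> < x" for x
      proof -
        have "1 = \<epsilon> powr - g * \<epsilon> powr g" using eps by (simp add: powr_minus)
        also have "\<dots> \<le> \<epsilon> powr - g * x powr g" using that eps g by (intro mult_left_mono powr_mono2) auto
        finally show ?thesis by (simp add: ennreal_mult[symmetric])
      qed
      then show "{\<omega>\<in>space M. \<bar>W a \<omega> - W (real n * T1) \<omega>\<bar> > \<epsilon>} \<subseteq> {\<omega>\<in>space M. 1 \<le> ennreal (\<epsilon> powr - g) * ennreal (\<bar>W a \<omega> - W (real n * T1) \<omega>\<bar> powr g)}" by blast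
    qed measurable
    also have "\<dots> \<le> ennreal (\<epsilon> powr - g) * (\<integral>\<^sup>+\<omega>. ennreal (\<bar>W a \<omega> - W (real n * T1) \<omega>\<bar> powr g) * indicator (space M) \<omega> \<partial>M)"
      by (rule nn_integral_Markov_inequality) measurable
    also have "(\<integral>\<^sup>+\<omega>. ennreal (\<bar>W a \<omega> - W (real n * T1) \<omega>\<bar> powr g) * indicator (space M) \<omega> \<partial>M) = ?N (\<lambda>\<omega>. W a \<omega> - W (real n * T1) \<omega>)"
      by (intro nn_integral_cong) simp
    also have "ennreal (\<epsilon> powr - g) * \<dots> \<le> ennreal (\<epsilon> powr - g) * ennreal (K * q ^ n / (1 - q))" by (intro mult_left_mono I) auto
    also have "\<dots> = ennreal (\<epsilon> powr - g * (K * q ^ n / (1 - q)))" using K(1) q by (intro ennreal_mult[symmetric]) auto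
    finally show ?thesis using K(1) q by (simp add: emeasure_eq_measure)
  qed
  have "(\<lambda>n. \<epsilon> powr - g * (K * q ^ n / (1 - q))) \<longlonglongrightarrow> \<epsilon> powr - g * (K * 0 / (1 - q))"
    using q by (intro tendsto_intros LIMSEQ_realpow_zero) auto
  then have "eventually (\<lambda>n. \<epsilon> powr - g * (K * q ^ n / (1 - q)) < \<eta>) sequentially"
    using eta by (intro order_tendstoD(2)) auto
  then obtain n where n: "\<epsilon> powr - g * (K * q ^ n / (1 - q)) < \<eta>" by (auto simp: eventually_sequentially)
  have "prob {\<omega>\<in>space M. \<bar>W a \<omega> - W (real n * T1) \<omega>\<bar> > \<epsilon>} \<le> \<eta>" if "a \<le> real n * T1" for a
    using tail[OF that] n by linarith
  then show ?thesis by blast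
qed

end

section \<open>Translative stability\<close>

context levy_driven
begin

text \<open>Two limits are taken in turn. With the left end of the integrals truncated at
  \<open>- N\<close>, refining the grid gives multiplicativity in \<open>c\<close>; then
  \<open>N\<close> tends to infinity and the truncated integrals become \<open>V\<close>.\<close>

lemma char_multiplicative_of_limit:
  fixes t \<theta> :: "nat \<Rightarrow> real"
  assumes \<delta>: "\<delta> \<noteq> 0" and l: "AE \<omega> in M. ((\<lambda>a. W a \<omega>) \<longlongrightarrow> l \<omega>) at_bot"
    and V[measurable]: "\<And>t. V t \<in> borel_measurable M"
    and VW: "\<And>t. AE \<omega> in M. V t \<omega> = exp (- k * t) * (W t \<omega> - l \<omega>)"
    and c: "0 < c" "0 < c'"
  shows "(CLINT \<omega>|M. iexp (\<Sum>j<m. \<theta> j * V (t j + ln (c + c') / \<delta>) \<omega>)) =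
    (CLINT \<omega>|M. iexp (\<Sum>j<m. \<theta> j * V (t j + ln c / \<delta>) \<omega>)) * (CLINT \<omega>|M. iexp (\<Sum>j<m. \<theta> j * V (t j + ln c' / \<delta>) \<omega>))"
proof -
  define T where "T c = ln c / \<delta>" for c
  have T: "exp (\<delta> * T c) = c" if "c > 0" for c using \<delta> that by (simp add: T_def)
  define f where "f N c = (CLINT \<omega>|M. iexp (\<Sum>j<m. \<theta> j * exp (- k * t j) * (exp (- k * T c) * (W (t j + T c) \<omega> - W (- real N + T c) \<omega>))))" for N :: nat and c
  \<comment> \<open>Inserting 0 keeps the set nonempty when \<open>m = 0\<close>.\<close>
  obtain N0 :: nat where N0: "Max (insert 0 ((\<lambda>j. \<bar>t j\<bar>) ` {..<m})) \<le> real N0" using real_arch_simple by blast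
  have tN: "\<bar>t j\<bar> \<le> real N0" if "j < m" for j using that by (intro order_trans[OF _ N0] Max_ge) auto
  have mult: "f N (c + c') = f N c * f N c'" if N: "N0 \<le> N" for N
  proof -
    define K where "K n = log_char_sum N n (\<lambda>i. \<Sum>j<m. \<theta> j * exp (- k * t j) * cell_weight n (- real N) (t j) i)" for n
    have tN': "- real N \<le> t j" "t j \<le> real N" if "j < m" for j
      using tN[OF that] N by (auto simp: abs_le_iff)
    have lim: "(\<lambda>n. exp (of_real c * K n)) \<longlonglongrightarrow> f N c" if "c > 0" for c
      using W_increments_char[of m "\<lambda>_. - real N" t N "T c" "\<lambda>j. \<theta> j * exp (- k * t j)"] tN'
      unfolding T[OF that] by (simp add: K_def f_def)
    have "(\<lambda>n. exp (of_real c * K n) * exp (of_real c' * K n)) \<longlonglongrightarrow> f N c * f N c'"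
      using c by (intro tendsto_mult lim)
    moreover have "(\<lambda>n. exp (of_real c * K n) * exp (of_real c' * K n)) \<longlonglongrightarrow> f N (c + c')"
      using lim[of "c + c'"] c by (simp add: distrib_right exp_add)
    ultimately show ?thesis by (rule LIMSEQ_unique[symmetric])
  qed
  have lim: "(\<lambda>N. f N c) \<longlonglongrightarrow> (CLINT \<omega>|M. iexp (\<Sum>j<m. \<theta> j * V (t j + T c) \<omega>))" for c
    unfolding f_def
  proof (rule iexp_dominated_convergence)
    have "AE \<omega> in M. \<forall>j. V (t j + T c) \<omega> = exp (- k * (t j + T c)) * (W (t j + T c) \<omega> - l \<omega>)"
      by (subst AE_all_countable) (use VW in auto)
    then show "AE \<omega> in M. (\<lambda>N. \<Sum>j<m. \<theta> j * exp (- k * t j) * (exp (- k * T c) * (W (t j + T c) \<omega> - W (- real N + T c) \<omega>)))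
       \<longlonglongrightarrow> (\<Sum>j<m. \<theta> j * V (t j + T c) \<omega>)"
      using l
    proof eventually_elim
      case (elim \<omega>)
      have "filterlim (\<lambda>N. real N - T c) at_top sequentially"
        by (intro filterlim_tendsto_add_at_top[OF tendsto_const filterlim_real_sequentially, of "- T c", simplified])
      then have "filterlim (\<lambda>N. - real N + T c) at_bot sequentially"
        by (simp add: filterlim_uminus_at_top)
      then have W: "(\<lambda>N. W (- real N + T c) \<omega>) \<longlonglongrightarrow> l \<omega>" by (rule filterlim_compose[OF elim(2)])
      have "\<theta> j * V (t j + T c) \<omega> = \<theta> j * exp (- k * t j) * (exp (- k * T c) * (W (t j + T c) \<omega> - l \<omega>))" for j
      proof -
        have "exp (- k * (t j + T c)) = exp (- k * t j) * exp (- k * T c)" by (simp add: distrib_left exp_add[symmetric])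
        then show ?thesis by (simp only: elim(1)[rule_format] mult.assoc)
      qed
      then show ?case by (simp only:) (intro tendsto_intros W)
    qed
  qed measurable
  have "(\<lambda>N. f N c * f N c') \<longlonglongrightarrow> (CLINT \<omega>|M. iexp (\<Sum>j<m. \<theta> j * V (t j + T (c + c')) \<omega>))"
    by (rule Lim_transform_eventually[OF lim]) (use mult in \<open>auto simp: eventually_sequentially\<close>)
  moreover have "(\<lambda>N. f N c * f N c') \<longlonglongrightarrow> (CLINT \<omega>|M. iexp (\<Sum>j<m. \<theta> j * V (t j + T c) \<omega>)) * (CLINT \<omega>|M. iexp (\<Sum>j<m. \<theta> j * V (t j + T c') \<omega>))"
    by (intro tendsto_mult lim)
  ultimately show ?thesis unfolding T_def by (rule LIMSEQ_unique)
qed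

text \<open>As \<open>c\<close> decreases to 0 the shift \<open>ln c / \<delta>\<close> moves to the
  end \<open>F\<close> of the time axis, where \<open>V\<close> vanishes. Passing to sequences
  leaves only countably many null sets from \<open>VW\<close> to discard.\<close>

lemma char_tendsto_1_of_tail:
  fixes t \<theta> :: "nat \<Rightarrow> real"
  assumes V[measurable]: "\<And>t. V t \<in> borel_measurable M"
    and VW: "\<And>t. AE \<omega> in M. V t \<omega> = exp (- k * t) * (W t \<omega> - l \<omega>)"
    and tail: "AE \<omega> in M. ((\<lambda>t. exp (- k * t) * (W t \<omega> - l \<omega>)) \<longlongrightarrow> 0) F"
    and F: "\<And>t. filterlim (\<lambda>c. t + ln c / \<delta>) F (at_right 0)"
  shows "((\<lambda>c. CLINT \<omega>|M. iexp (\<Sum>j<m. \<theta> j * V (t j + ln c / \<delta>) \<omega>)) \<longlongrightarrow> 1) (at_right 0)"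
  unfolding tendsto_at_iff_sequentially
proof (intro allI impI)
  fix s :: "nat \<Rightarrow> real" assume s: "\<forall>i. s i \<in> {0<..} - {0}" "s \<longlonglongrightarrow> 0"
  have s': "filterlim s (at_right 0) sequentially"
  proof -
    have "s i \<in> {0<..} \<and> s i \<noteq> 0" for i using s(1)[rule_format, of i] by simp
    then show ?thesis using s(2) by (simp add: filterlim_at)
  qed
  have "(\<lambda>n. CLINT \<omega>|M. iexp (\<Sum>j<m. \<theta> j * V (t j + ln (s n) / \<delta>) \<omega>)) \<longlonglongrightarrow> (CLINT \<omega>|M. iexp (\<Sum>j<m. \<theta> j * 0))"
  proof (rule iexp_dominated_convergence)
    have "AE \<omega> in M. \<forall>n j. V (t j + ln (s n) / \<delta>) \<omega> = exp (- k * (t j + ln (s n) / \<delta>)) * (W (t j + ln (s n) / \<delta>) \<omega> - l \<omega>)"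
      by (subst AE_all_countable, rule allI, subst AE_all_countable) (use VW in auto)
    then show "AE \<omega> in M. (\<lambda>n. \<Sum>j<m. \<theta> j * V (t j + ln (s n) / \<delta>) \<omega>) \<longlonglongrightarrow> (\<Sum>j<m. \<theta> j * 0)"
      using tail
    proof eventually_elim
      case (elim \<omega>)
      have "(\<lambda>n. V (t j + ln (s n) / \<delta>) \<omega>) \<longlonglongrightarrow> 0" for j
        using filterlim_compose[OF elim(2) filterlim_compose[OF F s']] elim(1) by simp
      then show ?case by (intro tendsto_intros)
    qed
  qed measurable
  then show "((\<lambda>c. CLINT \<omega>|M. iexp (\<Sum>j<m. \<theta> j * V (t j + ln c / \<delta>) \<omega>)) \<circ> s) \<longlonglongrightarrow> 1"
    by (simp add: o_def prob_space)
qed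

lemma translative_exponent:
  fixes t :: "nat \<Rightarrow> real" and m :: nat
  assumes \<delta>: "\<delta> \<noteq> 0" and l: "AE \<omega> in M. ((\<lambda>a. W a \<omega>) \<longlongrightarrow> l \<omega>) at_bot"
    and V[measurable]: "\<And>t. V t \<in> borel_measurable M"
    and VW: "\<And>t. AE \<omega> in M. V t \<omega> = exp (- k * t) * (W t \<omega> - l \<omega>)"
    and tail: "AE \<omega> in M. ((\<lambda>t. exp (- k * t) * (W t \<omega> - l \<omega>)) \<longlongrightarrow> 0) F"
    and F: "\<And>t. filterlim (\<lambda>c. t + ln c / \<delta>) F (at_right 0)"
  shows "\<exists>\<Psi>. (\<forall>T \<theta>. (CLINT \<omega>|M. iexp (\<Sum>j<m. \<theta> j * V (t j + T) \<omega>)) = exp (of_real (exp (\<delta> * T)) * \<Psi> \<theta>)) \<and>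
      (\<forall>\<theta> \<eta>. (\<forall>j<m. (\<lambda>n. \<eta> n j) \<longlonglongrightarrow> \<theta> j) \<longrightarrow> (\<lambda>n. \<Psi> (\<eta> n)) \<longlonglongrightarrow> \<Psi> \<theta>) \<and> (\<forall>\<theta>. (\<forall>j<m. \<theta> j = 0) \<longrightarrow> \<Psi> \<theta> = 0)"
proof (rule char_semigroup_exponent[of m "\<lambda>c j. V (t j + ln c / \<delta>)"], goal_cases)
  case 1
  show ?case by (rule V)
next
  case 2
  show ?case by (rule char_multiplicative_of_limit[OF \<delta> l V VW 2])
next
  case 3
  show ?case by (rule char_tendsto_1_of_tail[OF V VW tail F])
next
  case (4 \<Psi>)
  have "ln (exp (\<delta> * T)) / \<delta> = T" for T using \<delta> by simp
  then show ?case using 4(1)[of "exp (\<delta> * T)" for T] 4(2,3) by (intro exI[of _ \<Psi>] conjI allI impI) (simp_all only: exp_gt_zero)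
qed

theorem translatively_stableI:
  assumes \<delta>: "\<delta> \<noteq> 0" and l: "AE \<omega> in M. ((\<lambda>a. W a \<omega>) \<longlongrightarrow> l \<omega>) at_bot"
    and V[measurable]: "\<And>t. V t \<in> borel_measurable M"
    and VW: "\<And>t. AE \<omega> in M. V t \<omega> = exp (- k * t) * (W t \<omega> - l \<omega>)"
    and tail: "AE \<omega> in M. ((\<lambda>t. exp (- k * t) * (W t \<omega> - l \<omega>)) \<longlongrightarrow> 0) F"
    and F: "\<And>t. filterlim (\<lambda>c. t + ln c / \<delta>) F (at_right 0)"
  shows "translatively_stable M \<delta> V"
proof -
  note main = translative_exponent[OF \<delta> l V VW tail F]
  have "infinitely_divisible m (distr M (PiM {..<m} (\<lambda>_. borel)) (\<lambda>\<omega>. \<lambda>j\<in>{..<m}. V (t j) \<omega>))" for m t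
    unfolding infinitely_divisible_def
  proof (intro allI impI)
    fix n :: nat assume n: "1 \<le> n"
    obtain \<Psi> where \<Psi>: "\<And>T \<theta>. (CLINT \<omega>|M. iexp (\<Sum>j<m. \<theta> j * V (t j + T) \<omega>)) = exp (of_real (exp (\<delta> * T)) * \<Psi> \<theta>)"
      using main[of t m] by blast
    \<comment> \<open>The shift that scales the exponent by \<open>1 / n\<close>; the law of the
      shifted vector is the \<open>n\<close>-th convolution root that infinite divisibility asks
      for.\<close>
    define T where "T = ln (1 / real n) / \<delta>"
    have T: "exp (\<delta> * T) = 1 / real n" using \<delta> n by (simp add: T_def)
    have R: "(\<lambda>\<omega>. \<lambda>j\<in>{..<m}. V (t j + T) \<omega>) \<in> measurable M (PiM {..<m} (\<lambda>_. borel))" by measurable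
    define \<nu> where "\<nu> = distr M (PiM {..<m} (\<lambda>_. borel)) (\<lambda>\<omega>. \<lambda>j\<in>{..<m}. V (t j + T) \<omega>)"
    interpret N: prob_space \<nu> unfolding \<nu>_def by (rule prob_space_distr[OF R])
    interpret PP: product_prob_space "\<lambda>_. \<nu>" "{..<n}" ..
    have s\<nu>: "sets \<nu> = sets (PiM {..<m} (\<lambda>_. borel))" by (simp add: \<nu>_def)
    have comp: "(\<lambda>y. y j) \<in> borel_measurable \<nu>" if "j < m" for j
      using that unfolding measurable_cong_sets[OF s\<nu> refl] by (intro measurable_component_singleton) auto
    have "distr M (PiM {..<m} (\<lambda>_. borel)) (\<lambda>\<omega>. \<lambda>j\<in>{..<m}. V (t j) \<omega>) =
       distr (PiM {..<n} (\<lambda>_. \<nu>)) (PiM {..<m} (\<lambda>_. borel)) (\<lambda>x. \<lambda>j\<in>{..<m}. \<Sum>i<n. x i j)"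
    proof (rule multivariate_char_unique)
      show "prob_space (PiM {..<n} (\<lambda>_. \<nu>))" by (rule PP.prob_space_axioms)
      show "(\<lambda>x. \<Sum>i<n. x i j) \<in> borel_measurable (PiM {..<n} (\<lambda>_. \<nu>))" if "j < m" for j
      proof (intro borel_measurable_sum)
        fix i assume "i \<in> {..<n}"
        then have "(\<lambda>x. x i) \<in> measurable (PiM {..<n} (\<lambda>_. \<nu>)) \<nu>" by (rule measurable_component_singleton)
        from measurable_compose[OF this comp[OF that]] show "(\<lambda>x. x i j) \<in> borel_measurable (PiM {..<n} (\<lambda>_. \<nu>))" .
      qed
      fix \<theta> :: "nat \<Rightarrow> real"
      have f: "(\<lambda>y. \<Sum>j<m. \<theta> j * y j) \<in> borel_measurable \<nu>"
        by (intro borel_measurable_sum borel_measurable_times borel_measurable_const comp) auto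
      have "(\<Sum>j<m. \<theta> j * (\<Sum>i<n. x i j)) = (\<Sum>i<n. \<Sum>j<m. \<theta> j * x i j)" for x :: "nat \<Rightarrow> nat \<Rightarrow> real"
        unfolding sum_distrib_left by (rule sum.swap)
      then have "(CLINT x|PiM {..<n} (\<lambda>_. \<nu>). iexp (\<Sum>j<m. \<theta> j * (\<Sum>i<n. x i j))) = (CLINT y|\<nu>. iexp (\<Sum>j<m. \<theta> j * y j)) ^ n"
        using integral_PiM_iexp_sum[OF N.prob_space_axioms f, of n] by simp
      also have "(CLINT y|\<nu>. iexp (\<Sum>j<m. \<theta> j * y j)) = (CLINT \<omega>|M. iexp (\<Sum>j<m. \<theta> j * V (t j + T) \<omega>))"
      proof -
        have g: "(\<lambda>y. iexp (\<Sum>j<m. \<theta> j * y j)) \<in> borel_measurable (PiM {..<m} (\<lambda>_. borel))"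
          using f unfolding measurable_cong_sets[OF s\<nu> refl] by measurable
        show ?thesis unfolding \<nu>_def by (subst integral_distr[OF R g]) simp
      qed
      also have "\<dots> ^ n = exp (\<Psi> \<theta>)"
        unfolding \<Psi> T using n by (simp add: exp_of_nat_mult[symmetric])
      also have "\<dots> = (CLINT \<omega>|M. iexp (\<Sum>j<m. \<theta> j * V (t j) \<omega>))" using \<Psi>[of \<theta> 0] by simp
      finally show "(CLINT \<omega>|M. iexp (\<Sum>j<m. \<theta> j * V (t j) \<omega>)) = (CLINT x|PiM {..<n} (\<lambda>_. \<nu>). iexp (\<Sum>j<m. \<theta> j * (\<Sum>i<n. x i j)))" by (rule sym)
    qed (use prob_space_axioms in auto)
    then show "\<exists>\<nu>. prob_space \<nu> \<and> sets \<nu> = sets (PiM {..<m} (\<lambda>_. borel)) \<and>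
        distr M (PiM {..<m} (\<lambda>_. borel)) (\<lambda>\<omega>. \<lambda>j\<in>{..<m}. V (t j) \<omega>) = distr (PiM {..<n} (\<lambda>_. \<nu>)) (PiM {..<m} (\<lambda>_. borel)) (\<lambda>x. \<lambda>j\<in>{..<m}. \<Sum>i<n. x i j)"
      using N.prob_space_axioms s\<nu> by blast
  qed
  moreover have "log_char M m (\<lambda>j. V (t j + T)) \<theta> = of_real (exp (\<delta> * T)) * log_char M m (\<lambda>j. V (t j)) \<theta>"
    if \<theta>: "\<theta> \<in> {..<m} \<rightarrow>\<^sub>E UNIV" for T m t \<theta>
  proof -
    obtain \<Psi> where \<Psi>: "\<And>T \<theta>. (CLINT \<omega>|M. iexp (\<Sum>j<m. \<theta> j * V (t j + T) \<omega>)) = exp (of_real (exp (\<delta> * T)) * \<Psi> \<theta>)"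
      and cont: "\<And>\<theta> \<eta>. (\<And>j. j < m \<Longrightarrow> (\<lambda>n. \<eta> n j) \<longlonglongrightarrow> \<theta> j) \<Longrightarrow> (\<lambda>n. \<Psi> (\<eta> n)) \<longlonglongrightarrow> \<Psi> \<theta>"
      and zero: "\<And>\<theta>. (\<And>j. j < m \<Longrightarrow> \<theta> j = 0) \<Longrightarrow> \<Psi> \<theta> = 0"
      using main[of t m] by blast
    have "log_char M m (\<lambda>j. V (t j + T)) \<theta> = of_real (exp (\<delta> * T)) * \<Psi> \<theta>" for T
      by (rule log_char_eqI[where \<Psi>="\<lambda>\<theta>. of_real (exp (\<delta> * T)) * \<Psi> \<theta>", OF \<Psi> _ _ \<theta>]) (auto intro!: tendsto_intros cont simp: zero)
    from this[of T] this[of 0] show ?thesis by simp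
  qed
  ultimately show ?thesis
    unfolding translatively_stable_def infinitely_divisible_process_def process_on_def using V by blast
qed

lemma AE_W_0: "AE \<omega> in M. W 0 \<omega> = 0"
  using W_eq_exp_primitive by eventually_elim simp

lemma wide_sense_OU_iff:
  "wide_sense_OU M (- k) Y V \<longleftrightarrow> additive_process M Y \<and> (\<forall>t. V t \<in> borel_measurable M) \<and>
     (\<forall>t. AE \<omega> in M. V t \<omega> = exp (- k * t) * (V 0 \<omega> + W t \<omega>))"
proof -
  have "(AE \<omega> in M. V t \<omega> = exp (- k * t) * (V 0 \<omega> + cadlag_integral (\<lambda>s. exp (- (- k) * s)) (\<lambda>s. Y s \<omega>) 0 t)) \<longleftrightarrow>
    (AE \<omega> in M. V t \<omega> = exp (- k * t) * (V 0 \<omega> + W t \<omega>))" for t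
  proof -
    have "AE \<omega> in M. (V t \<omega> = exp (- k * t) * (V 0 \<omega> + cadlag_integral (\<lambda>s. exp (- (- k) * s)) (\<lambda>s. Y s \<omega>) 0 t)) \<longleftrightarrow>
       (V t \<omega> = exp (- k * t) * (V 0 \<omega> + W t \<omega>))"
      using cadlag_integral_W AE_W_0 by eventually_elim simp
    note * = this
    show ?thesis
    proof
      assume "AE \<omega> in M. V t \<omega> = exp (- k * t) * (V 0 \<omega> + cadlag_integral (\<lambda>s. exp (- (- k) * s)) (\<lambda>s. Y s \<omega>) 0 t)"
      with * show "AE \<omega> in M. V t \<omega> = exp (- k * t) * (V 0 \<omega> + W t \<omega>)" by eventually_elim blast
    next
      assume "AE \<omega> in M. V t \<omega> = exp (- k * t) * (V 0 \<omega> + W t \<omega>)"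
      with * show "AE \<omega> in M. V t \<omega> = exp (- k * t) * (V 0 \<omega> + cadlag_integral (\<lambda>s. exp (- (- k) * s)) (\<lambda>s. Y s \<omega>) 0 t)"
        by eventually_elim blast
    qed
  qed
  then show ?thesis by (simp add: wide_sense_OU_def process_on_def)
qed

lemma left_improper_integral_of_OU:
  assumes OU: "wide_sense_OU M (- k) Y V"
    and lim: "tendsto_in_prob M (\<lambda>t \<omega>. exp (k * t) * V t \<omega>) (\<lambda>_. 0) at_bot"
  shows "has_left_improper_integral M (\<lambda>u. exp ((u - t) * k)) Y t (V t)"
proof -
  have V[measurable]: "V t \<in> borel_measurable M" and VW: "AE \<omega> in M. V t \<omega> = exp (- k * t) * (V 0 \<omega> + W t \<omega>)" for t
    using OU by (auto simp: wide_sense_OU_iff)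
  have prob_eq: "prob {\<omega>\<in>space M. \<epsilon> < \<bar>exp (k * t) * V t \<omega> - 0\<bar>} = prob {\<omega>\<in>space M. \<epsilon> < \<bar>W t \<omega> - - V 0 \<omega>\<bar>}" for t \<epsilon>
  proof (rule finite_measure_eq_AE)
    show "AE \<omega> in M. (\<omega> \<in> {\<omega>\<in>space M. \<epsilon> < \<bar>exp (k * t) * V t \<omega> - 0\<bar>}) = (\<omega> \<in> {\<omega>\<in>space M. \<epsilon> < \<bar>W t \<omega> - - V 0 \<omega>\<bar>})"
      using VW[of t]
    proof eventually_elim
      case (elim \<omega>)
      have "exp (k * t) * V t \<omega> = W t \<omega> - - V 0 \<omega>" unfolding elim by (simp add: mult.assoc[symmetric] exp_add[symmetric])
      then show ?case by simp
    qed
  qed measurable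
  have W: "tendsto_in_prob M W (\<lambda>\<omega>. - V 0 \<omega>) at_bot"
    using lim unfolding tendsto_in_prob_def prob_eq .
  have "AE \<omega> in M. \<exists>l. ((\<lambda>t. W t \<omega>) \<longlongrightarrow> l) at_bot"
  proof (rule AE_convergent_at_bot_if_Cauchy_in_prob[OF W_measurable W_right_continuous W_independent_increments])
    fix \<epsilon> \<eta> :: real assume e: "0 < \<epsilon>" "0 < \<eta>"
    then have "((\<lambda>t. prob {\<omega>\<in>space M. \<epsilon> / 2 < \<bar>W t \<omega> - - V 0 \<omega>\<bar>}) \<longlongrightarrow> 0) at_bot"
      using W[unfolded tendsto_in_prob_def, rule_format, of "\<epsilon> / 2"] by simp
    from order_tendstoD(2)[OF this half_gt_zero[OF e(2)]]
    obtain b where b: "\<And>a. a \<le> b \<Longrightarrow> prob {\<omega>\<in>space M. \<epsilon> / 2 < \<bar>W a \<omega> - - V 0 \<omega>\<bar>} < \<eta> / 2"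
      unfolding eventually_at_bot_linorder by blast
    have "prob {\<omega>\<in>space M. \<bar>W a \<omega> - W b \<omega>\<bar> > \<epsilon>} \<le> \<eta>" if a: "a \<le> b" for a
    proof -
      have "prob {\<omega>\<in>space M. \<bar>W a \<omega> - W b \<omega>\<bar> > \<epsilon>} \<le> prob ({\<omega>\<in>space M. \<epsilon> / 2 < \<bar>W a \<omega> - - V 0 \<omega>\<bar>} \<union> {\<omega>\<in>space M. \<epsilon> / 2 < \<bar>W b \<omega> - - V 0 \<omega>\<bar>})"
      proof (rule finite_measure_mono)
        have "\<epsilon> / 2 < \<bar>W a \<omega> - - V 0 \<omega>\<bar> \<or> \<epsilon> / 2 < \<bar>W b \<omega> - - V 0 \<omega>\<bar>" if "\<bar>W a \<omega> - W b \<omega>\<bar> > \<epsilon>" for \<omega>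
          using that by linarith
        then show "{\<omega>\<in>space M. \<bar>W a \<omega> - W b \<omega>\<bar> > \<epsilon>} \<subseteq> {\<omega>\<in>space M. \<epsilon> / 2 < \<bar>W a \<omega> - - V 0 \<omega>\<bar>} \<union> {\<omega>\<in>space M. \<epsilon> / 2 < \<bar>W b \<omega> - - V 0 \<omega>\<bar>}"
          by blast
      qed measurable
      also have "\<dots> \<le> prob {\<omega>\<in>space M. \<epsilon> / 2 < \<bar>W a \<omega> - - V 0 \<omega>\<bar>} + prob {\<omega>\<in>space M. \<epsilon> / 2 < \<bar>W b \<omega> - - V 0 \<omega>\<bar>}"
        by (rule measure_Un_le) measurable
      also have "\<dots> \<le> \<eta>" using b[OF a] b[of b] by linarith
      finally show ?thesis .
    qed
    then show "\<exists>b. \<forall>a\<le>b. prob {\<omega>\<in>space M. \<bar>W a \<omega> - W b \<omega>\<bar> > \<epsilon>} \<le> \<eta>" by blast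
  qed
  then obtain l where l[measurable]: "l \<in> borel_measurable M" and Wl: "AE \<omega> in M. ((\<lambda>a. W a \<omega>) \<longlongrightarrow> l \<omega>) at_bot"
    by (rule W_limit_exists)
  have fl: "filterlim (\<lambda>n. - real n) at_bot sequentially"
    by (simp add: filterlim_uminus_at_top[symmetric] filterlim_real_sequentially)
  \<comment> \<open>The hypothesis says that \<open>W\<close> tends to \<open>- V 0\<close> in
    probability, which identifies the almost sure limit and turns the OU equation into the integral
    representation.\<close>
  have "AE \<omega> in M. l \<omega> = - V 0 \<omega>"
  proof (rule AE_limit_eq_limit_in_prob[of "\<lambda>n. W (- real n)"])
    show "AE \<omega> in M. (\<lambda>n. W (- real n) \<omega>) \<longlonglongrightarrow> l \<omega>" using Wl by eventually_elim (rule filterlim_compose[OF _ fl])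
    show "tendsto_in_prob M (\<lambda>n. W (- real n)) (\<lambda>\<omega>. - V 0 \<omega>) sequentially" by (rule tendsto_in_prob_compose[OF W fl])
  qed measurable
  with VW[of t] have "AE \<omega> in M. V t \<omega> = exp (- k * t) * (W t \<omega> - l \<omega>)" by eventually_elim (simp add: add.commute)
  then show ?thesis using has_left_improper_integral_iff[OF l Wl] V by blast
qed

lemma OU_of_left_improper_integral:
  assumes Y: "additive_process M Y" and \<delta>: "\<delta> \<noteq> 0"
    and conv: "AE \<omega> in M. \<exists>l. ((\<lambda>t. W t \<omega>) \<longlongrightarrow> l) at_bot"
    and tail: "AE \<omega> in M. \<forall>l. ((\<lambda>t. W t \<omega>) \<longlongrightarrow> l) at_bot \<longrightarrow> ((\<lambda>t. exp (- k * t) * (W t \<omega> - l)) \<longlongrightarrow> 0) F"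
    and F: "\<And>t. filterlim (\<lambda>c. t + ln c / \<delta>) F (at_right 0)"
  shows "(\<forall>t. \<exists>Z. has_left_improper_integral M (\<lambda>u. exp ((u - t) * k)) Y t Z) \<and>
    (\<forall>V. (\<forall>t. has_left_improper_integral M (\<lambda>u. exp ((u - t) * k)) Y t (V t)) \<longrightarrow>
      translatively_stable M \<delta> V \<and> wide_sense_OU M (- k) Y V)"
proof -
  obtain l where l[measurable]: "l \<in> borel_measurable M" and Wl: "AE \<omega> in M. ((\<lambda>a. W a \<omega>) \<longlongrightarrow> l \<omega>) at_bot"
    using conv by (rule W_limit_exists)
  note iff = has_left_improper_integral_iff[OF l Wl]
  show ?thesis
  proof (intro conjI allI impI)
    fix t
    have "has_left_improper_integral M (\<lambda>u. exp ((u - t) * k)) Y t (\<lambda>\<omega>. exp (- k * t) * (W t \<omega> - l \<omega>))"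
      unfolding iff by (intro conjI AE_I2 refl) measurable
    then show "\<exists>Z. has_left_improper_integral M (\<lambda>u. exp ((u - t) * k)) Y t Z" by blast
  next
    fix V assume "\<forall>t. has_left_improper_integral M (\<lambda>u. exp ((u - t) * k)) Y t (V t)"
    then have V: "V t \<in> borel_measurable M" and VW: "AE \<omega> in M. V t \<omega> = exp (- k * t) * (W t \<omega> - l \<omega>)" for t
      unfolding iff by auto
    have "AE \<omega> in M. ((\<lambda>t. exp (- k * t) * (W t \<omega> - l \<omega>)) \<longlongrightarrow> 0) F"
      using tail Wl by eventually_elim blast
    then show "translatively_stable M \<delta> V" by (rule translatively_stableI[OF \<delta> Wl V VW _ F])
    have "AE \<omega> in M. V t \<omega> = exp (- k * t) * (V 0 \<omega> + W t \<omega>)" for t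
      using VW[of t] VW[of 0] AE_W_0 by eventually_elim simp
    then show "wide_sense_OU M (- k) Y V" unfolding wide_sense_OU_iff using Y V by blast
  qed
qed

end

section \<open>Endpoints of the time change and the final assembly\<close>

lemma time_changed_converges_at_bot:
  assumes L: "cadlag_on UNIV L" and \<delta>: "0 < \<delta>"
  shows "\<exists>z. ((\<lambda>t. L (time_change \<delta> t)) \<longlongrightarrow> z) at_bot"
proof -
  have "filterlim (\<lambda>t. \<delta> * t) at_bot at_bot"
    by (rule filterlim_tendsto_pos_mult_at_bot[OF tendsto_const \<delta> filterlim_ident])
  then have "((\<lambda>t. exp (\<delta> * t)) \<longlongrightarrow> 0) at_bot" by (rule filterlim_compose[OF exp_at_bot])
  then have "((\<lambda>t. (exp (\<delta> * t) - 1) / (exp \<delta> - 1)) \<longlongrightarrow> (0 - 1) / (exp \<delta> - 1)) at_bot"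
    using \<delta> by (intro tendsto_intros) auto
  moreover have "(0 - 1) / (exp \<delta> - 1) < (exp (\<delta> * t) - 1) / (exp \<delta> - 1)" for t
    using \<delta> by (intro divide_strict_right_mono) auto
  \<comment> \<open>The time change decreases to a finite time that it never attains, so the right
    limit of \<open>L\<close> there is the limit of the path.\<close>
  ultimately have "filterlim (time_change \<delta>) (at_right ((0 - 1) / (exp \<delta> - 1))) at_bot"
    using \<delta> by (simp add: filterlim_at time_change_def[abs_def] always_eventually less_imp_neq[symmetric] less_imp_neq)
  moreover obtain z where "(L \<longlongrightarrow> z) (at_right ((0 - 1) / (exp \<delta> - 1)))"
    using L unfolding cadlag_on_UNIV_iff by blast
  ultimately have "((\<lambda>t. L (time_change \<delta> t)) \<longlongrightarrow> z) at_bot" by (rule filterlim_compose[rotated])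
  then show ?thesis ..
qed

lemma time_changed_converges_at_top:
  assumes L: "cadlag_on UNIV L" and \<delta>: "\<delta> < 0"
  shows "\<exists>z. ((\<lambda>t. L (time_change \<delta> t)) \<longlongrightarrow> z) at_top"
proof -
  have "filterlim (\<lambda>t. \<delta> * t) at_bot at_top"
    by (rule filterlim_tendsto_neg_mult_at_bot[OF tendsto_const \<delta> filterlim_ident])
  then have "((\<lambda>t. exp (\<delta> * t)) \<longlongrightarrow> 0) at_top" by (rule filterlim_compose[OF exp_at_bot])
  then have "((\<lambda>t. (exp (\<delta> * t) - 1) / (exp \<delta> - 1)) \<longlongrightarrow> (0 - 1) / (exp \<delta> - 1)) at_top"
    using \<delta> by (intro tendsto_intros) auto
  moreover have "(exp (\<delta> * t) - 1) / (exp \<delta> - 1) < (0 - 1) / (exp \<delta> - 1)" for t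
    using \<delta> by (intro divide_strict_right_mono_neg) auto
  \<comment> \<open>For negative \<delta> the same finite time is approached from below, and the
    left limit of \<open>L\<close> takes over.\<close>
  ultimately have "filterlim (time_change \<delta>) (at_left ((0 - 1) / (exp \<delta> - 1))) at_top"
    using \<delta> by (simp add: filterlim_at time_change_def[abs_def] always_eventually less_imp_neq[symmetric] less_imp_neq)
  moreover obtain z where "(L \<longlongrightarrow> z) (at_left ((0 - 1) / (exp \<delta> - 1)))"
    using L unfolding cadlag_on_UNIV_iff by blast
  ultimately have "((\<lambda>t. L (time_change \<delta> t)) \<longlongrightarrow> z) at_top" by (rule filterlim_compose[rotated])
  then show ?thesis ..
qed

theorem corollary3p7:
  fixes M :: "'a measure" and L :: "real \<Rightarrow> 'a \<Rightarrow> real" and \<alpha> \<delta> :: real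
  assumes "prob_space M"
    and "two_sided_levy_process M L"
  shows
    "(\<forall>V. translatively_stable M \<delta> V \<and>
          wide_sense_OU M (\<delta> / 2 - \<alpha>) (time_changed \<delta> L) V \<and>
          tendsto_in_prob M (\<lambda>t \<omega>. exp ((\<alpha> - \<delta> / 2) * t) * V t \<omega>) (\<lambda>_. 0) at_bot
        \<longrightarrow> (\<forall>t. has_left_improper_integral M
                (\<lambda>u. exp ((u - t) * (\<alpha> - \<delta> / 2))) (time_changed \<delta> L) t (V t)))
     \<and>
     (\<delta> \<noteq> 0 \<and>
      ((\<delta> > 0 \<and> \<alpha> > \<delta> / 2) \<or>
       (\<delta> < 0 \<and> \<alpha> > - \<delta> / 2 \<and>
        (\<exists>\<gamma> > - \<delta> / (\<alpha> + \<delta> / 2).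
          (SUP s\<in>{1 / \<delta> * ln 2..0}.
            \<integral>\<^sup>+\<omega>. ennreal (\<bar>cadlag_integral (\<lambda>t. exp (t * (\<alpha> - \<delta> / 2)))
                       (\<lambda>t. time_changed \<delta> L t \<omega>) s 0\<bar> powr \<gamma>) \<partial>M) < \<infinity>)))
      \<longrightarrow>
        (\<forall>t. \<exists>Z. has_left_improper_integral M
              (\<lambda>u. exp ((u - t) * (\<alpha> - \<delta> / 2))) (time_changed \<delta> L) t Z) \<and>
        (\<forall>V. (\<forall>t. has_left_improper_integral M
                (\<lambda>u. exp ((u - t) * (\<alpha> - \<delta> / 2))) (time_changed \<delta> L) t (V t))
          \<longrightarrow> translatively_stable M \<delta> V \<and>
              wide_sense_OU M (\<delta> / 2 - \<alpha>) (time_changed \<delta> L) V))"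
proof -
  interpret prob_space M by fact
  define k where "k = \<alpha> - \<delta> / 2"
  define Y where "Y = time_changed \<delta> L"
  obtain \<psi> :: "real \<Rightarrow> complex" where L: "AE \<omega> in M. cadlag_on UNIV (\<lambda>t. L t \<omega>)" and \<psi>0: "\<psi> 0 = 0"
    and L_char: "\<And>n r w. (\<And>i. i < n \<Longrightarrow> r i \<le> r (Suc i)) \<Longrightarrow>
       (CLINT \<omega>|M. iexp (\<Sum>i<n. w i * (L (r (Suc i)) \<omega> - L (r i) \<omega>))) = exp (\<Sum>i<n. of_real (r (Suc i) - r i) * \<psi> (w i))"
    by (rule two_sided_levy_processE[OF assms]) blast
  have Y: "additive_process M Y"
    unfolding Y_def by (rule additive_process_time_changed[OF additive_process_two_sided_levy[OF assms]])
  interpret levy_driven M Y \<delta> k \<psi>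
  proof
    fix n :: nat and r w :: "nat \<Rightarrow> real" assume "\<And>i. i < n \<Longrightarrow> r i \<le> r (Suc i)"
    then show "(CLINT \<omega>|M. iexp (\<Sum>i<n. w i * (Y (r (Suc i)) \<omega> - Y (r i) \<omega>))) =
       exp (\<Sum>i<n. of_real (time_change \<delta> (r (Suc i)) - time_change \<delta> (r i)) * \<psi> (w i))"
      unfolding Y_def time_changed_def
      by (intro L_char) (simp add: strict_mono_less_eq[OF strict_mono_time_change])
  qed (use Y \<psi>0 in \<open>auto simp: additive_process_on_def process_on_def\<close>)
  have k: "\<delta> / 2 - \<alpha> = - k" by (simp add: k_def)
  have a: "has_left_improper_integral M (\<lambda>u. exp ((u - t) * k)) Y t (V t)"
    if "wide_sense_OU M (- k) Y V" "tendsto_in_prob M (\<lambda>t \<omega>. exp (k * t) * V t \<omega>) (\<lambda>_. 0) at_bot" for V t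
    using that by (rule left_improper_integral_of_OU)
  let ?concl = "(\<forall>t. \<exists>Z. has_left_improper_integral M (\<lambda>u. exp ((u - t) * k)) Y t Z) \<and>
    (\<forall>V. (\<forall>t. has_left_improper_integral M (\<lambda>u. exp ((u - t) * k)) Y t (V t)) \<longrightarrow>
      translatively_stable M \<delta> V \<and> wide_sense_OU M (- k) Y V)"
  have i: ?concl if \<delta>: "0 < \<delta>" and "\<delta> / 2 < \<alpha>"
  proof -
    have kp: "0 < k" using that by (simp add: k_def)
    have lim: "AE \<omega> in M. \<exists>z. ((\<lambda>t. Y t \<omega>) \<longlongrightarrow> z) at_bot"
      using L unfolding Y_def time_changed_def by eventually_elim (rule time_changed_converges_at_bot[OF _ \<delta>])
    have "filterlim (\<lambda>c. t + ln c / \<delta>) at_bot (at_right 0)" for t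
    proof -
      have "filterlim (\<lambda>c. inverse \<delta> * - ln c) at_top (at_right (0::real))"
        using \<delta> ln_at_0 by (intro filterlim_tendsto_pos_mult_at_top[OF tendsto_const]) (auto simp: filterlim_uminus_at_bot)
      then have "filterlim (\<lambda>c. - t + inverse \<delta> * - ln c) at_top (at_right (0::real))"
        by (rule filterlim_tendsto_add_at_top[OF tendsto_const])
      then show ?thesis unfolding filterlim_uminus_at_top by (simp add: divide_inverse mult.commute add.commute)
    qed
    then show ?thesis
      using \<delta> by (intro OU_of_left_improper_integral[OF Y _ W_tail_at_bot[OF kp lim]]) auto
  qed
  have ii: ?concl if \<delta>: "\<delta> < 0" and "- \<delta> / 2 < \<alpha>" and \<gamma>: "- \<delta> / (\<alpha> + \<delta> / 2) < \<gamma>"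
    and sup: "(SUP s\<in>{1 / \<delta> * ln 2..0}. \<integral>\<^sup>+\<omega>. ennreal (\<bar>cadlag_integral (\<lambda>t. exp (t * k)) (\<lambda>t. Y t \<omega>) s 0\<bar> powr \<gamma>) \<partial>M) < \<infinity>" for \<gamma>
  proof -
    have kd: "- \<delta> < k" using that by (simp add: k_def)
    have kp: "0 < k" using kd \<delta> by simp
    have k\<delta>: "k + \<delta> = \<alpha> + \<delta> / 2" by (simp add: k_def)
    have \<gamma>': "- \<delta> / (k + \<delta>) < \<gamma>" using \<gamma> unfolding k\<delta> .
    have "0 < - \<delta> / (k + \<delta>)" using kd \<delta> by (intro divide_pos_pos) auto
    then have \<gamma>0: "0 < \<gamma>" using \<gamma>' by (rule less_trans)
    \<comment> \<open>The hypothesis on \<gamma> reads this way because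
      \<open>\<alpha> + \<delta> / 2 = k + \<delta>\<close>.\<close>
    have "- \<delta> < \<gamma> * (k + \<delta>)" using \<gamma>' kd by (subst (asm) pos_divide_less_eq) auto
    also have "\<dots> \<le> \<gamma> * k" using \<gamma>0 \<delta> by (intro mult_left_mono) auto
    finally have k\<gamma>: "- \<delta> < k * \<gamma>" by (simp add: mult.commute)
    \<comment> \<open>Orders above 1 are lowered to 1 for the sake of subadditivity. The decay
      condition persists: for \<open>g = 1\<close> it is \<open>- \<delta> < k\<close>, otherwise it
      is \<open>k\<gamma>\<close>.\<close>
    define g where "g = min 1 \<gamma>"
    have g: "0 < g" "g \<le> 1" "- \<delta> < k * g" "g \<le> \<gamma>" using \<gamma>0 k\<gamma> kd by (auto simp: g_def min_def)
    define S where "S = (SUP s\<in>{1 / \<delta> * ln 2..0}. \<integral>\<^sup>+\<omega>. ennreal (\<bar>cadlag_integral (\<lambda>t. exp (t * k)) (\<lambda>t. Y t \<omega>) s 0\<bar> powr \<gamma>) \<partial>M)"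
    have "S < \<infinity>" using sup by (simp only: S_def)
    then obtain K0 where K0: "0 \<le> K0" "S = ennreal K0" by (cases S) auto
    have mom: "(\<integral>\<^sup>+\<omega>. ennreal (\<bar>W 0 \<omega> - W s \<omega>\<bar> powr g) \<partial>M) \<le> ennreal (1 + K0)" if s: "s \<in> {ln 2 / \<delta>..0}" for s
    proof -
      \<comment> \<open>The assumed moments of order \<gamma> dominate those of the lower order
        \<open>g\<close> up to the additive constant 1.\<close>
      have "x powr g \<le> 1 + x powr \<gamma>" if "0 \<le> x" for x
        using that powr_mono[OF g(4), of x] powr_le_one_le[of x] powr_mono2[of g x 1] g(1)
        by (cases "x \<le> 1") (auto intro: add_increasing2 add_increasing)
      then have "(\<integral>\<^sup>+\<omega>. ennreal (\<bar>W 0 \<omega> - W s \<omega>\<bar> powr g) \<partial>M) \<le> (\<integral>\<^sup>+\<omega>. 1 + ennreal (\<bar>W 0 \<omega> - W s \<omega>\<bar> powr \<gamma>) \<partial>M)"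
        by (intro nn_integral_mono) (simp add: ennreal_leI flip: ennreal_1 ennreal_plus)
      also have "\<dots> = 1 + (\<integral>\<^sup>+\<omega>. ennreal (\<bar>W 0 \<omega> - W s \<omega>\<bar> powr \<gamma>) \<partial>M)"
        by (subst nn_integral_add) (auto simp: emeasure_space_1)
      also have "(\<integral>\<^sup>+\<omega>. ennreal (\<bar>W 0 \<omega> - W s \<omega>\<bar> powr \<gamma>) \<partial>M) = (\<integral>\<^sup>+\<omega>. ennreal (\<bar>cadlag_integral (\<lambda>t. exp (t * k)) (\<lambda>t. Y t \<omega>) s 0\<bar> powr \<gamma>) \<partial>M)"
        by (rule nn_integral_cong_AE) (use cadlag_integral_W in eventually_elim, simp add: mult.commute)
      also have "\<dots> \<le> ennreal K0" unfolding K0(2)[symmetric] S_def using s by (intro SUP_upper) simp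
      finally show ?thesis using K0(1) by (simp add: add_left_mono)
    qed
    have conv: "AE \<omega> in M. \<exists>l. ((\<lambda>t. W t \<omega>) \<longlongrightarrow> l) at_bot"
      by (rule AE_convergent_at_bot_if_Cauchy_in_prob[OF W_measurable W_right_continuous W_independent_increments])
        (rule W_Cauchy_in_prob[OF \<delta> g(1-3) _ mom], use K0 in auto)
    have lim: "AE \<omega> in M. \<exists>z. ((\<lambda>t. Y t \<omega>) \<longlongrightarrow> z) at_top"
      using L unfolding Y_def time_changed_def by eventually_elim (rule time_changed_converges_at_top[OF _ \<delta>])
    have tail: "AE \<omega> in M. \<forall>l. ((\<lambda>t. W t \<omega>) \<longlongrightarrow> l) at_bot \<longrightarrow> ((\<lambda>t. exp (- k * t) * (W t \<omega> - l)) \<longlongrightarrow> 0) at_top"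
      using W_tail_at_top[OF kp lim] by eventually_elim blast
    have "filterlim (\<lambda>c. t + ln c / \<delta>) at_top (at_right 0)" for t
    proof -
      have "filterlim (\<lambda>c. inverse (- \<delta>) * - ln c) at_top (at_right (0::real))"
        using \<delta> ln_at_0 by (intro filterlim_tendsto_pos_mult_at_top[OF tendsto_const]) (auto simp: filterlim_uminus_at_bot)
      then have "filterlim (\<lambda>c. t + inverse (- \<delta>) * - ln c) at_top (at_right (0::real))"
        by (rule filterlim_tendsto_add_at_top[OF tendsto_const])
      then show ?thesis using \<delta> by (simp add: divide_inverse mult.commute)
    qed
    then show ?thesis using \<delta> by (intro OU_of_left_improper_integral[OF Y _ conv tail]) auto
  qed
  show ?thesis
    unfolding k k_def[symmetric] Y_def[symmetric]
  proof (rule conjI, goal_cases)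
    case 1
    show ?case using a by blast
  next
    case 2
    show ?case using i ii by blast
  qed
qed

end
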